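(* Let $n\in\mathbb Z_{>0}$, $\tau\in\mathbb H$, $\widetilde B\in\mathbb C$. The non-even isomonodromic family $\{\mathrm{GLE}^{(1)}_n(p,T,\tau): p\in E_\tau\setminus E_\tau[2],\ T^2=n(n+1)\wp(p)+\widetilde B\}$ has finite monodromy if and only if its associated classical Lamé equation $\mathrm L_n(\widetilde B,\tau)$: $w''=(n(n+1)\wp(z)+\widetilde B)w$ has finite monodromy.
   Context: Notation: $E_\tau=\mathbb C/(\mathbb Z+\mathbb Z\tau)$; $\wp,\zeta$ are the Weierstrass functions. $\mathrm{GLE}^{(1)}_n(p,T,\tau)$ is $y''=q^{(1)}_n(z;p,T)y$ with $$q_n^{(1)}=n(n+1)\wp(z)+\tfrac34(\wp(z+p)+\wp(z-p))+T(\zeta(z+p)+\zeta(z-p)-2\zeta(z))-\tfrac{\wp''(p)}{4\wp'(p)}(\zeta(z+p)-\zeta(z-p))+B,$$ $B=T^2+\frac{\wp''(p)}{2\wp'(p)}\zeta(p)-\frac12(2n^2+2n-3)\wp(p)$. It is log-free at $0,\pm p$, with local monodromy $I$ at $0$ and $-I$ at $\pm p$. All members of the family have the same period monodromy up to conjugation. "Finite monodromy" means that the monodromy group (equivalently the group generated by the two period monodromy matrices along $z\to z+1$ and $z\to z+\tau$) is finite; for a family, that this holds for its (common) monodromy. *)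

theory Defs
  imports "HOL-Complex_Analysis.Complex_Analysis"
begin

section \<open>Weierstrass functions\<close>

definition period_lattice :: "complex \<Rightarrow> complex set" where
  "period_lattice \<tau> = {of_int a + of_int b * \<tau> | a b. True}"

definition wp :: "complex \<Rightarrow> complex \<Rightarrow> complex" where
  "wp \<tau> z = 1 / z ^ 2 +
     (\<Sum>\<^sub>\<infinity>\<omega>\<in>period_lattice \<tau> - {0}. 1 / (z - \<omega>) ^ 2 - 1 / \<omega> ^ 2)"

definition wzeta :: "complex \<Rightarrow> complex \<Rightarrow> complex" where
  "wzeta \<tau> z = 1 / z +
     (\<Sum>\<^sub>\<infinity>\<omega>\<in>period_lattice \<tau> - {0}. 1 / (z - \<omega>) + 1 / \<omega> + z / \<omega> ^ 2)"


section \<open>Monodromy of \<open>y'' = q y\<close> on the torus\<close>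

text \<open>
  An equation \<open>y'' = q y\<close> on the torus is given by a potential \<open>q\<close> on the complex plane and
  the set \<open>S\<close> of its singular points in the plane; both are invariant under the period lattice.
  Only the germs of solutions at the relevant point matter.
\<close>

definition is_solution_at :: "(complex \<Rightarrow> complex) \<Rightarrow> complex \<Rightarrow> (complex \<Rightarrow> complex) \<Rightarrow> bool" where
  "is_solution_at q z0 y \<longleftrightarrow>
     y analytic_on {z0} \<and> (\<forall>\<^sub>F z in nhds z0. deriv (deriv y) z = q z * y z)"

definition is_fundamental_system ::
    "(complex \<Rightarrow> complex) \<Rightarrow> complex \<Rightarrow> (2 \<Rightarrow> complex \<Rightarrow> complex) \<Rightarrow> bool" where
  "is_fundamental_system q z0 y \<longleftrightarrow>
     (\<forall>i. is_solution_at q z0 (y i)) \<and>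
     (\<forall>c :: complex ^ 2. (\<forall>\<^sub>F z in nhds z0. (\<Sum>i\<in>UNIV. c $ i * y i z) = 0) \<longrightarrow> c = 0)"

text \<open>
  Analytic continuation along a path \<open>\<gamma>\<close> on \<open>[0,1]\<close>: \<open>F t\<close> is a function
  representing the germ at \<open>\<gamma> t\<close>, and nearby germs are direct continuations of each other.
\<close>

definition analytic_continuation_along ::
    "(real \<Rightarrow> complex) \<Rightarrow> (real \<Rightarrow> complex \<Rightarrow> complex) \<Rightarrow> bool" where
  "analytic_continuation_along \<gamma> F \<longleftrightarrow>
     (\<forall>t\<in>{0..1}. F t analytic_on {\<gamma> t} \<and>
        (\<forall>\<^sub>F s in at t within {0..1}. \<forall>\<^sub>F z in nhds (\<gamma> s). F s z = F t z))"

text \<open>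
  Loops based at the image of \<open>z0\<close> in the torus minus the singular points are
  the projections of paths in the plane minus \<open>S\<close> from \<open>z0\<close> to \<open>z0 + \<omega>\<close>, with \<open>\<omega>\<close> a period.
  The monodromy matrix of such a loop expresses the continued fundamental system, translated
  back by \<open>\<omega>\<close>, in terms of the original one.
\<close>

definition monodromy_group ::
    "complex \<Rightarrow> complex set \<Rightarrow> complex \<Rightarrow> (2 \<Rightarrow> complex \<Rightarrow> complex) \<Rightarrow> (complex ^ 2 ^ 2) set"
where
  "monodromy_group \<tau> S z0 y =
     {M. \<exists>\<omega>\<in>period_lattice \<tau>. \<exists>\<gamma> F.
           path \<gamma> \<and> path_image \<gamma> \<subseteq> - S \<and> pathstart \<gamma> = z0 \<and> pathfinish \<gamma> = z0 + \<omega> \<and>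
           (\<forall>i. analytic_continuation_along \<gamma> (F i) \<and>
                (\<forall>\<^sub>F z in nhds z0. F i 0 z = y i z) \<and>
                (\<forall>\<^sub>F z in nhds z0. F i 1 (z + \<omega>) = (\<Sum>j\<in>UNIV. M $ i $ j * y j z)))}"

text \<open>
  Another base point or fundamental system gives a conjugate group, so the choice is irrelevant.
\<close>

definition finite_monodromy :: "complex \<Rightarrow> complex set \<Rightarrow> (complex \<Rightarrow> complex) \<Rightarrow> bool" where
  "finite_monodromy \<tau> S q \<longleftrightarrow>
     (\<exists>z0 y. z0 \<notin> S \<and> is_fundamental_system q z0 y \<and> finite (monodromy_group \<tau> S z0 y))"


section \<open>The two equations\<close>

definition lame_potential :: "nat \<Rightarrow> complex \<Rightarrow> complex \<Rightarrow> complex \<Rightarrow> complex" where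
  "lame_potential n \<tau> B z = of_nat (n * (n + 1)) * wp \<tau> z + B"

definition lame_finite_monodromy :: "nat \<Rightarrow> complex \<Rightarrow> complex \<Rightarrow> bool" where
  "lame_finite_monodromy n \<tau> B \<longleftrightarrow>
     finite_monodromy \<tau> (period_lattice \<tau>) (lame_potential n \<tau> B)"

definition gle1_B :: "nat \<Rightarrow> complex \<Rightarrow> complex \<Rightarrow> complex \<Rightarrow> complex" where
  "gle1_B n \<tau> p T =
     T ^ 2 + deriv (deriv (wp \<tau>)) p / (2 * deriv (wp \<tau>) p) * wzeta \<tau> p
       - 1 / 2 * (2 * of_nat n ^ 2 + 2 * of_nat n - 3) * wp \<tau> p"

definition gle1_potential ::
    "nat \<Rightarrow> complex \<Rightarrow> complex \<Rightarrow> complex \<Rightarrow> complex \<Rightarrow> complex" where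
  "gle1_potential n \<tau> p T z =
     of_nat (n * (n + 1)) * wp \<tau> z
     + 3 / 4 * (wp \<tau> (z + p) + wp \<tau> (z - p))
     + T * (wzeta \<tau> (z + p) + wzeta \<tau> (z - p) - 2 * wzeta \<tau> z)
     - deriv (deriv (wp \<tau>)) p / (4 * deriv (wp \<tau>) p) * (wzeta \<tau> (z + p) - wzeta \<tau> (z - p))
     + gle1_B n \<tau> p T"

definition gle1_singular_points :: "complex \<Rightarrow> complex \<Rightarrow> complex set" where
  "gle1_singular_points \<tau> p =
     {z. z \<in> period_lattice \<tau> \<or> z - p \<in> period_lattice \<tau> \<or> z + p \<in> period_lattice \<tau>}"

definition gle1_finite_monodromy :: "nat \<Rightarrow> complex \<Rightarrow> complex \<Rightarrow> complex \<Rightarrow> bool" where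
  "gle1_finite_monodromy n \<tau> p T \<longleftrightarrow>
     finite_monodromy \<tau> (gle1_singular_points \<tau> p) (gle1_potential n \<tau> p T)"

text \<open>
  The point \<open>p\<close> of the torus, not of order dividing two, is given by a representative in the
  plane; the potential depends only on the class of \<open>p\<close> modulo the period lattice.
\<close>

definition gle1_family :: "nat \<Rightarrow> complex \<Rightarrow> complex \<Rightarrow> (complex \<times> complex) set" where
  "gle1_family n \<tau> B =
     {(p, T). 2 * p \<notin> period_lattice \<tau> \<and> T ^ 2 = of_nat (n * (n + 1)) * wp \<tau> p + B}"

end

(*
  Let g = n(n+1)(wp - wp p), which vanishes exactly at the points p and -p modulo the lattice. On the
  family, g = n(n+1) wp + B - T^2, and then the first-order gauge transformation
  y = (w' - T w) / sqrt g maps the solutions w of the Lame equation to the solutions of the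
  generalized Lame equation, with inverse w = ((sqrt g y)' + T sqrt g y) / g. Since g is elliptic,
  sqrt g is multiplied by 1 or -1 along any path joining two congruent points, so the monodromy
  matrices of the two equations along a common path agree up to sign. A path for the Lame equation
  may meet p or -p, but it can be replaced by a nearby path that avoids them and yields the same
  continuation. That the transformed potential has the stated form comes down to
  wp' = (zeta(z+p) + zeta(z-p) - 2 zeta(z)) (wp - wp p) and wp'' = 6 wp^2 + const, both consequences
  of Liouville's theorem.
*)
theory Submission
  imports Defs
begin

section \<open>The period lattice\<close>

text \<open>On the family the Lame equation reads w'' = (g + T^2) w. With R^2 = g it is one
  component of the first-order system w' = T w + R y, y' = R w - (T + R'/R) y, and eliminating w
  instead of y leaves the generalized equation. So its singular points p and -p are the branch
  points of R, and the coefficient 3/4 belongs to the exponents -1/2 and 3/2 that a factor 1/R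
  produces at a simple zero of g. The signs do no harm to finiteness: each group lies in the union
  of the other and its negative. The two directions are not symmetric, however. A path for the
  generalized equation is already a path for the Lame equation, while the converse needs the detour
  around p and -p; moreover, the base point of the Lame equation may itself be congruent to p or -p
  and has to be moved beforehand. That g has no further zeros is not obtained by counting zeros of
  elliptic functions: wp - wp p solves a homogeneous linear equation of first order whose
  coefficient is regular elsewhere, so another zero would force it to vanish identically.\<close>

lemma period_lattice_iff: "w \<in> period_lattice \<tau> \<longleftrightarrow> (\<exists>a b. w = of_int a + of_int b * \<tau>)"
  by (auto simp: period_lattice_def)

lemma period_latticeI [intro]: "of_int a + of_int b * \<tau> \<in> period_lattice \<tau>"
  by (auto simp: period_lattice_def)

lemma period_lattice_0 [simp]: "0 \<in> period_lattice \<tau>"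
  using period_latticeI[of 0 0 \<tau>] by simp

lemma period_lattice_1 [simp]: "1 \<in> period_lattice \<tau>"
  using period_latticeI[of 1 0 \<tau>] by simp

lemma period_lattice_tau [simp]: "\<tau> \<in> period_lattice \<tau>"
  using period_latticeI[of 0 1 \<tau>] by simp

lemma period_lattice_add:
  assumes "v \<in> period_lattice \<tau>" "w \<in> period_lattice \<tau>"
  shows "v + w \<in> period_lattice \<tau>"
proof -
  obtain a b c d where "v = of_int a + of_int b * \<tau>" "w = of_int c + of_int d * \<tau>"
    using assms by (auto simp: period_lattice_def)
  hence "v + w = of_int (a + c) + of_int (b + d) * \<tau>" by (simp add: algebra_simps)
  thus ?thesis by (simp only: period_latticeI)
qed

lemma period_lattice_minus_iff [simp]: "- w \<in> period_lattice \<tau> \<longleftrightarrow> w \<in> period_lattice \<tau>"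
proof -
  have "- w \<in> period_lattice \<tau>" if w: "w \<in> period_lattice \<tau>" for w
  proof -
    obtain a b where "w = of_int a + of_int b * \<tau>" using w by (auto simp: period_lattice_def)
    hence "- w = of_int (- a) + of_int (- b) * \<tau>" by simp
    thus ?thesis by (simp only: period_latticeI)
  qed
  from this[of w] this[of "- w"] show ?thesis by auto
qed

lemma period_lattice_diff:
  "v \<in> period_lattice \<tau> \<Longrightarrow> w \<in> period_lattice \<tau> \<Longrightarrow> v - w \<in> period_lattice \<tau>"
  using period_lattice_add[of v \<tau> "- w"] by simp

lemma period_lattice_add_iff [simp]:
  "w \<in> period_lattice \<tau> \<Longrightarrow> z + w \<in> period_lattice \<tau> \<longleftrightarrow> z \<in> period_lattice \<tau>"
  using period_lattice_add[of z \<tau> w] period_lattice_diff[of "z + w" \<tau> w] by auto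

lemma period_lattice_diff_iff [simp]:
  "w \<in> period_lattice \<tau> \<Longrightarrow> z - w \<in> period_lattice \<tau> \<longleftrightarrow> z \<in> period_lattice \<tau>"
  using period_lattice_add_iff[of "- w" \<tau> z] by simp

lemma countable_period_lattice: "countable (period_lattice \<tau>)"
proof -
  have "period_lattice \<tau> = (\<lambda>(a, b). of_int a + of_int b * \<tau>) ` (UNIV :: (int \<times> int) set)"
    by (auto simp: period_lattice_def)
  thus ?thesis by simp
qed

text \<open>The lattice is generated by 1 and \<tau>, so a property closed under sums and negatives
  has to be checked on these two. This serves the periodicity of \<open>wp\<close>, whose direct
  argument covers only periods v with v/2 outside the lattice.\<close>

lemma period_induct [consumes 1, case_names one tau add minus]:
  assumes "w \<in> period_lattice \<tau>"
    and "P 1" "P \<tau>"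
    and add: "\<And>v w. v \<in> period_lattice \<tau> \<Longrightarrow> w \<in> period_lattice \<tau> \<Longrightarrow> P v \<Longrightarrow> P w \<Longrightarrow> P (v + w)"
    and minus: "\<And>v. v \<in> period_lattice \<tau> \<Longrightarrow> P v \<Longrightarrow> P (- v)"
  shows "P w"
proof -
  have zero: "P 0" using add[of 1 "- 1"] minus[of 1] assms(2) by simp
  have nat: "of_nat n * v \<in> period_lattice \<tau> \<and> P (of_nat n * v)"
      if "v \<in> period_lattice \<tau>" "P v" for v n
    using that zero
    by (induction n) (auto simp: distrib_right intro: add period_lattice_add)
  have int: "of_int a * v \<in> period_lattice \<tau> \<and> P (of_int a * v)"
      if "v \<in> period_lattice \<tau>" "P v" for v a
  proof (cases "a \<ge> 0")
    case True
    thus ?thesis using nat[of v "nat a"] that by (simp add: of_nat_nat)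
  next
    case False
    thus ?thesis using nat[of v "nat (- a)"] minus[of "of_nat (nat (- a)) * v"] that
      by (auto simp add: of_nat_nat)
  qed
  obtain a b where "w = of_int a * 1 + of_int b * \<tau>"
    using assms(1) by (auto simp: period_lattice_def)
  thus ?thesis using int[of 1 a] int[of \<tau> b] assms(2,3) add
      by (metis period_lattice_1 period_lattice_tau)
qed

locale upper_half_plane =
  fixes \<tau> :: complex
  assumes Im_pos: "Im \<tau> > 0"
begin

abbreviation \<Lambda> :: "complex set" where "\<Lambda> \<equiv> period_lattice \<tau>"

text \<open>If N is the modulus of the lattice point, its imaginary part bounds |b| by N / Im
  \<tau>, and its real part then bounds |a| by N + |b| |Re \<tau>|; the constant C adds up both
  bounds. Discreteness of the lattice and convergence of the lattice sums rest on this
  estimate.\<close>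

lemma norm_lattice_point_ge:
  obtains c where "c > 0"
    "\<And>a b. c * (real_of_int \<bar>a\<bar> + real_of_int \<bar>b\<bar>) \<le> norm (of_int a + of_int b * \<tau>)"
proof
  define C where "C = 1 + \<bar>Re \<tau>\<bar> / Im \<tau> + 1 / Im \<tau>"
  have C: "C > 0" using Im_pos by (auto simp: C_def intro!: add_pos_nonneg)
  show "1 / C > 0" using C by simp
  fix a b :: int
  define N where "N = norm (of_int a + of_int b * \<tau>)"
  have "\<bar>Im (of_int a + of_int b * \<tau>)\<bar> \<le> N" unfolding N_def by (rule abs_Im_le_cmod)
  hence "\<bar>of_int b\<bar> * Im \<tau> \<le> N" using Im_pos by (simp add: abs_mult)
  hence b: "\<bar>real_of_int b\<bar> \<le> N / Im \<tau>" using Im_pos by (simp add: field_simps)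
  have "\<bar>Re (of_int a + of_int b * \<tau>)\<bar> \<le> N" unfolding N_def by (rule abs_Re_le_cmod)
  hence "\<bar>real_of_int a\<bar> \<le> N + \<bar>of_int b * Re \<tau>\<bar>" by simp
  also have "\<bar>of_int b * Re \<tau>\<bar> \<le> N / Im \<tau> * \<bar>Re \<tau>\<bar>"
    unfolding abs_mult using b by (rule mult_right_mono) simp
  finally have "\<bar>real_of_int a\<bar> + \<bar>real_of_int b\<bar> \<le> C * N"
    using b by (simp add: C_def algebra_simps)
  thus "1 / C * (real_of_int \<bar>a\<bar> + real_of_int \<bar>b\<bar>) \<le> norm (of_int a + of_int b * \<tau>)"
    using C by (simp add: N_def field_simps)
qed

lemma lattice_point_eq_0_iff: "of_int a + of_int b * \<tau> = 0 \<longleftrightarrow> a = 0 \<and> b = 0"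
proof
  assume "of_int a + of_int b * \<tau> = 0"
  moreover obtain c where "c > 0"
    "\<And>a b. c * (real_of_int \<bar>a\<bar> + real_of_int \<bar>b\<bar>) \<le> norm (of_int a + of_int b * \<tau>)"
    using norm_lattice_point_ge by blast
  ultimately have "c * (real_of_int \<bar>a\<bar> + real_of_int \<bar>b\<bar>) \<le> 0" by (metis norm_zero)
  thus "a = 0 \<and> b = 0" using \<open>c > 0\<close> by (auto simp: mult_le_0_iff)
qed auto

lemma inj_lattice_point: "inj (\<lambda>(a, b). of_int a + of_int b * \<tau>)"
proof (rule injI, clarify)
  fix a b c d :: int
  assume "of_int a + of_int b * \<tau> = of_int c + of_int d * \<tau>"
  hence "of_int (a - c) + of_int (b - d) * \<tau> = 0" by (simp add: algebra_simps)
  thus "a = c \<and> b = d" using lattice_point_eq_0_iff[of "a - c" "b - d"] by simp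
qed

lemma half_period_not_in_lattice: "1 / 2 \<notin> \<Lambda>" "\<tau> / 2 \<notin> \<Lambda>" "1 / 2 + \<tau> / 2 \<notin> \<Lambda>"
proof -
  have *: "even c \<and> even d" if cd: "of_int c / 2 + of_int d / 2 * \<tau> \<in> \<Lambda>" for c d :: int
  proof -
    obtain a b where "of_int c / 2 + of_int d / 2 * \<tau> = of_int a + of_int b * \<tau>"
      using cd unfolding period_lattice_iff by blast
    hence "of_int (c - 2 * a) + of_int (d - 2 * b) * \<tau> = 0" by (simp add: field_simps)
    hence "c = 2 * a" "d = 2 * b" using lattice_point_eq_0_iff[of "c - 2 * a" "d - 2 * b"] by auto
    thus ?thesis by simp
  qed
  show "1 / 2 \<notin> \<Lambda>" using *[of 1 0] by auto
  show "\<tau> / 2 \<notin> \<Lambda>" using *[of 0 1] by auto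
  show "1 / 2 + \<tau> / 2 \<notin> \<Lambda>" using *[of 1 1] by auto
qed

lemma norm_lattice_ge:
  obtains c where "c > 0" "\<And>w. w \<in> \<Lambda> - {0} \<Longrightarrow> c \<le> norm w"
proof -
  obtain c where c: "c > 0"
    "\<And>a b. c * (real_of_int \<bar>a\<bar> + real_of_int \<bar>b\<bar>) \<le> norm (of_int a + of_int b * \<tau>)"
    using norm_lattice_point_ge by blast
  show thesis
  proof (rule that[OF c(1)])
    fix w assume "w \<in> \<Lambda> - {0}"
    then obtain a b where w: "w = of_int a + of_int b * \<tau>"
      unfolding Diff_iff period_lattice_iff by blast
    with \<open>w \<in> \<Lambda> - {0}\<close> have "a \<noteq> 0 \<or> b \<noteq> 0" by auto
    hence "1 \<le> \<bar>a\<bar> + \<bar>b\<bar>" by linarith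
    hence "1 \<le> real_of_int \<bar>a\<bar> + real_of_int \<bar>b\<bar>" by linarith
    hence "c * 1 \<le> c * (real_of_int \<bar>a\<bar> + real_of_int \<bar>b\<bar>)" using c(1)
        by (intro mult_left_mono) auto
    thus "c \<le> norm w" using c(2)[of a b] w by simp
  qed
qed

text \<open>Distinct lattice points have a minimal distance, so every set of them is closed. General
  subsets are allowed because the lattice with one point left out occurs as well:
  \<open>zeta_reg\<close> is holomorphic at the origin, and lattice points need punctured
  neighbourhoods free of other lattice points.\<close>

lemma closed_lattice_subset:
  assumes "A \<subseteq> \<Lambda>"
  shows "closed A"
proof -
  obtain c where c: "c > 0" "\<And>w. w \<in> \<Lambda> - {0} \<Longrightarrow> c \<le> norm w" using norm_lattice_ge by blast
  show ?thesis
  proof (rule discrete_imp_closed[OF c(1)], intro ballI impI)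
    fix x y assume "x \<in> A" "y \<in> A" "dist y x < c"
    moreover from this have "y - x \<in> \<Lambda>" using assms period_lattice_diff by blast
    ultimately show "y = x" using c(2)[of "y - x"] by (auto simp: dist_norm)
  qed
qed

lemma open_minus_lattice: "open (- \<Lambda>)"
  using closed_lattice_subset[of \<Lambda>] by (simp add: open_Compl)

lemma connected_minus_countable: "countable S \<Longrightarrow> connected (- S :: complex set)"
  using connected_open_diff_countable[of "UNIV :: complex set" S]
  by (simp add: Compl_eq_Diff_UNIV connected_UNIV)

lemma connected_minus_lattice: "connected (- \<Lambda>)"
  by (rule connected_minus_countable[OF countable_period_lattice])

section \<open>Convergence of the lattice sums\<close>

lemma summable_int_powr: "(\<lambda>a :: int. (1 + \<bar>real_of_int a\<bar>) powr (-3/2)) summable_on UNIV"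
proof -
  let ?f = "\<lambda>a :: int. (1 + \<bar>real_of_int a\<bar>) powr (-3/2)"
  have "summable (\<lambda>n. real n powr (-3/2))" by (subst summable_real_powr_iff) simp
  hence "summable (\<lambda>n. real (Suc n) powr (-3/2))" by (subst summable_Suc_iff)
  hence "summable (\<lambda>n. norm ((1 + real n) powr (-3/2)))" by (simp add: add_ac)
  hence n: "(\<lambda>n. (1 + real n) powr (-3/2)) summable_on UNIV"
    by (rule norm_summable_imp_summable_on)
  have "?f summable_on range int"
    using n by (subst summable_on_reindex) (auto simp: o_def)
  moreover have "?f summable_on range (\<lambda>n. - int n)"
    using n by (subst summable_on_reindex) (auto simp: o_def inj_on_def)
  ultimately have "?f summable_on (range int \<union> range (\<lambda>n. - int n))"
    by (rule summable_on_union)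
  moreover have "(range int \<union> range (\<lambda>n. - int n)) = UNIV"
    by (auto simp: image_iff) (metis int_cases2)
  ultimately show ?thesis by simp
qed

text \<open>The inverse cube is dominated by a product of a function of a and a function of b, so
  that the sum over pairs is controlled by a product of two sums over the integers. Splitting the
  exponent -3 evenly gives -3/2 for each, which still converges.\<close>

lemma summable_lattice_inverse_cube: "(\<lambda>w. 1 / norm w ^ 3) summable_on (\<Lambda> - {0})"
proof -
  obtain c where c: "c > 0"
    "\<And>a b. c * (real_of_int \<bar>a\<bar> + real_of_int \<bar>b\<bar>) \<le> norm (of_int a + of_int b * \<tau>)"
    using norm_lattice_point_ge by blast
  define s where "s = (\<lambda>a :: int. (1 + \<bar>real_of_int a\<bar>) powr (-3/2))"
  let ?h = "\<lambda>(a, b). of_int a + of_int b * \<tau>"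
  have s: "s summable_on UNIV" unfolding s_def by (rule summable_int_powr)
  have "(\<lambda>x. s (fst x) * s (snd x)) summable_on (SIGMA x:UNIV. UNIV)"
  proof (rule summable_on_SigmaI)
    show "((\<lambda>y. s (fst (x, y)) * s (snd (x, y))) has_sum s x * infsum s UNIV) UNIV" for x
      using s by (auto intro!: has_sum_cmult_right)
    show "(\<lambda>x. s x * infsum s UNIV) summable_on UNIV"
      using s by (rule summable_on_cmult_left)
  qed (auto simp: s_def)
  hence "(\<lambda>x. s (fst x) * s (snd x)) summable_on UNIV" by simp
  hence ss: "(\<lambda>x. 8 / c ^ 3 * (s (fst x) * s (snd x))) summable_on UNIV"
    by (rule summable_on_cmult_right)
  have bound: "1 / norm (?h x) ^ 3 \<le> 8 / c ^ 3 * (s (fst x) * s (snd x))" if "x \<noteq> (0, 0)" for x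
  proof -
    obtain a b where x: "x = (a, b)" by force
    define m where "m = real_of_int \<bar>a\<bar> + real_of_int \<bar>b\<bar>"
    have "1 \<le> \<bar>a\<bar> + \<bar>b\<bar>" using that x by (cases "a = 0") auto
    hence m1: "1 \<le> m" unfolding m_def by linarith
    \<comment> \<open>As m is at least 1, each factor is at most 1 + m and hence at most 2m. The
      power 3/2 turns the square of 2m into 8 m^3, which is where the 8 in the majorant comes
      from.\<close>
    have "(1 + \<bar>real_of_int a\<bar>) * (1 + \<bar>real_of_int b\<bar>) \<le> (2 * m) * (2 * m)"
      using m1 by (intro mult_mono) (auto simp: m_def)
    hence "((1 + \<bar>real_of_int a\<bar>) * (1 + \<bar>real_of_int b\<bar>)) powr (3/2) \<le> ((2 * m)\<^sup>2) powr (3/2)"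
      by (intro powr_mono2) (auto simp: power2_eq_square)
    also have "\<dots> = ((2 * m) powr 2) powr (3/2)" using m1 by simp
    also have "\<dots> = (2 * m) powr 3" unfolding powr_powr by simp
    also have "\<dots> = 8 * m ^ 3" using m1 by (simp add: power_mult_distrib)
    finally have 1: "((1 + \<bar>real_of_int a\<bar>) * (1 + \<bar>real_of_int b\<bar>)) powr (3/2) \<le> 8 * m ^ 3" .
    have 2: "s a * s b = 1 / ((1 + \<bar>real_of_int a\<bar>) * (1 + \<bar>real_of_int b\<bar>)) powr (3/2)"
      by (simp add: s_def powr_mult powr_minus_divide)
    have "1 / (8 * m ^ 3) \<le> s a * s b"
      unfolding 2 using 1 m1 by (intro divide_left_mono mult_pos_pos) auto
    hence "8 / c ^ 3 * (1 / (8 * m ^ 3)) \<le> 8 / c ^ 3 * (s a * s b)"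
      using c by (intro mult_left_mono) auto
    moreover have "8 / c ^ 3 * (1 / (8 * m ^ 3)) = 1 / (c * m) ^ 3"
      by (simp add: power_mult_distrib)
    moreover have "1 / norm (?h x) ^ 3 \<le> 1 / (c * m) ^ 3"
    proof -
      have "(c * m) ^ 3 \<le> norm (?h x) ^ 3"
        using c(2)[of a b] m1 c(1) by (intro power_mono) (auto simp: x m_def)
      moreover have "0 < (c * m) ^ 3" using c(1) m1 by simp
      ultimately show ?thesis by (intro frac_le) auto
    qed
    ultimately show ?thesis by (simp add: x)
  qed
  have *: "(\<lambda>w. 1 / norm w ^ 3) \<circ> ?h summable_on (UNIV - {(0,0)})"
  proof (rule summable_on_comparison_test)
    show "(\<lambda>x. 8 / c ^ 3 * (s (fst x) * s (snd x))) summable_on (UNIV - {(0,0)})"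
      using ss by (rule summable_on_subset_banach) auto
  qed (use bound in auto)
  have "\<Lambda> - {0} = ?h ` (UNIV - {(0,0)})"
  proof (intro set_eqI iffI)
    fix w assume "w \<in> \<Lambda> - {0}"
    then obtain a b where w: "w = of_int a + of_int b * \<tau>"
      unfolding Diff_iff period_lattice_iff by blast
    with \<open>w \<in> \<Lambda> - {0}\<close> have "(a, b) \<noteq> (0, 0)" by auto
    thus "w \<in> ?h ` (UNIV - {(0, 0)})" using w by (intro image_eqI[of _ _ "(a, b)"]) auto
  qed (use lattice_point_eq_0_iff in auto)
  moreover have "inj_on ?h (UNIV - {(0,0)})"
    using inj_lattice_point by (rule inj_on_subset) auto
  ultimately show ?thesis using * by (simp add: summable_on_reindex)
qed

end

section \<open>Weierstrass functions\<close>

context upper_half_plane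
begin

text \<open>The part of the zeta function that is regular at the origin. \<open>wp\<close> and its
  derivative are expressed by the first two derivatives of this function, so a single uniform limit
  yields analyticity of all of them, and the behaviour at 0 gives their principal parts.\<close>

definition zeta_reg :: "complex \<Rightarrow> complex" where
  "zeta_reg z = (\<Sum>\<^sub>\<infinity>w\<in>\<Lambda> - {0}. 1 / (z - w) + 1 / w + z / w ^ 2)"

lemma wzeta_eq: "wzeta \<tau> z = 1 / z + zeta_reg z"
  by (simp add: wzeta_def zeta_reg_def)

lemma open_minus_lattice0: "open (- (\<Lambda> - {0}))"
  by (intro open_Compl closed_lattice_subset) auto

text \<open>The three fractions combine to z^2 / (w^2 (z - w)). On a small disc |w| / |z - w| is
  bounded uniformly in w, so the terms are dominated by a multiple of |w|^(-3) and the M-test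
  applies.\<close>

lemma uniform_limit_zeta_reg:
  assumes "z0 \<notin> \<Lambda> - {0}"
  obtains r where "r > 0" "cball z0 r \<subseteq> - (\<Lambda> - {0})"
    "uniform_limit (cball z0 r) (\<lambda>X z. \<Sum>w\<in>X. 1 / (z - w) + 1 / w + z / w ^ 2) zeta_reg
       (finite_subsets_at_top (\<Lambda> - {0}))"
proof -
  obtain s where s: "s > 0" "cball z0 s \<subseteq> - (\<Lambda> - {0})"
    using assms open_minus_lattice0 open_contains_cball by (metis ComplI)
  \<comment> \<open>With half the radius, all points of the smaller disc keep a distance of more
    than r from every nonzero lattice point.\<close>
  define r where "r = s / 2"
  define R where "R = norm z0 + r"
  have r: "r > 0" using s by (simp add: r_def)
  have "cball z0 r \<subseteq> cball z0 s" using s by (auto simp: r_def)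
  hence sub: "cball z0 r \<subseteq> - (\<Lambda> - {0})" using s(2) by blast
  have "uniform_limit (cball z0 r) (\<lambda>X z. \<Sum>w\<in>X. 1 / (z - w) + 1 / w + z / w ^ 2)
     (\<lambda>z. \<Sum>\<^sub>\<infinity>w\<in>\<Lambda> - {0}. 1 / (z - w) + 1 / w + z / w ^ 2)
     (finite_subsets_at_top (\<Lambda> - {0}))"
  proof (rule Weierstrass_m_test_general)
    show "(\<lambda>w. R\<^sup>2 * (1 + R / r) * (1 / norm w ^ 3)) summable_on \<Lambda> - {0}"
      by (intro summable_on_cmult_right summable_lattice_inverse_cube)
    fix w z assume w: "w \<in> \<Lambda> - {0}" and z: "z \<in> cball z0 r"
    have zw: "z \<noteq> w" using w z sub by auto
    have R: "norm z \<le> R"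
      using z norm_triangle_ineq2[of z z0] by (simp add: R_def dist_norm norm_minus_commute)
    have "w \<notin> cball z0 s" using s w by auto
    hence "2 * r < dist z0 w" by (simp add: r_def)
    also have "\<dots> \<le> dist z0 z + dist z w" by (rule dist_triangle)
    finally have d: "r < norm (z - w)" using z by (simp add: dist_norm)
    have "norm w \<le> norm (z - w) + norm z"
      using norm_triangle_ineq4[of "z - w" z] by (simp add: norm_minus_commute)
    hence "norm w / norm (z - w) \<le> 1 + norm z / norm (z - w)"
      using zw by (simp add: field_simps)
    also have "norm z / norm (z - w) \<le> R / r"
      using R d r norm_ge_zero[of z] by (intro frac_le) linarith+
    finally have q: "norm w / norm (z - w) \<le> 1 + R / r" by simp
    have "1 / (z - w) + 1 / w + z / w ^ 2 = z\<^sup>2 / (w\<^sup>2 * (z - w))"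
      using w zw by (simp add: divide_simps power2_eq_square) algebra
    hence "norm (1 / (z - w) + 1 / w + z / w ^ 2)
        = (norm z)\<^sup>2 * (norm w / norm (z - w)) * (1 / norm w ^ 3)"
      using w by (simp add: norm_divide norm_mult norm_power power2_eq_square power3_eq_cube)
    also have "\<dots> \<le> R\<^sup>2 * (1 + R / r) * (1 / norm w ^ 3)"
      using q R by (intro mult_right_mono mult_mono power_mono) auto
    finally show "norm (1 / (z - w) + 1 / w + z / w ^ 2) \<le> R\<^sup>2 * (1 + R / r) * (1 / norm w ^ 3)" .
  qed
  thus ?thesis using that[OF r sub] by (simp add: zeta_reg_def[abs_def])
qed

lemma zeta_reg_holomorphic: "zeta_reg holomorphic_on - (\<Lambda> - {0})"
proof -
  have "zeta_reg analytic_on {z0}" if z0: "z0 \<notin> \<Lambda> - {0}" for z0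
  proof -
    obtain r where r: "r > 0" "cball z0 r \<subseteq> - (\<Lambda> - {0})"
      "uniform_limit (cball z0 r) (\<lambda>X z. \<Sum>w\<in>X. 1 / (z - w) + 1 / w + z / w ^ 2) zeta_reg
         (finite_subsets_at_top (\<Lambda> - {0}))"
      using uniform_limit_zeta_reg[OF z0] by blast
    have "\<forall>\<^sub>F X in finite_subsets_at_top (\<Lambda> - {0}).
       continuous_on (cball z0 r) (\<lambda>z. \<Sum>w\<in>X. 1 / (z - w) + 1 / w + z / w ^ 2) \<and>
       (\<lambda>z. \<Sum>w\<in>X. 1 / (z - w) + 1 / w + z / w ^ 2) holomorphic_on ball z0 r"
    proof (rule eventually_finite_subsets_at_top_weakI, intro conjI)
      fix X assume "finite X" and X: "X \<subseteq> \<Lambda> - {0}"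
      have "(\<lambda>z. \<Sum>w\<in>X. 1 / (z - w) + 1 / w + z / w ^ 2) holomorphic_on cball z0 r"
        using X r(2) by (intro holomorphic_intros) auto
      thus "continuous_on (cball z0 r) (\<lambda>z. \<Sum>w\<in>X. 1 / (z - w) + 1 / w + z / w ^ 2)"
        "(\<lambda>z. \<Sum>w\<in>X. 1 / (z - w) + 1 / w + z / w ^ 2) holomorphic_on ball z0 r"
        by (auto intro: holomorphic_on_imp_continuous_on holomorphic_on_subset)
    qed
    from holomorphic_uniform_limit[OF this r(3)] have "zeta_reg holomorphic_on ball z0 r"
      by auto
    thus ?thesis using r(1) by (meson analytic_at centre_in_ball open_ball)
  qed
  thus ?thesis using analytic_on_analytic_at analytic_imp_holomorphic by blast
qed

lemma zeta_reg_analytic: "z \<notin> \<Lambda> - {0} \<Longrightarrow> zeta_reg analytic_on {z}"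
  using zeta_reg_holomorphic open_minus_lattice0 by (meson ComplI analytic_at)

text \<open>Locally uniform limits of holomorphic functions may be differentiated term by term. The
  second derivative is included because its series carries no correcting terms that depend on w
  alone.\<close>

lemma has_sum_deriv_zeta_reg:
  assumes z0: "z0 \<notin> \<Lambda> - {0}"
  shows "((\<lambda>w. 1 / w ^ 2 - 1 / (z0 - w) ^ 2) has_sum deriv zeta_reg z0) (\<Lambda> - {0})"
    and "((\<lambda>w. 2 / (z0 - w) ^ 3) has_sum deriv (deriv zeta_reg) z0) (\<Lambda> - {0})"
proof -
  let ?s = "\<lambda>X z. \<Sum>w\<in>X. 1 / (z - w) + 1 / w + z / w ^ 2"
  let ?F = "finite_subsets_at_top (\<Lambda> - {0})"
  obtain r where r: "r > 0" "cball z0 r \<subseteq> - (\<Lambda> - {0})"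
    "uniform_limit (cball z0 r) ?s zeta_reg ?F"
    using uniform_limit_zeta_reg[OF z0] by blast
  have lim: "uniform_limit (ball z0 r) ?s zeta_reg ?F"
    using r(3) by (rule uniform_limit_on_subset) auto
  have holo: "\<forall>\<^sub>F X in ?F. ?s X holomorphic_on ball z0 r"
  proof (rule eventually_finite_subsets_at_top_weakI)
    fix X assume "finite X" and X: "X \<subseteq> \<Lambda> - {0}"
    show "?s X holomorphic_on ball z0 r"
      using X r(2) by (intro holomorphic_intros) (auto simp: subset_iff intro: less_imp_le)
  qed
  have d1: "deriv (?s X) z = (\<Sum>w\<in>X. 1 / w ^ 2 - 1 / (z - w) ^ 2)"
    if "finite X" "X \<subseteq> \<Lambda> - {0}" "z \<notin> \<Lambda> - {0}" for X z
  proof -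
    have "((\<lambda>z. 1 / (z - w) + 1 / w +
        z / w ^ 2) has_field_derivative 1 / w ^ 2 - 1 / (z - w) ^ 2) (at z)"
      if "w \<in> X" for w
    proof -
      have "z \<noteq> w" "w \<noteq> 0" using that \<open>X \<subseteq> _\<close> \<open>z \<notin> _\<close> by auto
      thus ?thesis by (auto intro!: derivative_eq_intros simp: power2_eq_square)
    qed
    thus ?thesis by (intro DERIV_imp_deriv DERIV_sum)
  qed
  have d2: "deriv (deriv (?s X)) z0 = (\<Sum>w\<in>X. 2 / (z0 - w) ^ 3)"
    if X: "finite X" "X \<subseteq> \<Lambda> - {0}" for X
  proof -
    have "\<forall>\<^sub>F z in nhds z0. deriv (?s X) z = (\<Sum>w\<in>X. 1 / w ^ 2 - 1 / (z - w) ^ 2)"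
      using eventually_nhds_in_open[OF open_minus_lattice0, of z0] z0
      by (auto elim!: eventually_mono intro!: d1[OF X])
    hence "deriv (deriv (?s X)) z0 = deriv (\<lambda>z. \<Sum>w\<in>X. 1 / w ^ 2 - 1 / (z - w) ^ 2) z0"
      by (intro deriv_cong_ev) auto
    also have "\<dots> = (\<Sum>w\<in>X. 2 / (z0 - w) ^ 3)"
    proof (intro DERIV_imp_deriv DERIV_sum)
      fix w assume "w \<in> X"
      hence "z0 \<noteq> w" using X z0 by auto
      show "((\<lambda>z. 1 / w ^ 2 - 1 / (z - w) ^ 2) has_field_derivative 2 / (z0 - w) ^ 3) (at z0)"
      proof -
        have cube: "2 * x / (x ^ 2 * x ^ 2) = 2 / x ^ 3" if "x \<noteq> 0" for x :: complex
          using that by (simp add: power2_eq_square power3_eq_cube)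
        have nz: "z0 - w \<noteq> 0" using \<open>z0 \<noteq> w\<close> by simp
        have "((\<lambda>z. 1 / w ^ 2 - 1 / (z - w) ^ 2) has_field_derivative
            2 * (z0 - w) / ((z0 - w) ^ 2 * (z0 - w) ^ 2)) (at z0)"
          using \<open>z0 \<noteq> w\<close> by (auto intro!: derivative_eq_intros) (simp add: divide_simps)
        thus ?thesis unfolding cube[OF nz] .
      qed
    qed
    finally show ?thesis .
  qed
  have "((\<lambda>X. (deriv ^^ 1) (?s X) z0) \<longlongrightarrow> (deriv ^^ 1) zeta_reg z0) ?F"
    by (rule higher_deriv_complex_uniform_limit[OF lim holo]) (use r in auto)
  moreover have "\<forall>\<^sub>F X in ?F. (deriv ^^ 1) (?s X) z0 = (\<Sum>w\<in>X. 1 / w ^ 2 - 1 / (z0 - w) ^ 2)"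
  proof (rule eventually_finite_subsets_at_top_weakI)
    fix X assume "finite X" "X \<subseteq> \<Lambda> - {0}"
    from d1[OF this z0] show "(deriv ^^ 1) (?s X) z0 = (\<Sum>w\<in>X. 1 / w ^ 2 - 1 / (z0 - w) ^ 2)"
      by simp
  qed
  ultimately have "((\<lambda>X. \<Sum>w\<in>X. 1 / w ^ 2 - 1 / (z0 - w) ^ 2) \<longlongrightarrow> (deriv ^^ 1) zeta_reg z0) ?F"
    using tendsto_cong by fast
  thus "((\<lambda>w. 1 / w ^ 2 - 1 / (z0 - w) ^ 2) has_sum deriv zeta_reg z0) (\<Lambda> - {0})"
    by (simp add: has_sum_def)
  have "((\<lambda>X. (deriv ^^ 2) (?s X) z0) \<longlongrightarrow> (deriv ^^ 2) zeta_reg z0) ?F"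
    by (rule higher_deriv_complex_uniform_limit[OF lim holo]) (use r in auto)
  moreover have "\<forall>\<^sub>F X in ?F. (deriv ^^ 2) (?s X) z0 = (\<Sum>w\<in>X. 2 / (z0 - w) ^ 3)"
  proof (rule eventually_finite_subsets_at_top_weakI)
    fix X assume "finite X" "X \<subseteq> \<Lambda> - {0}"
    from d2[OF this] show "(deriv ^^ 2) (?s X) z0 = (\<Sum>w\<in>X. 2 / (z0 - w) ^ 3)"
      unfolding numeral_2_eq_2 by simp
  qed
  ultimately have "((\<lambda>X. \<Sum>w\<in>X. 2 / (z0 - w) ^ 3) \<longlongrightarrow> (deriv ^^ 2) zeta_reg z0) ?F"
    using tendsto_cong by fast
  thus "((\<lambda>w. 2 / (z0 - w) ^ 3) has_sum deriv (deriv zeta_reg) z0) (\<Lambda> - {0})"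
    by (simp add: has_sum_def numeral_2_eq_2)
qed

lemma wp_eq:
  assumes "z \<notin> \<Lambda> - {0}"
  shows "wp \<tau> z = 1 / z ^ 2 - deriv zeta_reg z"
proof -
  have "((\<lambda>w. - (1 / w ^ 2 - 1 / (z - w) ^ 2)) has_sum - deriv zeta_reg z) (\<Lambda> - {0})"
    using has_sum_deriv_zeta_reg(1)[OF assms] by (simp only: has_sum_uminus minus_minus)
  hence "(\<Sum>\<^sub>\<infinity>w\<in>\<Lambda> - {0}. 1 / (z - w) ^ 2 - 1 / w ^ 2) = - deriv zeta_reg z"
    by (intro infsumI) simp
  thus ?thesis by (simp add: wp_def)
qed

section \<open>Parity and periodicity of the Weierstrass functions\<close>

lemma zeta_reg_minus: "zeta_reg (- z) = - zeta_reg z"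
proof -
  have bij: "bij_betw uminus (\<Lambda> - {0}) (\<Lambda> - {0})"
    by (rule bij_betwI[of _ _ _ uminus]) auto
  have eq: "1 / (- z - - w) + 1 / - w + - z / (- w) ^ 2 = - (1 / (z - w) + 1 / w + z / w ^ 2)" for w
    by (simp add: minus_divide_right[symmetric] del: minus_diff_eq flip: minus_diff_eq[of w z])
  have "zeta_reg (- z) = (\<Sum>\<^sub>\<infinity>w\<in>\<Lambda> - {0}. 1 / (- z - - w) + 1 / - w + - z / (- w) ^ 2)"
    unfolding zeta_reg_def
    by (rule infsum_reindex_bij_betw[OF bij, of "\<lambda>w. 1 / (- z - w) + 1 / w +
        - z / w ^ 2", symmetric])
  thus ?thesis unfolding eq infsum_uminus by (simp add: zeta_reg_def)
qed

lemma wzeta_minus: "wzeta \<tau> (- z) = - wzeta \<tau> z"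
  by (simp add: wzeta_eq zeta_reg_minus)

lemma wp_minus: "wp \<tau> (- z) = wp \<tau> z"
proof -
  have bij: "bij_betw uminus (\<Lambda> - {0}) (\<Lambda> - {0})"
    by (rule bij_betwI[of _ _ _ uminus]) auto
  have eq: "1 / (- z - - w) ^ 2 - 1 / (- w) ^ 2 = 1 / (z - w) ^ 2 - 1 / w ^ 2" for w
    by (simp add: power2_commute)
  have "(\<Sum>\<^sub>\<infinity>w\<in>\<Lambda> - {0}. 1 / (- z - w) ^ 2 - 1 / w ^ 2) =
        (\<Sum>\<^sub>\<infinity>w\<in>\<Lambda> - {0}. 1 / (- z - - w) ^ 2 - 1 / (- w) ^ 2)"
    by (rule infsum_reindex_bij_betw[OF bij, of "\<lambda>w. 1 / (- z - w) ^ 2 - 1 / w ^ 2", symmetric])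
  thus ?thesis unfolding eq by (simp add: wp_def)
qed

lemma wzeta_analytic: "z \<notin> \<Lambda> \<Longrightarrow> wzeta \<tau> analytic_on {z}"
  unfolding wzeta_eq[abs_def] by (intro analytic_intros zeta_reg_analytic) auto

lemma eventually_not_lattice: "z \<notin> \<Lambda> \<Longrightarrow> \<forall>\<^sub>F x in nhds z. x \<notin> \<Lambda>"
  using eventually_nhds_in_open[OF open_minus_lattice, of z] by simp

lemma wp_analytic: assumes "z \<notin> \<Lambda>" shows "wp \<tau> analytic_on {z}"
proof -
  have "(\<lambda>z. 1 / z ^ 2 - deriv zeta_reg z) analytic_on {z}"
    using assms by (intro analytic_intros zeta_reg_analytic) auto
  moreover have "\<forall>\<^sub>F x in nhds z. wp \<tau> x = 1 / x ^ 2 - deriv zeta_reg x"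
    using eventually_not_lattice[OF assms] by eventually_elim (simp add: wp_eq)
  ultimately show ?thesis using analytic_at_cong by fast
qed

lemma DERIV_wzeta:
  assumes "z \<notin> \<Lambda>"
  shows "(wzeta \<tau> has_field_derivative - wp \<tau> z) (at z)"
proof -
  have "z \<noteq> 0" using assms by auto
  moreover have "(zeta_reg has_field_derivative deriv zeta_reg z) (at z)"
    using zeta_reg_analytic[of z] assms
        analytic_on_imp_differentiable_at DERIV_deriv_iff_field_differentiable by blast
  ultimately show ?thesis
    unfolding wzeta_eq[abs_def] using assms
    by (auto intro!: derivative_eq_intros simp: wp_eq power2_eq_square)
qed

lemma DERIV_wp: "z \<notin> \<Lambda> \<Longrightarrow> (wp \<tau> has_field_derivative deriv (wp \<tau>) z) (at z)"
  using wp_analytic[of z]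
      analytic_on_imp_differentiable_at DERIV_deriv_iff_field_differentiable by blast

lemma DERIV_wp': "z \<notin> \<Lambda> \<Longrightarrow> (deriv (wp \<tau>) has_field_derivative deriv (deriv (wp \<tau>)) z) (at z)"
  using analytic_deriv[OF wp_analytic[of z]]
      analytic_on_imp_differentiable_at DERIV_deriv_iff_field_differentiable
  by blast

lemma deriv_wp_eq:
  assumes "z \<notin> \<Lambda>"
  shows "deriv (wp \<tau>) z = - 2 / z ^ 3 - deriv (deriv zeta_reg) z"
proof -
  have z: "z \<noteq> 0" "z \<notin> \<Lambda> - {0}" using assms by auto
  have "(deriv zeta_reg has_field_derivative deriv (deriv zeta_reg) z) (at z)"
    using analytic_deriv[OF zeta_reg_analytic[OF z(2)]]
        analytic_on_imp_differentiable_at DERIV_deriv_iff_field_differentiable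
    by blast
  hence "((\<lambda>z. 1 / z ^ 2 - deriv zeta_reg z) has_field_derivative - 2 / z ^ 3 - deriv (deriv zeta_reg) z) (at z)"
    using z by (auto intro!: derivative_eq_intros simp: power2_eq_square power3_eq_cube)
  hence "deriv (\<lambda>z. 1 / z ^ 2 - deriv zeta_reg z) z = - 2 / z ^ 3 - deriv (deriv zeta_reg) z"
    by (rule DERIV_imp_deriv)
  moreover have "\<forall>\<^sub>F x in nhds z. wp \<tau> x = 1 / x ^ 2 - deriv zeta_reg x"
    using eventually_not_lattice[OF assms] by eventually_elim (simp add: wp_eq)
  ultimately show ?thesis using deriv_cong_ev by metis
qed

lemma has_sum_wp':
  assumes "z \<notin> \<Lambda>"
  shows "((\<lambda>w. - 2 / (z - w) ^ 3) has_sum deriv (wp \<tau>) z) \<Lambda>"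
proof -
  have z: "z \<noteq> 0" "z \<notin> \<Lambda> - {0}" using assms by auto
  have "((\<lambda>w. - (2 / (z - w) ^ 3)) has_sum - deriv (deriv zeta_reg) z) (\<Lambda> - {0})"
    using has_sum_deriv_zeta_reg(2)[OF z(2)] by (simp only: has_sum_uminus minus_minus)
  hence "((\<lambda>w. - 2 / (z - w) ^ 3) has_sum (- 2 / (z - 0) ^ 3 +
      - deriv (deriv zeta_reg) z)) (insert 0 (\<Lambda> - {0}))"
    by (intro has_sum_insert) auto
  moreover have "insert 0 (\<Lambda> - {0}) = \<Lambda>" by auto
  ultimately show ?thesis by (simp add: deriv_wp_eq[OF assms])
qed

text \<open>A period merely permutes the terms of the series of -2 / (z - w)^3. The series of
  \<open>wp\<close> has correcting terms and does not allow this shift term by term, hence the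
  detour through the derivative.\<close>

lemma wp'_periodic:
  assumes "z \<notin> \<Lambda>" "v \<in> \<Lambda>"
  shows "deriv (wp \<tau>) (z + v) = deriv (wp \<tau>) z"
proof -
  have bij: "bij_betw (\<lambda>w. w + v) \<Lambda> \<Lambda>"
    using assms(2) by (intro bij_betwI[of _ _ _ "\<lambda>w. w - v"]) auto
  have "((\<lambda>w. - 2 / (z + v - w) ^ 3) has_sum deriv (wp \<tau>) (z + v)) \<Lambda>"
    using has_sum_wp'[of "z + v"] assms by simp
  hence "((\<lambda>w. - 2 / (z + v - (w + v)) ^ 3) has_sum deriv (wp \<tau>) (z + v)) \<Lambda>"
    by (subst has_sum_reindex_bij_betw[OF bij, of "\<lambda>w. - 2 / (z + v - w) ^ 3"])
  thus ?thesis using has_sum_wp'[OF assms(1)] by (simp add: has_sum_unique)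
qed

lemma constant_off_lattice:
  assumes "\<And>z. z \<notin> \<Lambda> \<Longrightarrow> (f has_field_derivative 0) (at z)"
  obtains c where "\<And>z. z \<notin> \<Lambda> \<Longrightarrow> f z = c"
proof -
  have "\<exists>c. \<forall>z\<in>-\<Lambda>. f z = c"
  proof -
    have "continuous_on (- \<Lambda>) f"
      using assms DERIV_isCont continuous_at_imp_continuous_on by (metis ComplD)
    thus ?thesis
      using DERIV_zero_connected_constant[OF connected_minus_lattice open_minus_lattice finite.emptyI, of f]
        assms by (metis ComplD DiffD1)
  qed
  thus ?thesis using that by auto
qed

text \<open>Since the derivative is periodic, wp(z + v) - wp(z) is a constant. At z = -v/2 it equals
  wp(v/2) - wp(-v/2), which is zero by evenness, provided that v/2 is not a lattice point. This
  covers 1 and \<tau>, and the remaining periods follow by generation.\<close>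

lemma wp_periodic:
  assumes "v \<in> \<Lambda>" "z \<notin> \<Lambda>"
  shows "wp \<tau> (z + v) = wp \<tau> z"
proof -
  have half: "wp \<tau> (z + v) = wp \<tau> z" if v: "v \<in> \<Lambda>" "v / 2 \<notin> \<Lambda>" and z: "z \<notin> \<Lambda>" for v z
  proof -
    have "((\<lambda>z. wp \<tau> (z + v) - wp \<tau> z) has_field_derivative 0) (at z)" if z: "z \<notin> \<Lambda>" for z
    proof -
      have "((\<lambda>z. wp \<tau> (z + v)) has_field_derivative deriv (wp \<tau>) z) (at z)"
        using DERIV_wp[of "z + v"] z v(1) wp'_periodic[OF z v(1)] by (simp add: DERIV_shift)
      from DERIV_diff[OF this DERIV_wp[OF z]] show ?thesis by simp
    qed
    then obtain c where c: "\<And>z. z \<notin> \<Lambda> \<Longrightarrow> wp \<tau> (z + v) - wp \<tau> z = c"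
      using constant_off_lattice by blast
    have "wp \<tau> (- (v / 2) + v) - wp \<tau> (- (v / 2)) = c" using c v(2)
        by (metis period_lattice_minus_iff)
    hence "c = 0" by (simp add: wp_minus)
    thus ?thesis using c[OF z] by simp
  qed
  have "\<forall>z. z \<notin> \<Lambda> \<longrightarrow> wp \<tau> (z + v) = wp \<tau> z"
    using assms(1)
  proof (induction rule: period_induct)
    case one
    show ?case using half[of 1] half_period_not_in_lattice by simp
  next
    case tau
    show ?case using half[of \<tau>] half_period_not_in_lattice by simp
  next
    case (add v w)
    thus ?case by (metis add.assoc period_lattice_add_iff)
  next
    case (minus v)
    show ?case
    proof (intro allI impI)
      fix z assume "z \<notin> \<Lambda>"
      hence "wp \<tau> (z + - v + v) = wp \<tau> (z + - v)" using minus
          by (metis period_lattice_add_iff period_lattice_minus_iff)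
      thus "wp \<tau> (z + - v) = wp \<tau> z" by simp
    qed
  qed
  thus ?thesis using assms(2) by blast
qed

text \<open>The quasi-period depends on v but not on z. It therefore cancels in combinations of
  translates with total weight zero, such as zeta(z + p) + zeta(z - p) - 2 zeta(z), which are
  elliptic.\<close>

lemma wzeta_quasi_periodic:
  assumes "v \<in> \<Lambda>"
  obtains \<eta> where "\<And>z. z \<notin> \<Lambda> \<Longrightarrow> wzeta \<tau> (z + v) = wzeta \<tau> z + \<eta>"
proof -
  have "((\<lambda>z. wzeta \<tau> (z + v) - wzeta \<tau> z) has_field_derivative 0) (at z)" if z: "z \<notin> \<Lambda>" for z
  proof -
    have "((\<lambda>z. wzeta \<tau> (z + v)) has_field_derivative - wp \<tau> z) (at z)"
      using DERIV_wzeta[of "z + v"] z assms wp_periodic[OF assms z] by (simp add: DERIV_shift)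
    from DERIV_diff[OF this DERIV_wzeta[OF z]] show ?thesis by simp
  qed
  then obtain c where c: "\<And>z. z \<notin> \<Lambda> \<Longrightarrow> wzeta \<tau> (z + v) - wzeta \<tau> z = c"
    using constant_off_lattice by blast
  show ?thesis using that[of c] c by (metis add.commute diff_eq_eq)
qed

end

section \<open>Elliptic functions\<close>

text \<open>The value of f at z itself is ignored, because total functions take arbitrary values at
  their poles. In this form sums and products of functions with cancelling poles can be handled
  without pole orders.\<close>

definition removable :: "(complex \<Rightarrow> complex) \<Rightarrow> complex \<Rightarrow> bool" where
  "removable f z \<longleftrightarrow> (\<exists>g. g analytic_on {z} \<and> (\<forall>\<^sub>F x in at z. f x = g x))"

lemma removableI: "g analytic_on {z} \<Longrightarrow> \<forall>\<^sub>F x in at z. f x = g x \<Longrightarrow> removable f z"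
  by (auto simp: removable_def)

lemma removable_analytic: "f analytic_on {z} \<Longrightarrow> removable f z"
  by (auto simp: removable_def)

lemma removable_add:
  assumes "removable f z" "removable g z"
  shows "removable (\<lambda>x. f x + g x) z"
proof -
  obtain F G where "F analytic_on {z}" "\<forall>\<^sub>F x in at z. f x = F x"
    "G analytic_on {z}" "\<forall>\<^sub>F x in at z. g x = G x"
    using assms by (auto simp: removable_def)
  thus ?thesis
    by (intro removableI[of "\<lambda>x. F x + G x"] analytic_intros) (auto elim: eventually_elim2)
qed

lemma removable_mult:
  assumes "removable f z" "removable g z"
  shows "removable (\<lambda>x. f x * g x) z"
proof -
  obtain F G where "F analytic_on {z}" "\<forall>\<^sub>F x in at z. f x = F x"
    "G analytic_on {z}" "\<forall>\<^sub>F x in at z. g x = G x"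
    using assms by (auto simp: removable_def)
  thus ?thesis
    by (intro removableI[of "\<lambda>x. F x * G x"] analytic_intros) (auto elim: eventually_elim2)
qed

lemma removable_minus: "removable f z \<Longrightarrow> removable (\<lambda>x. - f x) z"
  using removable_mult[OF removable_analytic[of "\<lambda>_. -1"]] by simp

lemma removable_diff: "removable f z \<Longrightarrow> removable g z \<Longrightarrow> removable (\<lambda>x. f x - g x) z"
  using removable_add[OF _ removable_minus] by simp

lemma removable_cong:
  "\<forall>\<^sub>F x in at z. f x = g x \<Longrightarrow> removable g z \<Longrightarrow> removable f z"
proof -
  assume fg: "\<forall>\<^sub>F x in at z. f x = g x" and "removable g z"
  then obtain G where G: "G analytic_on {z}" "\<forall>\<^sub>F x in at z. g x = G x"
    by (auto simp: removable_def)
  from fg G(2) have "\<forall>\<^sub>F x in at z. f x = G x" by eventually_elim simp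
  with G(1) show ?thesis by (rule removableI)
qed

lemma analytic_shift:
  assumes "f analytic_on {z + c}"
  shows "(\<lambda>x. f (x + c)) analytic_on {z}"
proof -
  have "(\<lambda>x. x + c) analytic_on {z}" by (intro analytic_intros)
  thus ?thesis using analytic_on_compose_gen[of "\<lambda>x. x + c" "{z}" f "{z + c}"] assms
    by (simp add: o_def)
qed

lemma eventually_at_shift:
  fixes z c :: complex
  shows "eventually P (at (z + c)) \<longleftrightarrow> (\<forall>\<^sub>F x in at z. P (x + c))"
  using filtermap_at_shift[of "- c" z] by (simp add: filter_eq_iff eventually_filtermap)

text \<open>A point x different from z has a whole neighbourhood that misses z; this is the
  punctured counterpart of \<open>eventually_eventually\<close>.\<close>

lemma eventually_eventually_at_punctured:
  fixes z :: complex
  assumes "eventually P (at z)"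
  shows "\<forall>\<^sub>F x in at z. eventually P (at x)"
proof -
  obtain S where S: "open S" "z \<in> S" "\<And>x. x \<in> S \<Longrightarrow> x \<noteq> z \<Longrightarrow> P x"
    using assms by (auto simp: eventually_at_topological)
  have "eventually P (at x)" if "x \<in> S - {z}" for x
    using S that eventually_nhds_in_open[of "S - {z}" x]
    by (auto simp: eventually_nhds_conv_at open_delete elim!: eventually_mono)
  moreover have "\<forall>\<^sub>F x in at z. x \<in> S - {z}" using S by (intro eventually_at_in_open)
  ultimately show ?thesis by (auto elim!: eventually_mono)
qed

lemma removable_shift:
  assumes "removable f (z + c)"
  shows "removable (\<lambda>x. f (x + c)) z"
proof -
  obtain g where g: "g analytic_on {z + c}" "\<forall>\<^sub>F x in at (z + c). f x = g x"
    using assms by (auto simp: removable_def)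
  have "\<forall>\<^sub>F x in at z. f (x + c) = g (x + c)" using g(2) by (simp add: eventually_at_shift)
  thus ?thesis using analytic_shift[OF g(1)] by (intro removableI)
qed

lemma analytic_remove_sings:
  assumes "removable f z"
  shows "remove_sings f analytic_on {z}"
proof -
  obtain g where g: "g analytic_on {z}" "\<forall>\<^sub>F x in at z. f x = g x"
    using assms by (auto simp: removable_def)
  have "remove_sings f z = remove_sings g z" using g(2) by (rule remove_sings_cong) auto
  hence 1: "remove_sings f z = g z" using g(1) by simp
  have "\<forall>\<^sub>F x in at z. \<forall>\<^sub>F y in at x. f y = g y"
    using g(2) by (rule eventually_eventually_at_punctured)
  hence "\<forall>\<^sub>F x in at z. remove_sings f x = remove_sings g x"
    by eventually_elim (auto intro: remove_sings_cong)
  moreover have "\<forall>\<^sub>F x in at z. remove_sings g x = g x"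
    using eventually_remove_sings_eq_nhds[OF g(1)] by (simp add: eventually_nhds_conv_at)
  ultimately have "\<forall>\<^sub>F x in at z. remove_sings f x = g x" by eventually_elim simp
  with 1 have "\<forall>\<^sub>F x in nhds z. remove_sings f x = g x" by (simp add: eventually_nhds_conv_at)
  thus ?thesis using g(1) analytic_at_cong by blast
qed

lemma eventually_remove_sings:
  assumes "removable f z"
  shows "\<forall>\<^sub>F x in at z. remove_sings f x = f x"
proof -
  obtain g where g: "g analytic_on {z}" "\<forall>\<^sub>F x in at z. f x = g x"
    using assms by (auto simp: removable_def)
  have "\<forall>\<^sub>F x in at z. \<forall>\<^sub>F y in at x. f y = g y"
    using g(2) by (rule eventually_eventually_at_punctured)
  hence "\<forall>\<^sub>F x in at z. remove_sings f x = remove_sings g x"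
    by eventually_elim (auto intro: remove_sings_cong)
  moreover have "\<forall>\<^sub>F x in at z. remove_sings g x = g x"
    using eventually_remove_sings_eq_nhds[OF g(1)] by (simp add: eventually_nhds_conv_at)
  ultimately show ?thesis using g(2) by eventually_elim simp
qed

lemma eq_of_eventually_eq_at:
  fixes f g :: "complex \<Rightarrow> complex"
  assumes "f analytic_on {z}" "g analytic_on {z}" "\<forall>\<^sub>F x in at z. f x = g x"
  shows "f z = g z"
proof (rule tendsto_unique[of "at z"])
  show "(f \<longlongrightarrow> f z) (at z)" using assms(1) by (simp add: analytic_at_imp_isCont isContD)
  have "(g \<longlongrightarrow> g z) (at z)" using assms(2) by (simp add: analytic_at_imp_isCont isContD)
  thus "(f \<longlongrightarrow> g z) (at z)" using assms(3) tendsto_cong by blast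
qed auto

text \<open>The cofactor is the difference quotient, completed by the derivative at z. It replaces
  power series: a simple pole is cancelled by pulling one factor x - z out of a function that
  vanishes at z.\<close>

lemma analytic_zero_factor:
  assumes "f analytic_on {z}" "f z = 0"
  obtains q where "q analytic_on {z}" "q z = deriv f z" "\<And>x. f x = (x - z) * q x"
proof
  let ?q = "\<lambda>x. if x = z then deriv f z else (f x - f z) / (x - z)"
  obtain S where "open S" "z \<in> S" "f holomorphic_on S" using assms(1) analytic_at by blast
  thus "?q analytic_on {z}" using pole_lemma_open[of f S z] analytic_at by blast
qed (use assms(2) in auto)

context upper_half_plane
begin

section \<open>Liouville's theorem for elliptic functions\<close>

lemma reduce_mod_lattice:
  obtains v s t where "v \<in> \<Lambda>" "z = of_real s + of_real t * \<tau> + v"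
    "0 \<le> s" "s \<le> 1" "0 \<le> t" "t \<le> 1"
proof -
  define y where "y = Im z / Im \<tau>"
  define x where "x = Re z - y * Re \<tau>"
  have z: "z = of_real x + of_real y * \<tau>"
    using Im_pos by (auto simp: complex_eq_iff x_def y_def)
  have "of_int \<lfloor>x\<rfloor> + of_int \<lfloor>y\<rfloor> * \<tau> \<in> \<Lambda>" by (rule period_latticeI)
  moreover have "z = of_real (frac x) + of_real (frac y) * \<tau> + (of_int \<lfloor>x\<rfloor> + of_int \<lfloor>y\<rfloor> * \<tau>)"
    unfolding z by (simp add: frac_def algebra_simps)
  ultimately show ?thesis
    using that[of "of_int \<lfloor>x\<rfloor> + of_int \<lfloor>y\<rfloor> * \<tau>" "frac x" "frac y"]
        by (simp add: less_imp_le[OF frac_lt_1])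
qed

text \<open>With its singularities removed, K becomes entire and, by continuity, periodic at every
  point; its range is then the image of a compact period parallelogram. Periodicity is assumed only
  on punctured neighbourhoods, and the conclusion is restricted to points of analyticity, because K
  may have stray values elsewhere.\<close>

lemma liouville_elliptic:
  assumes rem: "\<And>z. removable K z"
    and per: "\<And>z v. v \<in> \<Lambda> \<Longrightarrow> \<forall>\<^sub>F x in at z. K (x + v) = K x"
  obtains c where "\<And>z. K analytic_on {z} \<Longrightarrow> K z = c"
proof -
  define G where "G = remove_sings K"
  have G: "G analytic_on {z}" for z unfolding G_def by (rule analytic_remove_sings[OF rem])
  hence Gh: "G holomorphic_on UNIV" using analytic_on_analytic_at analytic_imp_holomorphic by blast
  have eq: "\<forall>\<^sub>F x in at z. G x = K x" for z
    unfolding G_def by (rule eventually_remove_sings[OF rem])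
  have perG: "G (z + v) = G z" if v: "v \<in> \<Lambda>" for z v
  proof (rule eq_of_eventually_eq_at[of "\<lambda>z. G (z + v)"])
    have "\<forall>\<^sub>F x in at z. G (x + v) = K (x + v)"
      using eq[of "z + v"] by (simp add: eventually_at_shift)
    with per[OF v, of z] eq[of z] show "\<forall>\<^sub>F x in at z. G (x + v) = G x"
      by eventually_elim simp
  qed (use G analytic_shift in auto)
  let ?D = "(\<lambda>(s, t). of_real s + of_real t * \<tau>) ` ({0..1} \<times> {0..1::real})"
  have "compact ?D"
    by (intro compact_continuous_image compact_Times)
       (auto intro!: continuous_intros simp: case_prod_beta)
  moreover have "continuous_on ?D G"
    using Gh holomorphic_on_imp_continuous_on continuous_on_subset subset_UNIV by metis
  ultimately have "compact (G ` ?D)" by (metis compact_continuous_image)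
  moreover have "range G \<subseteq> G ` ?D"
  proof clarify
    fix z
    obtain v s t where *: "v \<in> \<Lambda>" "z = of_real s + of_real t * \<tau> + v"
      "0 \<le> s" "s \<le> 1" "0 \<le> t" "t \<le> 1" using reduce_mod_lattice .
    hence "G z = G (of_real s + of_real t * \<tau>)" using perG by simp
    moreover have "of_real s + of_real t * \<tau> \<in> ?D"
      using * by (intro image_eqI[of _ _ "(s, t)"]) auto
    ultimately show "G z \<in> G ` ?D" by (metis imageI)
  qed
  ultimately have "bounded (range G)" using bounded_subset compact_imp_bounded by blast
  with Gh have "G constant_on UNIV" by (rule Liouville_theorem)
  then obtain c where c: "\<And>z. G z = c" by (auto simp: constant_on_def)
  show ?thesis
  proof (rule that)
    fix z assume "K analytic_on {z}"
    hence "G z = K z" by (simp add: G_def)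
    thus "K z = c" using c by simp
  qed
qed

lemma removable_periodic:
  assumes "removable K 0" "v \<in> \<Lambda>" "\<And>z v. v \<in> \<Lambda> \<Longrightarrow> \<forall>\<^sub>F x in at z. K (x + v) = K x"
  shows "removable K v"
proof -
  have "removable (\<lambda>x. K (x + - v)) v" using assms(1) by (intro removable_shift) simp
  moreover have "\<forall>\<^sub>F x in at v. K (x + - v) = K x" using assms(2) by (intro assms(3)) simp
  hence "\<forall>\<^sub>F x in at v. K x = K (x + - v)" by eventually_elim simp
  ultimately show ?thesis by (rule removable_cong[rotated])
qed

lemma eventually_at_not_lattice: "\<forall>\<^sub>F x in at z. x \<notin> \<Lambda>"
proof -
  have "open (- (\<Lambda> - {z}))" by (intro open_Compl closed_lattice_subset) auto
  hence "\<forall>\<^sub>F x in at z. x \<in> - (\<Lambda> - {z}) - {z}"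
    by (intro eventually_at_in_open) auto
  thus ?thesis by eventually_elim auto
qed

lemma eventually_at_shift_not_lattice: "\<forall>\<^sub>F x in at z. x + c \<notin> \<Lambda>"
  using eventually_at_not_lattice[of "z + c"] by (simp add: eventually_at_shift)

text \<open>
  An odd elliptic function vanishes at the half periods, so that \<open>k z * k (z + 1/2)\<close> has no poles,
  hence is constant, and its value at \<open>\<tau>/2\<close> is zero.
\<close>

lemma odd_elliptic_simple_pole_eq_0:
  assumes an: "\<And>z. z \<notin> \<Lambda> \<Longrightarrow> k analytic_on {z}"
    and per: "\<And>z v. z \<notin> \<Lambda> \<Longrightarrow> v \<in> \<Lambda> \<Longrightarrow> k (z + v) = k z"
    and odd: "\<And>z. z \<notin> \<Lambda> \<Longrightarrow> k (- z) = - k z"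
    and pole: "removable (\<lambda>x. x * k x) 0"
    and z: "z \<notin> \<Lambda>"
  shows "k z = 0"
proof -
  note half = half_period_not_in_lattice
  have zero: "k (v / 2) = 0" if "v \<in> \<Lambda>" "v / 2 \<notin> \<Lambda>" for v
  proof -
    have "k (- (v / 2) + v) = k (- (v / 2))" using that by (intro per) auto
    also have "- (v / 2) + v = v / 2" by simp
    also have "k (- (v / 2)) = - k (v / 2)" using that odd by simp
    finally show ?thesis by (simp add: eq_neg_iff_add_eq_0 flip: mult_2)
  qed
  \<comment> \<open>The condition on the pole is given at 0; periodicity carries it to every lattice
    point.\<close>
  have rem_pole: "removable (\<lambda>x. (x - z) * k x) z" if "z \<in> \<Lambda>" for z
  proof -
    have "removable (\<lambda>x. (x + - z) * k (x + - z)) z"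
      by (rule removable_shift) (use pole in simp)
    moreover have "\<forall>\<^sub>F x in at z. (x - z) * k x = (x + - z) * k (x + - z)"
      using eventually_at_not_lattice[of z]
      by eventually_elim (use that per[of _ "- z"] in simp)
    ultimately show ?thesis by (rule removable_cong[rotated])
  qed
  \<comment> \<open>The simple pole of one factor meets the zero of the other at the half period c.
    The choices c = 1/2 and c = -1/2 deal with the poles of the first and of the second
    factor.\<close>
  have pz: "removable (\<lambda>x. k x * k (x + c)) z" if c: "2 * c \<in> \<Lambda>" "c \<notin> \<Lambda>" and z: "z \<in> \<Lambda>" for z c
  proof -
    have zc: "z + c \<notin> \<Lambda>" using z c by (simp add: add.commute)
    have "k (z + c) = k (c + z)" by (simp add: add.commute)
    also have "\<dots> = k c" using c z by (intro per)
    also have "k c = 0" using zero[of "2 * c"] c by simp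
    finally obtain q where q: "q analytic_on {z}" "\<And>x. k (x + c) = (x - z) * q x"
      using analytic_zero_factor[of "\<lambda>x. k (x + c)" z] analytic_shift[OF an[OF zc]] by blast
    have "removable (\<lambda>x. ((x - z) * k x) * q x) z"
      by (intro removable_mult rem_pole z removable_analytic q)
    thus ?thesis by (simp add: q(2) mult_ac)
  qed
  have "removable (\<lambda>x. k x * k (x + 1/2)) z" for z
  proof (cases "z \<in> \<Lambda>")
    case True
    thus ?thesis using pz[of "1/2" z] half by simp
  next
    case z: False
    show ?thesis
    proof (cases "z + 1/2 \<in> \<Lambda>")
      case True
      hence "removable (\<lambda>x. k x * k (x + - 1/2)) (z + 1/2)" using pz[of "- 1/2"] half by simp
      hence "removable (\<lambda>x. k (x + 1/2) * k (x + 1/2 + - 1/2)) z" by (rule removable_shift)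
      thus ?thesis by (simp add: mult.commute)
    next
      case False
      thus ?thesis using z an analytic_shift by (intro removable_mult removable_analytic) auto
    qed
  qed
  moreover have "\<forall>\<^sub>F x in at z. k (x + v) * k (x + v + 1/2) = k x * k (x + 1/2)" if "v \<in> \<Lambda>" for z v
    using eventually_at_not_lattice[of z] eventually_at_shift_not_lattice[of "1/2" z]
  proof eventually_elim
    case (elim x)
    have "x + v + 1/2 = x + 1/2 + v" by simp
    thus ?case using per[OF elim(1) that] per[OF elim(2) that] by metis
  qed
  ultimately obtain c where c: "\<And>z. (\<lambda>x. k x * k (x + 1/2)) analytic_on {z} \<Longrightarrow> k z * k (z + 1/2) = c"
    by (rule liouville_elliptic[of "\<lambda>x. k x * k (x + 1/2)"]) (assumption, rule that)
  have an2: "(\<lambda>x. k x * k (x + 1/2)) analytic_on {z}" if "z \<notin> \<Lambda>" "z + 1/2 \<notin> \<Lambda>" for z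
    using that an analytic_shift by (intro analytic_intros) auto
  have "c = 0"
    using c[OF an2, of "\<tau> / 2"] half zero[of \<tau>] by (simp add: add.commute)
  have prod: "k z * k (z + 1/2) = 0" if "z \<notin> \<Lambda>" "z + 1/2 \<notin> \<Lambda>" for z
    using c[OF an2[OF that]] \<open>c = 0\<close> by simp
  have hol: "k holomorphic_on - \<Lambda>"
    using an analytic_on_analytic_at analytic_imp_holomorphic by blast
  show ?thesis
  proof (rule ccontr)
    assume "k z \<noteq> 0"
    hence "\<forall>\<^sub>F x in at z. k x \<noteq> 0"
      using analytic_at_imp_isCont[OF an[OF z]] by (simp add: isCont_def tendsto_imp_eventually_ne)
    hence "\<forall>\<^sub>F x in at z. k x \<noteq> 0 \<and> x \<notin> \<Lambda> \<and> x + 1/2 \<notin> \<Lambda>"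
      using eventually_at_not_lattice[of z] eventually_at_shift_not_lattice[of "1/2" z]
      by eventually_elim auto
    from eventually_happens'[OF at_neq_bot this]
    obtain x where x: "k x \<noteq> 0" "x \<notin> \<Lambda>" "x + 1/2 \<notin> \<Lambda>" by blast
    have "\<forall>\<^sub>F y in nhds x. k y \<noteq> 0 \<and> y \<notin> \<Lambda>"
      using x analytic_at_imp_isCont[OF an[OF x(2)]] eventually_not_lattice
      by (auto simp: eventually_conj_iff isCont_def tendsto_imp_eventually_ne eventually_nhds_conv_at)
    then obtain U where U: "open U" "x \<in> U" "\<And>y. y \<in> U \<Longrightarrow> k y \<noteq> 0 \<and> y \<notin> \<Lambda>"
      by (auto simp: eventually_nhds)
    \<comment> \<open>On U the function k has no zeros, so the vanishing product makes k zero on the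
      translate of U by 1/2. The identity theorem spreads this over the complement of the lattice
      and contradicts the choice of x.\<close>
    let ?V = "((+) (1/2) ` U) \<inter> - \<Lambda>"
    have "k x = 0"
    proof (rule analytic_continuation_open[of ?V "- \<Lambda>" k "\<lambda>_. 0"])
      show "open ?V" using U(1) open_minus_lattice open_translation by blast
      show "?V \<noteq> {}" using U(2) x(3) by (auto simp: add.commute)
      show "k y = 0" if "y \<in> ?V" for y using that U(3) prod by (auto simp: add.commute)
    qed (use hol x open_minus_lattice connected_minus_lattice in auto)
    thus False using x by simp
  qed
qed

end

section \<open>Identities between Weierstrass functions\<close>

context upper_half_plane
begin

lemma wp'_minus:
  assumes "z \<notin> \<Lambda>"
  shows "deriv (wp \<tau>) (- z) = - deriv (wp \<tau>) z"
proof -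
  have "((\<lambda>x. wp \<tau> (- x)) has_field_derivative deriv (wp \<tau>) (- z) * (- 1)) (at z)"
    by (rule DERIV_chain2[of "wp \<tau>"]) (use assms in \<open>auto intro!: DERIV_wp derivative_eq_intros\<close>)
  hence "(wp \<tau> has_field_derivative - deriv (wp \<tau>) (- z)) (at z)" by (simp add: wp_minus)
  from DERIV_unique[OF this DERIV_wp[OF assms]] show ?thesis by (metis minus_minus)
qed

lemma deriv_zeta_reg_0: "deriv zeta_reg 0 = 0"
proof -
  have "((\<lambda>w. 0) has_sum deriv zeta_reg 0) (\<Lambda> - {0})"
    using has_sum_deriv_zeta_reg(1)[of 0] by simp
  from has_sum_unique[OF this has_sum_0] show ?thesis by simp
qed

lemma deriv_deriv_zeta_reg_0: "deriv (deriv zeta_reg) 0 = 0"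
proof -
  let ?s = "deriv (deriv zeta_reg) 0"
  have bij: "bij_betw uminus (\<Lambda> - {0}) (\<Lambda> - {0})"
    by (rule bij_betwI[of _ _ _ uminus]) auto
  have 1: "((\<lambda>w. 2 / (0 - w) ^ 3) has_sum ?s) (\<Lambda> - {0})"
    using has_sum_deriv_zeta_reg(2)[of 0] by simp
  hence "((\<lambda>w. 2 / (0 - - w) ^ 3) has_sum ?s) (\<Lambda> - {0})"
    using has_sum_reindex_bij_betw[OF bij, of "\<lambda>w. 2 / (0 - w) ^ 3"] by simp
  hence "((\<lambda>w. - (2 / (0 - w) ^ 3)) has_sum ?s) (\<Lambda> - {0})" by (simp add: power3_eq_cube)
  hence "((\<lambda>w. 2 / (0 - w) ^ 3) has_sum - ?s) (\<Lambda> - {0})" by (simp only: has_sum_uminus)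
  with 1 have "?s = - ?s" using has_sum_unique by blast
  thus ?thesis by simp
qed

lemma zeta_reg_0: "zeta_reg 0 = 0"
  using zeta_reg_minus[of 0] by simp

text \<open>Near 0 one has wp = 1/x^2 + P with P = x^2 a, hence wp'' = 6/x^4 + P'' and 6 wp^2 =
  6/x^4 + 12 a + 6 P^2. The poles cancel and Liouville's theorem applies. Classically the constant
  is -1/2 times the invariant g_2; what counts below is that it drops out of wp''(z) -
  wp''(p).\<close>

lemma wp''_eq_polynomial:
  obtains C where "\<And>z. z \<notin> \<Lambda> \<Longrightarrow> deriv (deriv (wp \<tau>)) z = 6 * (wp \<tau> z)\<^sup>2 + C"
proof -
  let ?K = "\<lambda>z. deriv (deriv (wp \<tau>)) z - 6 * (wp \<tau> z)\<^sup>2"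
  define P where "P = (\<lambda>z. - deriv zeta_reg z)"
  have an0: "zeta_reg analytic_on {0}" by (rule zeta_reg_analytic) simp
  have P: "P analytic_on {0}" unfolding P_def by (intro analytic_intros an0)
  have "P 0 = 0" by (simp add: P_def deriv_zeta_reg_0)
  then obtain a1 where a1: "a1 analytic_on {0}" "a1 0 = deriv P 0" "\<And>x. P x = (x - 0) * a1 x"
    using analytic_zero_factor[OF P] by blast
  have dP: "deriv P x = - deriv (deriv zeta_reg) x" if "x \<notin> \<Lambda> - {0}" for x
    unfolding P_def
    by (intro DERIV_imp_deriv DERIV_minus)
       (use analytic_deriv[OF zeta_reg_analytic[OF that]]
           analytic_on_imp_differentiable_at DERIV_deriv_iff_field_differentiable in blast)
  \<comment> \<open>P has to vanish to second order at 0, because the cross term 12 P / x^2 of the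
    square must be regular there.\<close>
  have "a1 0 = 0" using dP[of 0] a1(2) by (simp add: deriv_deriv_zeta_reg_0)
  then obtain a where a: "a analytic_on {0}" "\<And>x. a1 x = (x - 0) * a x"
    using analytic_zero_factor[OF a1(1)] by blast
  have Pa: "P x = x\<^sup>2 * a x" for x using a1(3) a(2) by (simp add: power2_eq_square)
  have d2: "deriv (deriv (wp \<tau>)) x = 6 / x ^ 4 + deriv (deriv P) x" if x: "x \<notin> \<Lambda>" for x
  proof -
    have x0: "x \<noteq> 0" "x \<notin> \<Lambda> - {0}" using x by auto
    have "P analytic_on {x}" unfolding P_def by (intro analytic_intros zeta_reg_analytic x0)
    hence "(deriv P has_field_derivative deriv (deriv P) x) (at x)"
      using analytic_deriv analytic_on_imp_differentiable_at DERIV_deriv_iff_field_differentiable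
      by blast
    hence "((\<lambda>x. - 2 / x ^ 3 + deriv P x) has_field_derivative 6 * x\<^sup>2 / (x ^ 3 * x ^ 3) +
        deriv (deriv P) x) (at x)"
      using x0 by (auto intro!: derivative_eq_intros)
    hence "deriv (\<lambda>x. - 2 / x ^ 3 + deriv P x) x = 6 * x\<^sup>2 / (x ^ 3 * x ^ 3) + deriv (deriv P) x"
      by (rule DERIV_imp_deriv)
    also have "6 * x\<^sup>2 / (x ^ 3 * x ^ 3) = 6 / x ^ 4"
      using x0 by (simp add: power_eq_if)
    finally have "deriv (\<lambda>x. - 2 / x ^ 3 + deriv P x) x = 6 / x ^ 4 + deriv (deriv P) x" .
    moreover have "\<forall>\<^sub>F y in nhds x. deriv (wp \<tau>) y = - 2 / y ^ 3 + deriv P y"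
      using eventually_not_lattice[OF x] by eventually_elim (simp add: deriv_wp_eq dP)
    ultimately show ?thesis using deriv_cong_ev by metis
  qed
  have "removable ?K 0"
  proof (rule removableI)
    show "(\<lambda>x. deriv (deriv P) x - 12 * a x - 6 * (P x)\<^sup>2) analytic_on {0}"
      by (intro analytic_intros P a)
    show "\<forall>\<^sub>F x in at 0. ?K x = deriv (deriv P) x - 12 * a x - 6 * (P x)\<^sup>2"
      using eventually_at_not_lattice[of 0]
    proof eventually_elim
      case (elim x)
      hence "x \<noteq> 0" by auto
      have "6 * (1 / x\<^sup>2 + P x)\<^sup>2 = 6 / x ^ 4 + 12 * a x + 6 * (P x)\<^sup>2"
        using \<open>x \<noteq> 0\<close> unfolding Pa by (simp add: field_simps power2_eq_square power4_eq_xxxx)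
      moreover have "wp \<tau> x = 1 / x\<^sup>2 + P x" using elim by (simp add: wp_eq P_def)
      ultimately have "6 * (wp \<tau> x)\<^sup>2 = 6 / x ^ 4 + 12 * a x + 6 * (P x)\<^sup>2" by simp
      thus ?case using d2[OF elim] by simp
    qed
  qed
  moreover have an: "?K analytic_on {z}" if "z \<notin> \<Lambda>" for z
    using that by (intro analytic_intros wp_analytic)
  moreover have per: "?K (z + v) = ?K z" if z: "z \<notin> \<Lambda>" and v: "v \<in> \<Lambda>" for z v
  proof -
    have "((\<lambda>z. deriv (wp \<tau>) (z + v)) has_field_derivative deriv (deriv (wp \<tau>)) (z + v)) (at z)"
      using DERIV_wp'[of "z + v"] z v by (simp add: DERIV_shift)
    moreover have "\<forall>\<^sub>F x in nhds z. deriv (wp \<tau>) (x + v) = deriv (wp \<tau>) x"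
      using eventually_not_lattice[OF z] by eventually_elim (rule wp'_periodic[OF _ v])
    ultimately have "deriv (deriv (wp \<tau>)) (z + v) = deriv (deriv (wp \<tau>)) z"
      using DERIV_imp_deriv deriv_cong_ev by metis
    thus ?thesis using wp_periodic[OF v z] by simp
  qed
  have per': "\<forall>\<^sub>F x in at z. ?K (x + v) = ?K x" if "v \<in> \<Lambda>" for z v
    using eventually_at_not_lattice[of z] by eventually_elim (use per that in blast)
  have "removable ?K z" for z
  proof (cases "z \<in> \<Lambda>")
    case True
    show ?thesis by (rule removable_periodic[OF \<open>removable ?K 0\<close> True per'])
  next
    case False
    show ?thesis by (rule removable_analytic[OF an[OF False]])
  qed
  then obtain C where C: "\<And>z. ?K analytic_on {z} \<Longrightarrow> ?K z = C"
    by (rule liouville_elliptic[of ?K]) (rule per', assumption, rule that)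
  show ?thesis
  proof (rule that)
    fix z assume "z \<notin> \<Lambda>"
    from C[OF an[OF this]] show "deriv (deriv (wp \<tau>)) z = 6 * (wp \<tau> z)\<^sup>2 + C"
      by (simp add: algebra_simps)
  qed
qed

text \<open>
  The difference of both sides is odd and elliptic with at most a simple pole at the origin: at the
  points \<open>\<plusminus>p\<close> the poles of the zeta functions are cancelled by the zeros of \<open>wp z - wp p\<close>.
\<close>

lemma wp'_eq_wzeta:
  assumes p: "p \<notin> \<Lambda>" and z: "z \<notin> \<Lambda>" "z + p \<notin> \<Lambda>" "z - p \<notin> \<Lambda>"
  shows "deriv (wp \<tau>) z =
    (wzeta \<tau> (z + p) + wzeta \<tau> (z - p) - 2 * wzeta \<tau> z) * (wp \<tau> z - wp \<tau> p)"
proof -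
  define f where "f = (\<lambda>z. wp \<tau> z - wp \<tau> p)"
  define h where "h = (\<lambda>z. wzeta \<tau> (z + p) + wzeta \<tau> (z - p) - 2 * wzeta \<tau> z)"
  define K where "K = (\<lambda>z. deriv (wp \<tau>) z - h z * f z)"
  define k where "k = remove_sings K"
  have Kan: "K analytic_on {x}" if "x \<notin> \<Lambda>" "x + p \<notin> \<Lambda>" "x + - p \<notin> \<Lambda>" for x
  proof -
    have "(\<lambda>z. deriv (wp \<tau>) z - (wzeta \<tau> (z + p) + wzeta \<tau> (z +
        - p) - 2 * wzeta \<tau> z) * (wp \<tau> z - wp \<tau> p)) analytic_on {x}"
      using that by (intro analytic_intros wp_analytic wzeta_analytic analytic_shift) auto
    thus ?thesis by (simp add: K_def h_def f_def)
  qed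
  \<comment> \<open>Evenness of \<open>wp\<close> lets both points p and -p be treated at once.
    Quasi-periodicity reduces the pole of the translated zeta function to that at the origin, where
    zeta is 1/x + \<open>zeta_reg\<close>.\<close>
  have wf: "removable (\<lambda>x. wzeta \<tau> (x + c) * f x) z" if c: "c = p \<or> c = - p" and z: "z \<notin> \<Lambda>" for c z
  proof (cases "z + c \<in> \<Lambda>")
    case False
    thus ?thesis using z
      by (intro removable_analytic analytic_intros analytic_shift wzeta_analytic)
         (auto simp: f_def intro!: analytic_intros wp_analytic)
  next
    case True
    have "wp \<tau> z = wp \<tau> (- c + (z + c))" by simp
    also have "\<dots> = wp \<tau> (- c)" using c p True by (intro wp_periodic) auto
    also have "\<dots> = wp \<tau> p" using c by (auto simp: wp_minus)
    finally have "f z = 0" by (simp add: f_def)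
    moreover have "f analytic_on {z}" unfolding f_def by (intro analytic_intros wp_analytic z)
    ultimately obtain q where q: "q analytic_on {z}" "\<And>x. f x = (x - z) * q x"
      using analytic_zero_factor by blast
    obtain \<eta> where \<eta>: "\<And>x. x \<notin> \<Lambda> \<Longrightarrow> wzeta \<tau> (x + (z + c)) = wzeta \<tau> x + \<eta>"
      using wzeta_quasi_periodic[OF True] by blast
    have "(\<lambda>x. zeta_reg (x + - z)) analytic_on {z}"
      by (intro analytic_shift zeta_reg_analytic) simp
    hence "(\<lambda>x. q x + (zeta_reg (x + - z) + \<eta>) * ((x - z) * q x)) analytic_on {z}"
      by (intro analytic_intros q)
    moreover have "\<forall>\<^sub>F x in at z. wzeta \<tau> (x + c) * f x = q x + (zeta_reg (x + - z) +
        \<eta>) * ((x - z) * q x)"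
      using eventually_at_shift_not_lattice[of "- z" z]
    proof eventually_elim
      case (elim x)
      have "x - z \<noteq> 0" using elim by auto
      have "wzeta \<tau> (x + c) = 1 / (x - z) + zeta_reg (x + - z) + \<eta>"
        using \<eta>[OF elim] by (simp add: wzeta_eq add_ac)
      hence "wzeta \<tau> (x + c) * f x = (1 / (x - z) * (x - z)) * q x + (zeta_reg (x + - z) +
          \<eta>) * ((x - z) * q x)"
        unfolding q(2) by (simp only: distrib_right mult.assoc add.assoc)
      also have "1 / (x - z) * (x - z) = 1" using \<open>x - z \<noteq> 0\<close> by simp
      finally show ?case by simp
    qed
    ultimately show ?thesis by (rule removableI)
  qed
  have rem: "removable K z" if "z \<notin> \<Lambda>" for z
  proof -
    have "removable (\<lambda>x. deriv (wp \<tau>) x - (wzeta \<tau> (x + p) * f x + wzeta \<tau> (x + - p) * f x)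
        + 2 * wzeta \<tau> x * f x) z"
      using that by (intro removable_add removable_diff wf)
        (auto intro!: removable_analytic analytic_intros wp_analytic wzeta_analytic simp: f_def)
    thus ?thesis by (simp add: K_def h_def algebra_simps)
  qed
  have kan: "k analytic_on {z}" if "z \<notin> \<Lambda>" for z
    unfolding k_def by (intro analytic_remove_sings rem that)
  have kK: "\<forall>\<^sub>F x in at z. k x = K x" if "z \<notin> \<Lambda>" for z
    unfolding k_def by (intro eventually_remove_sings rem that)
  have kper: "k (z + v) = k z" if z: "z \<notin> \<Lambda>" and v: "v \<in> \<Lambda>" for z v
  proof (rule eq_of_eventually_eq_at[of "\<lambda>z. k (z + v)"])
    obtain \<eta> where \<eta>: "\<And>x. x \<notin> \<Lambda> \<Longrightarrow> wzeta \<tau> (x + v) = wzeta \<tau> x + \<eta>"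
      using wzeta_quasi_periodic[OF v] by blast
    have "\<forall>\<^sub>F x in at z. k (x + v) = K (x + v)"
      using kK[of "z + v"] z v by (simp add: eventually_at_shift)
    thus "\<forall>\<^sub>F x in at z. k (x + v) = k x"
      using eventually_at_not_lattice[of z] eventually_at_shift_not_lattice[of p z]
        eventually_at_shift_not_lattice[of "- p" z] kK[OF z]
    proof eventually_elim
      case (elim x)
      have "wzeta \<tau> (x + v + p) = wzeta \<tau> (x + p) + \<eta>" "wzeta \<tau> (x + v - p) = wzeta \<tau> (x - p) + \<eta>"
        using \<eta>[OF elim(3)] \<eta>[OF elim(4)] by (simp_all add: algebra_simps)
      hence "h (x + v) = h x" using \<eta>[OF elim(2)] by (simp add: h_def)
      moreover have "f (x + v) = f x" using wp_periodic[OF v elim(2)] by (simp add: f_def)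
      ultimately show ?case using wp'_periodic[OF elim(2) v] elim by (simp add: K_def)
    qed
  qed (use z v kan analytic_shift in auto)
  have hodd: "h (- x) = - h x" for x
  proof -
    have "- x + p = - (x - p)" "- x - p = - (x + p)" by simp_all
    thus ?thesis unfolding h_def by (simp only: wzeta_minus) (simp add: algebra_simps)
  qed
  have kodd: "k (- z) = - k z" if z: "z \<notin> \<Lambda>" for z
  proof -
    have "(\<lambda>x. k (- x)) analytic_on {z}"
      using analytic_on_compose_gen[of uminus "{z}" k "{- z}"] kan[of "- z"] z
      by (simp add: o_def analytic_on_neg analytic_on_ident)
    moreover have "\<forall>\<^sub>F x in at z. k (- x) = - k x"
    proof -
      have "\<forall>\<^sub>F x in at z. k (- x) = K (- x)"
        using kK[of "- z"] z by (simp add: filtermap_at_minus[symmetric] eventually_filtermap)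
      thus ?thesis using eventually_at_not_lattice[of z] kK[OF z]
      proof eventually_elim
        case (elim x)
        have "K (- x) = - K x" by (simp add: K_def hodd wp'_minus[OF elim(2)] f_def wp_minus)
        thus ?case using elim by simp
      qed
    qed
    ultimately show ?thesis
      using eq_of_eventually_eq_at[of "\<lambda>x. k (- x)" z "\<lambda>x. - k x"] kan[OF z]
      by (simp add: analytic_on_neg)
  qed
  have "removable (\<lambda>x. x * K x) 0"
  proof -
    define P where "P = (\<lambda>z. - deriv zeta_reg z)"
    define H where "H = (\<lambda>x. wzeta \<tau> (x + p) + wzeta \<tau> (x + - p) - 2 * zeta_reg x)"
    have an0: "zeta_reg analytic_on {0}" by (rule zeta_reg_analytic) simp
    have P: "P analytic_on {0}" unfolding P_def by (intro analytic_intros an0)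
    have H: "H analytic_on {0}" unfolding H_def
      by (intro analytic_intros an0 analytic_shift wzeta_analytic) (use p in auto)
    \<comment> \<open>Near 0, \<open>h\<close> is -2/x + H. The triple poles of \<open>K\<close>
      cancel in any case, but a nonzero H(0) would leave the double pole -H(0)/x^2; oddness of zeta
      excludes it, so that at most a simple pole remains.\<close>
    have "H 0 = 0" by (simp add: H_def zeta_reg_0 wzeta_minus)
    then obtain b where b: "b analytic_on {0}" "\<And>x. H x = (x - 0) * b x"
      using analytic_zero_factor[OF H] by blast
    have "(\<lambda>x. x * deriv P x + 2 * P x - 2 * wp \<tau> p - b x - x * H x * (P x - wp \<tau> p))
        analytic_on {0}"
      by (intro analytic_intros P H b)
    moreover have "\<forall>\<^sub>F x in at 0. x * K x = x * deriv P x +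
        2 * P x - 2 * wp \<tau> p - b x - x * H x * (P x - wp \<tau> p)"
      using eventually_at_not_lattice[of 0]
    proof eventually_elim
      case (elim x)
      hence x: "x \<noteq> 0" "x \<notin> \<Lambda> - {0}" by auto
      have dP: "deriv P x = - deriv (deriv zeta_reg) x" 
        unfolding P_def
        by (intro DERIV_imp_deriv DERIV_minus)
           (use analytic_deriv[OF zeta_reg_analytic[OF x(2)]]
               analytic_on_imp_differentiable_at DERIV_deriv_iff_field_differentiable in blast)
      have 1: "deriv (wp \<tau>) x = - 2 / x ^ 3 + deriv P x" using deriv_wp_eq[OF elim] dP by simp
      have 2: "f x = 1 / x\<^sup>2 + P x - wp \<tau> p" using x by (simp add: f_def wp_eq P_def)
      have 3: "h x = - 2 / x + x * b x"
        using b(2)[of x] by (simp add: h_def H_def wzeta_eq[of x] algebra_simps)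
      show ?case unfolding K_def 1 2 3 b(2)
        using x(1) by (simp add: field_simps power2_eq_square power3_eq_cube)
    qed
    ultimately show ?thesis by (rule removableI)
  qed
  moreover have "\<forall>\<^sub>F x in at 0. x * k x = x * K x"
    using eventually_at_not_lattice[of 0] eventually_at_shift_not_lattice[of p 0]
      eventually_at_shift_not_lattice[of "- p" 0]
    by eventually_elim (simp add: k_def Kan)
  ultimately have "removable (\<lambda>x. x * k x) 0" by (rule removable_cong[rotated])
  from odd_elliptic_simple_pole_eq_0[OF kan kper kodd this z(1)] have "k z = 0" .
  moreover have "k z = K z"
    using Kan[of z] z by (simp add: k_def)
  ultimately show ?thesis by (simp add: K_def h_def f_def)
qed

section \<open>Singular points, zeros of wp - wp p, and the transformed potential\<close>

lemma gle1_singular_points_eq: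
  "gle1_singular_points \<tau> p = \<Lambda> \<union> (+) p ` \<Lambda> \<union> (+) (- p) ` \<Lambda>"
proof (intro set_eqI iffI)
  fix z assume "z \<in> gle1_singular_points \<tau> p"
  hence "z \<in> \<Lambda> \<or> z - p \<in> \<Lambda> \<or> z + p \<in> \<Lambda>" by (simp add: gle1_singular_points_def)
  moreover have "z = p + (z - p)" "z = - p + (z + p)" by simp_all
  ultimately show "z \<in> \<Lambda> \<union> (+) p ` \<Lambda> \<union> (+) (- p) ` \<Lambda>" by blast
qed (auto simp: gle1_singular_points_def)

lemma countable_gle1_singular_points: "countable (gle1_singular_points \<tau> p)"
  unfolding gle1_singular_points_eq by (intro countable_Un countable_image countable_period_lattice)

lemma open_minus_gle1_singular_points: "open (- gle1_singular_points \<tau> p)"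
  unfolding gle1_singular_points_eq
  by (intro open_Compl closed_Un closed_translation closed_lattice_subset order_refl)

text \<open>The double pole at the origin forbids it: for a constant c, the analytic function x^2 (c
  + \<open>deriv zeta_reg x\<close>) would be 1 near 0 and yet vanish at 0.\<close>

lemma wp_not_constant: "\<not> (\<forall>z. z \<notin> \<Lambda> \<longrightarrow> wp \<tau> z = c)"
proof
  assume c: "\<forall>z. z \<notin> \<Lambda> \<longrightarrow> wp \<tau> z = c"
  have an0: "zeta_reg analytic_on {0}" by (rule zeta_reg_analytic) simp
  have "(\<lambda>x. x\<^sup>2 * (c + deriv zeta_reg x)) analytic_on {0}" by (intro analytic_intros an0)
  moreover have "\<forall>\<^sub>F x in at 0. x\<^sup>2 * (c + deriv zeta_reg x) = 1"
    using eventually_at_not_lattice[of 0]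
  proof eventually_elim
    case (elim x)
    hence "x \<noteq> 0" by auto
    have "wp \<tau> x = c" using c elim by blast
    moreover have "wp \<tau> x = 1 / x\<^sup>2 - deriv zeta_reg x" using elim by (intro wp_eq) auto
    ultimately have "c + deriv zeta_reg x = 1 / x\<^sup>2" by (simp add: algebra_simps)
    thus ?case using \<open>x \<noteq> 0\<close> by simp
  qed
  ultimately have "(0::complex)\<^sup>2 * (c + deriv zeta_reg 0) = 1"
    using eq_of_eventually_eq_at[of "\<lambda>x. x\<^sup>2 * (c + deriv zeta_reg x)" 0 "\<lambda>_. 1"] by simp
  thus False by simp
qed

text \<open>The function f = wp - wp p satisfies f' = h f with h holomorphic off the singular
  points. By uniqueness for this linear equation a zero of f there would make f vanish on a disc,
  and then \<open>wp\<close> would be constant.\<close>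

lemma wp_neq_wp:
  assumes p: "p \<notin> \<Lambda>" and z: "z \<notin> gle1_singular_points \<tau> p"
  shows "wp \<tau> z \<noteq> wp \<tau> p"
proof
  assume eq: "wp \<tau> z = wp \<tau> p"
  define f where "f = (\<lambda>z. wp \<tau> z - wp \<tau> p)"
  define h where "h = (\<lambda>z. wzeta \<tau> (z + p) + wzeta \<tau> (z + - p) - 2 * wzeta \<tau> z)"
  obtain r where r: "r > 0" "ball z r \<subseteq> - gle1_singular_points \<tau> p"
    using open_minus_gle1_singular_points z open_contains_ball by (metis ComplI)
  have S: "x \<notin> \<Lambda>" "x + p \<notin> \<Lambda>" "x - p \<notin> \<Lambda>" if "x \<in> ball z r" for x
    using r(2) that by (auto simp: gle1_singular_points_def)
  have "h analytic_on {x}" if "x \<in> ball z r" for x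
    unfolding h_def using S[OF that] by (intro analytic_intros analytic_shift wzeta_analytic) auto
  hence "h holomorphic_on ball z r"
    using analytic_on_analytic_at analytic_imp_holomorphic by blast
  \<comment> \<open>Uniqueness is made explicit with a primitive H of h: the function f exp(-H) has
    derivative zero on the disc.\<close>
  then obtain H where H: "\<And>x. x \<in> ball z r \<Longrightarrow> (H has_field_derivative h x) (at x within ball z r)"
    using holomorphic_convex_primitive'[of "ball z r" h] by auto
  have "((\<lambda>x. f x * exp (- H x)) has_field_derivative 0) (at x)" if x: "x \<in> ball z r" for x
  proof -
    have "(H has_field_derivative h x) (at x)" using H[OF x] at_within_open[OF x] by simp
    moreover have "(f has_field_derivative h x * f x) (at x)"
      using DERIV_wp[of x] S[OF x] wp'_eq_wzeta[OF p, of x]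
      by (auto simp: f_def h_def intro!: derivative_eq_intros)
    ultimately show ?thesis
      by (auto intro!: derivative_eq_intros simp: algebra_simps)
  qed
  hence "\<exists>c. \<forall>x\<in>ball z r. f x * exp (- H x) = c"
    by (intro has_field_derivative_zero_constant) (auto intro: has_field_derivative_at_within)
  then obtain c where c: "\<And>x. x \<in> ball z r \<Longrightarrow> f x * exp (- H x) = c" by blast
  have "f z = 0" using eq by (auto simp: f_def)
  hence "c = 0" using c[of z] r(1) by simp
  hence f0: "f x = 0" if "x \<in> ball z r" for x using c[OF that] by simp
  have "wp \<tau> x = wp \<tau> p" if "x \<notin> \<Lambda>" for x
  proof (rule analytic_continuation_open[of "ball z r" "- \<Lambda>" "wp \<tau>" "\<lambda>_. wp \<tau> p"])
    show "wp \<tau> holomorphic_on - \<Lambda>"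
      using wp_analytic analytic_on_analytic_at analytic_imp_holomorphic by blast
  qed (use r(1) S f0 that open_minus_lattice connected_minus_lattice in \<open>auto simp: f_def\<close>)
  thus False using wp_not_constant by blast
qed

text \<open>This is \<open>wp'_eq_wzeta\<close> with the roles of z and p exchanged. It evaluates
  the difference of zeta functions in the potential; the constant 2 zeta(p) is the one that
  \<open>gle1_B\<close> supplies.\<close>

lemma wzeta_diff_eq:
  assumes p: "p \<notin> \<Lambda>" and z: "z \<notin> gle1_singular_points \<tau> p"
  shows "wzeta \<tau> (z + p) - wzeta \<tau> (z - p) - 2 * wzeta \<tau> p = - deriv (wp \<tau>) p / (wp \<tau> z - wp \<tau> p)"
proof -
  have z': "z \<notin> \<Lambda>" "z + p \<notin> \<Lambda>" "z - p \<notin> \<Lambda>" using z by (auto simp: gle1_singular_points_def)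
  have "p - z \<notin> \<Lambda>" using z'(3) period_lattice_minus_iff[of "z - p" \<tau>] by simp
  hence "deriv (wp \<tau>) p =
    (wzeta \<tau> (p + z) + wzeta \<tau> (p - z) - 2 * wzeta \<tau> p) * (wp \<tau> p - wp \<tau> z)"
    using z' by (intro wp'_eq_wzeta p) (auto simp: add.commute)
  moreover have "wzeta \<tau> (p - z) = - wzeta \<tau> (z - p)" using wzeta_minus[of "z - p"] by simp
  moreover have "wp \<tau> z - wp \<tau> p \<noteq> 0" using wp_neq_wp[OF p z] by simp
  ultimately show ?thesis by (simp add: field_simps)
qed

text \<open>If the derivative vanished at p, then zeta(z + p) - zeta(z - p) would be constantly 2
  zeta(p) by \<open>wzeta_diff_eq\<close>. Near z = p the second term has a pole, while the first is
  regular because 2p is not a lattice point. With z = x + p and after multiplication by x this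
  becomes 1 = 0 at x = 0.\<close>

lemma wp'_nonzero:
  assumes p: "2 * p \<notin> \<Lambda>"
  shows "deriv (wp \<tau>) p \<noteq> 0"
proof
  assume 0: "deriv (wp \<tau>) p = 0"
  have p': "p \<notin> \<Lambda>" using p by (metis mult_2 period_lattice_add)
  have an0: "zeta_reg analytic_on {0}" by (rule zeta_reg_analytic) simp
  have 1: "(\<lambda>x. 1 + x * zeta_reg x) analytic_on {0}" by (intro analytic_intros an0)
  have "(\<lambda>x. wzeta \<tau> (x + 2 * p)) analytic_on {0}"
    using p by (intro analytic_shift wzeta_analytic) auto
  hence 2: "(\<lambda>x. x * (wzeta \<tau> (x + 2 * p) - 2 * wzeta \<tau> p)) analytic_on {0}" by (intro
      analytic_intros)
  have "\<forall>\<^sub>F x in at 0. 1 + x * zeta_reg x = x * (wzeta \<tau> (x + 2 * p) - 2 * wzeta \<tau> p)"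
    using eventually_at_not_lattice[of 0] eventually_at_shift_not_lattice[of p 0]
      eventually_at_shift_not_lattice[of "2 * p" 0]
  proof eventually_elim
    case (elim x)
    hence "x \<noteq> 0" by auto
    have "x + p \<notin> gle1_singular_points \<tau> p"
      using elim by (simp add: gle1_singular_points_def algebra_simps)
    from wzeta_diff_eq[OF p' this] have "wzeta \<tau> x = wzeta \<tau> (x + 2 * p) - 2 * wzeta \<tau> p"
      by (simp add: 0 algebra_simps)
    hence "x * (1 / x + zeta_reg x) = x * (wzeta \<tau> (x + 2 * p) - 2 * wzeta \<tau> p)"
      by (simp add: wzeta_eq[of x])
    thus ?case using \<open>x \<noteq> 0\<close> by (simp add: distrib_left)
  qed
  from eq_of_eventually_eq_at[OF 1 2 this] show False by simp
qed

text \<open>Everything is expressed by f = wp - wp p and h = wp'/f = g'/g. The derivative of h is 2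
  wp(z) - s, with s the sum of the two translates of \<open>wp\<close>, so that wp'' = (h' + h^2) f
  brings in s. The terms with wp''(p)/wp'(p) collapse to a multiple of wp''(p)/f, and this is
  removed by the second-order equation for \<open>wp\<close> at z and at p.\<close>

lemma gle1_potential_eq:
  fixes n :: nat
  assumes p: "2 * p \<notin> \<Lambda>" and T: "T\<^sup>2 = of_nat (n * (n + 1)) * wp \<tau> p + B"
    and n: "n > 0" and z: "z \<notin> gle1_singular_points \<tau> p"
  defines "g \<equiv> of_nat (n * (n + 1)) * (wp \<tau> z - wp \<tau> p)"
    and "g' \<equiv> of_nat (n * (n + 1)) * deriv (wp \<tau>) z"
    and "g'' \<equiv> of_nat (n * (n + 1)) * deriv (deriv (wp \<tau>)) z"
  shows "gle1_potential n \<tau> p T z = T\<^sup>2 + g + T * (g' / g) + 3 / 4 * (g' / g)\<^sup>2 - g'' / (2 * g)"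
proof -
  define N :: complex where "N = of_nat (n * (n + 1))"
  have N: "N \<noteq> 0" unfolding N_def of_nat_eq_0_iff using n by simp
  have p': "p \<notin> \<Lambda>" using p by (metis mult_2 period_lattice_add)
  have z': "z \<notin> \<Lambda>" "z + p \<notin> \<Lambda>" "z - p \<notin> \<Lambda>" using z by (auto simp: gle1_singular_points_def)
  define f where "f = wp \<tau> z - wp \<tau> p"
  have f: "f \<noteq> 0" using wp_neq_wp[OF p' z] by (simp add: f_def)
  define h where "h = (\<lambda>z. wzeta \<tau> (z + p) + wzeta \<tau> (z - p) - 2 * wzeta \<tau> z)"
  have h: "deriv (wp \<tau>) z = h z * f" using wp'_eq_wzeta[OF p' z'] by (simp add: h_def f_def)
  define s where "s = wp \<tau> (z + p) + wp \<tau> (z - p)"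
  have "((\<lambda>x. wzeta \<tau> (x + p)) has_field_derivative - wp \<tau> (z + p)) (at z)"
    "((\<lambda>x. wzeta \<tau> (x + - p)) has_field_derivative - wp \<tau> (z + - p)) (at z)"
    using DERIV_wzeta[of "z + p"] DERIV_wzeta[of "z + - p"] z'
        by (simp_all only: DERIV_shift) simp_all
  hence "(h has_field_derivative 2 * wp \<tau> z - s) (at z)"
    using DERIV_wzeta[OF z'(1)] unfolding h_def s_def by (auto intro!: derivative_eq_intros)
  hence "((\<lambda>x. h x * (wp \<tau> x - wp \<tau> p)) has_field_derivative (2 * wp \<tau> z - s) * f +
      h z * (h z * f)) (at z)"
    using DERIV_wp[OF z'(1)] h by (auto intro!: derivative_eq_intros simp: f_def)
  moreover have "\<forall>\<^sub>F x in nhds z. deriv (wp \<tau>) x = h x * (wp \<tau> x - wp \<tau> p)"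
    using eventually_nhds_in_open[OF open_minus_gle1_singular_points, of z p] z
    by (auto elim!: eventually_mono simp: h_def gle1_singular_points_def intro!: wp'_eq_wzeta p')
  ultimately have h2: "deriv (deriv (wp \<tau>)) z = (2 * wp \<tau> z - s) * f + (h z)\<^sup>2 * f"
    using deriv_cong_ev DERIV_imp_deriv by (metis mult.assoc power2_eq_square)
  obtain C where C: "\<And>z. z \<notin> \<Lambda> \<Longrightarrow> deriv (deriv (wp \<tau>)) z = 6 * (wp \<tau> z)\<^sup>2 + C"
    by (rule wp''_eq_polynomial) (rule that)
  have k: "deriv (deriv (wp \<tau>)) p / (4 * deriv (wp \<tau>) p) * (wzeta \<tau> (z +
      p) - wzeta \<tau> (z - p) - 2 * wzeta \<tau> p)
    = - deriv (deriv (wp \<tau>)) p / (4 * f)"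
    unfolding wzeta_diff_eq[OF p' z] using wp'_nonzero[OF p] f by (simp add: f_def)
  \<comment> \<open>Subtracting wp'' = 6 wp^2 + C at z and at p cancels C, and the difference of
    squares splits off the factor f. So division by f in the next step leaves no pole term.\<close>
  have pp: "deriv (deriv (wp \<tau>)) p = (2 * wp \<tau> z - s) * f + (h z)\<^sup>2 * f - 6 * (wp \<tau> z + wp \<tau> p) * f"
    using C[OF p'] C[OF z'(1)] h2 unfolding f_def by (simp add: algebra_simps power2_eq_square)
  hence k2: "deriv (deriv (wp \<tau>)) p / (4 * f) = ((2 * wp \<tau> z - s) + (h z)\<^sup>2 - 6 * (wp \<tau> z +
      wp \<tau> p)) / 4"
    using f by (simp add: field_simps)
  have gg: "g' / g = h z"
    unfolding g_def g'_def h N_def[symmetric] f_def[symmetric] using N f by simp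
  have ggg: "g'' / (2 * g) = ((2 * wp \<tau> z - s) + (h z)\<^sup>2) / 2"
    unfolding g_def g''_def h2 N_def[symmetric] f_def[symmetric] using N f
        by (simp add: field_simps)
  have NN: "2 * of_nat n ^ 2 + 2 * of_nat n - 3 = 2 * N - 3"
      by (simp add: N_def algebra_simps power2_eq_square)
  define \<kappa> where "\<kappa> = deriv (deriv (wp \<tau>)) p / (4 * deriv (wp \<tau>) p)"
  have k4: "deriv (deriv (wp \<tau>)) p / (2 * deriv (wp \<tau>) p) = 2 * \<kappa>" by (simp add: \<kappa>_def)
  have "gle1_potential n \<tau> p T z = N * wp \<tau> z + 3 / 4 * s + T * h z
     - deriv (deriv (wp \<tau>)) p / (4 * deriv (wp \<tau>) p) * (wzeta \<tau> (z +
         p) - wzeta \<tau> (z - p) - 2 * wzeta \<tau> p)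
     + T\<^sup>2 - 1 / 2 * (2 * N - 3) * wp \<tau> p"
    unfolding gle1_potential_def gle1_B_def NN k4 \<kappa>_def[symmetric]
    by (simp add: N_def s_def h_def algebra_simps)
  also have "\<dots> = N * wp \<tau> z + 3 / 4 * s + T * h z
     + ((2 * wp \<tau> z - s) + (h z)\<^sup>2 - 6 * (wp \<tau> z + wp \<tau> p)) / 4
     + T\<^sup>2 - 1 / 2 * (2 * N - 3) * wp \<tau> p"
    unfolding k using k2 by simp
  also have "\<dots> = T\<^sup>2 + N * f + T * h z + 3 / 4 * (h z)\<^sup>2 - ((2 * wp \<tau> z - s) + (h z)\<^sup>2) / 2"
    by (simp add: f_def field_simps)
  finally show ?thesis unfolding gg ggg by (simp add: g_def N_def f_def)
qed

end

section \<open>Analytic continuation along paths\<close>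

lemma analytic_continuation_along_iff:
  "analytic_continuation_along \<gamma> F \<longleftrightarrow>
    (\<forall>t\<in>{0..1}. F t analytic_on {\<gamma> t} \<and>
       (\<exists>d>0. \<forall>s\<in>{0..1}. \<bar>s - t\<bar> < d \<longrightarrow> (\<forall>\<^sub>F z in nhds (\<gamma> s). F s z = F t z)))"
proof -
  have "(\<forall>\<^sub>F s in at t within {0..1}. \<forall>\<^sub>F z in nhds (\<gamma> s). F s z = F t z) \<longleftrightarrow>
    (\<exists>d>0. \<forall>s\<in>{0..1}. \<bar>s - t\<bar> < d \<longrightarrow> (\<forall>\<^sub>F z in nhds (\<gamma> s). F s z = F t z))" for t
  proof
    assume "\<forall>\<^sub>F s in at t within {0..1}. \<forall>\<^sub>F z in nhds (\<gamma> s). F s z = F t z"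
    then obtain d where d: "d > 0"
      "\<And>s. s \<in> {0..1} \<Longrightarrow> s \<noteq> t \<Longrightarrow> \<bar>s - t\<bar> < d \<Longrightarrow> \<forall>\<^sub>F z in nhds (\<gamma> s). F s z = F t z"
      unfolding eventually_at dist_real_def by blast
    have "\<forall>\<^sub>F z in nhds (\<gamma> s). F s z = F t z" if "s \<in> {0..1}" "\<bar>s - t\<bar> < d" for s
      using d(2)[OF that(1) _ that(2)] by (cases "s = t") auto
    with d(1) show "\<exists>d>0. \<forall>s\<in>{0..1}. \<bar>s - t\<bar> < d \<longrightarrow> (\<forall>\<^sub>F z in nhds (\<gamma> s). F s z = F t z)" by blast
  qed (auto simp: eventually_at dist_real_def)
  thus ?thesis by (simp add: analytic_continuation_along_def)
qed

lemma path_eventually_nhds: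
  assumes "path \<gamma>" "t \<in> {0..1}" "eventually P (nhds (\<gamma> t))"
  obtains d where "d > 0" "\<And>s. s \<in> {0..1} \<Longrightarrow> \<bar>s - t\<bar> < d \<Longrightarrow> P (\<gamma> s)"
proof -
  have "continuous_on {0..1} \<gamma>" using assms(1) by (simp add: path_def)
  hence "(\<gamma> \<longlongrightarrow> \<gamma> t) (at t within {0..1})" using assms(2) by (simp add: continuous_on)
  hence "\<forall>\<^sub>F s in at t within {0..1}. P (\<gamma> s)"
    using assms(3) by (simp add: filterlim_def le_filter_def eventually_filtermap)
  moreover have "P (\<gamma> t)" using assms(3) by (rule eventually_nhds_x_imp_x)
  ultimately show ?thesis using that unfolding eventually_at dist_real_def by metis
qed

text \<open>The whole family of germs is continued along one common path, as a monodromy matrix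
  requires. The path is hidden behind the quantifier, so that it can be cut, concatenated and
  rerouted while only the germs at the ends are kept track of.\<close>

definition joined ::
    "complex set \<Rightarrow> complex \<Rightarrow> ('i \<Rightarrow> complex \<Rightarrow> complex) \<Rightarrow> complex \<Rightarrow> ('i \<Rightarrow> complex \<Rightarrow> complex) \<Rightarrow> bool"
where
  "joined S a y b x \<longleftrightarrow>
     (\<exists>\<gamma> F. path \<gamma> \<and> path_image \<gamma> \<subseteq> - S \<and> pathstart \<gamma> = a \<and> pathfinish \<gamma> = b \<and>
        (\<forall>i. analytic_continuation_along \<gamma> (F i) \<and>
           (\<forall>\<^sub>F z in nhds a. F i 0 z = y i z) \<and> (\<forall>\<^sub>F z in nhds b. F i 1 z = x i z)))"

lemma eventually_nhds_shift:
  fixes z c :: complex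
  shows "eventually P (nhds (z + c)) \<longleftrightarrow> (\<forall>\<^sub>F x in nhds z. P (x + c))"
  using filtermap_nhds_shift[of "- c" z] by (simp add: filter_eq_iff eventually_filtermap)

lemma monodromy_group_iff:
  "M \<in> monodromy_group \<tau> S z0 y \<longleftrightarrow>
    (\<exists>\<omega>\<in>period_lattice \<tau>. joined S z0 y (z0 + \<omega>) (\<lambda>i z. \<Sum>j\<in>UNIV. M $ i $ j * y j (z - \<omega>)))"
  by (simp add: monodromy_group_def joined_def eventually_nhds_shift)

lemma joined_mono: "joined S' a y b x \<Longrightarrow> S \<subseteq> S' \<Longrightarrow> joined S a y b x"
  unfolding joined_def by (elim exE, intro exI) auto

lemma joined_cong:
  assumes "joined S a y b x" "\<And>i. \<forall>\<^sub>F z in nhds a. y i z = y' i z" "\<And>i. \<forall>\<^sub>F z in nhds b. x i z =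
      x' i z"
  shows "joined S a y' b x'"
proof -
  obtain \<gamma> F where *: "path \<gamma>" "path_image \<gamma> \<subseteq> - S" "pathstart \<gamma> = a" "pathfinish \<gamma> = b"
    "\<And>i. analytic_continuation_along \<gamma> (F i)"
    "\<And>i. \<forall>\<^sub>F z in nhds a. F i 0 z = y i z" "\<And>i. \<forall>\<^sub>F z in nhds b. F i 1 z = x i z"
    using assms(1) unfolding joined_def by blast
  have "\<forall>\<^sub>F z in nhds a. F i 0 z = y' i z" for i
    using *(6)[of i] assms(2)[of i] by eventually_elim simp
  moreover have "\<forall>\<^sub>F z in nhds b. F i 1 z = x' i z" for i
    using *(7)[of i] assms(3)[of i] by eventually_elim simp
  ultimately show ?thesis using * unfolding joined_def by blast
qed

text \<open>An open connected set stays path connected when countably many points are removed, and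
  functions analytic on all of it are their own continuation along any path inside.\<close>

lemma joined_local:
  assumes "open U" "connected U" "countable S" "a \<in> U - S" "b \<in> U - S" "\<And>i. y i analytic_on U"
  shows "joined S a y b y"
proof -
  have "path_connected (U - S)"
    using assms by (intro path_connected_open_diff_countable) auto
  then obtain \<gamma> where \<gamma>: "path \<gamma>" "path_image \<gamma> \<subseteq> U - S" "pathstart \<gamma> = a" "pathfinish \<gamma> = b"
    using assms(4,5) unfolding path_connected_def by blast
  have "y i analytic_on {\<gamma> t}" if "t \<in> {0..1}" for i t
    by (rule analytic_on_subset[OF assms(6)[of i]])
        (use \<gamma>(2) that in \<open>unfold path_image_def, blast\<close>)
  hence "analytic_continuation_along \<gamma> (\<lambda>t. y i)" for i
    unfolding analytic_continuation_along_def by simp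
  thus ?thesis unfolding joined_def using \<gamma>
    by (intro exI[of _ \<gamma>] exI[of _ "\<lambda>i t. y i"]) auto
qed

lemma analytic_continuation_along_join:
  assumes \<gamma>1: "path \<gamma>1" and \<gamma>2: "path \<gamma>2" and eq: "pathfinish \<gamma>1 = pathstart \<gamma>2"
    and F: "analytic_continuation_along \<gamma>1 F" and G: "analytic_continuation_along \<gamma>2 G"
    and FG: "\<forall>\<^sub>F z in nhds (pathfinish \<gamma>1). F 1 z = G 0 z"
  shows "analytic_continuation_along (\<gamma>1 +++ \<gamma>2) (\<lambda>t. if t \<le> 1/2 then F (2 * t) else G (2 * t - 1))"
    (is "analytic_continuation_along ?\<gamma> ?H")
  unfolding analytic_continuation_along_iff
proof (intro ballI conjI)
  fix t :: real assume t: "t \<in> {0..1}"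
  show "?H t analytic_on {?\<gamma> t}"
    using F G t by (auto simp: analytic_continuation_along_def joinpaths_def)
  consider "t < 1/2" | "t = 1/2" | "t > 1/2" by linarith
  thus "\<exists>d>0. \<forall>s\<in>{0..1}. \<bar>s - t\<bar> < d \<longrightarrow> (\<forall>\<^sub>F z in nhds (?\<gamma> s). ?H s z = ?H t z)"
  proof cases
    case 1
    then obtain d where d: "d > 0"
      "\<And>s. s \<in> {0..1} \<Longrightarrow> \<bar>s - 2 * t\<bar> < d \<Longrightarrow> \<forall>\<^sub>F z in nhds (\<gamma>1 s). F s z = F (2 * t) z"
      using F t unfolding analytic_continuation_along_iff
          by (metis atLeastAtMost_iff mult_2 field_sum_of_halves add_mono less_imp_le add_nonneg_nonneg)
    show ?thesis
    proof (intro exI[of _ "min (d / 2) (1/2 - t)"] conjI ballI impI)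
      fix s :: real assume "s \<in> {0..1}" "\<bar>s - t\<bar> < min (d / 2) (1/2 - t)"
      hence "s \<le> 1/2" "2 * s \<in> {0..1}" "\<bar>2 * s - 2 * t\<bar> < d" by (auto simp: abs_if split: if_splits)
      thus "\<forall>\<^sub>F z in nhds (?\<gamma> s). ?H s z = ?H t z"
        using d(2)[of "2 * s"] 1 by (simp add: joinpaths_def)
    qed (use d(1) 1 in auto)
  next
    case 3
    hence "2 * t - 1 \<in> {0..1}" using t by auto
    then obtain d where d: "d > 0"
      "\<And>s. s \<in> {0..1} \<Longrightarrow> \<bar>s - (2 * t - 1)\<bar> < d \<Longrightarrow> \<forall>\<^sub>F z in nhds (\<gamma>2 s). G s z = G (2 * t - 1) z"
      using G unfolding analytic_continuation_along_iff by metis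
    show ?thesis
    proof (intro exI[of _ "min (d / 2) (t - 1/2)"] conjI ballI impI)
      fix s :: real assume "s \<in> {0..1}" "\<bar>s - t\<bar> < min (d / 2) (t - 1/2)"
      hence "\<not> s \<le> 1/2" "2 * s - 1 \<in> {0..1}" "\<bar>(2 * s - 1) - (2 * t - 1)\<bar> < d"
        by (auto simp: abs_if split: if_splits)
      thus "\<forall>\<^sub>F z in nhds (?\<gamma> s). ?H s z = ?H t z"
        using d(2)[of "2 * s - 1"] 3 by (simp add: joinpaths_def)
    qed (use d(1) 3 in auto)
  next
    \<comment> \<open>At the junction the germ is F 1. On the right it is compared with G through G
      0, so the agreement of F 1 and G 0 is needed not only at the junction but also near the points
      of the second path shortly after it.\<close>
    case 2
    obtain d1 where d1: "d1 > 0"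
      "\<And>s. s \<in> {0..1} \<Longrightarrow> \<bar>s - 1\<bar> < d1 \<Longrightarrow> \<forall>\<^sub>F z in nhds (\<gamma>1 s). F s z = F 1 z"
      using F unfolding analytic_continuation_along_iff
          by (metis atLeastAtMost_iff order_refl zero_le_one)
    obtain d2 where d2: "d2 > 0"
      "\<And>s. s \<in> {0..1} \<Longrightarrow> \<bar>s - 0\<bar> < d2 \<Longrightarrow> \<forall>\<^sub>F z in nhds (\<gamma>2 s). G s z = G 0 z"
      using G unfolding analytic_continuation_along_iff
          by (metis atLeastAtMost_iff order_refl zero_le_one)
    have "\<forall>\<^sub>F c in nhds (\<gamma>2 0). \<forall>\<^sub>F z in nhds c. F 1 z = G 0 z"
      using FG eq by (simp add: pathstart_def eventually_eventually)
    then obtain d3 where d3: "d3 > 0"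
      "\<And>s. s \<in> {0..1} \<Longrightarrow> \<bar>s - 0\<bar> < d3 \<Longrightarrow> \<forall>\<^sub>F z in nhds (\<gamma>2 s). F 1 z = G 0 z"
      using path_eventually_nhds[OF \<gamma>2, of 0] by auto
    show ?thesis
    proof (intro exI[of _ "min (d1 / 2) (min (d2 / 2) (d3 / 2))"] conjI ballI impI)
      fix s :: real assume s: "s \<in> {0..1}" "\<bar>s - t\<bar> < min (d1 / 2) (min (d2 / 2) (d3 / 2))"
      show "\<forall>\<^sub>F z in nhds (?\<gamma> s). ?H s z = ?H t z"
      proof (cases "s \<le> 1/2")
        case True
        hence "2 * s \<in> {0..1}" "\<bar>2 * s - 1\<bar> < d1" using s 2 by (auto simp: abs_if split: if_splits)
        from d1(2)[OF this] show ?thesis using True by (simp add: joinpaths_def 2)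
      next
        case False
        hence "2 * s - 1 \<in> {0..1}" "\<bar>(2 * s - 1) - 0\<bar> < d2" "\<bar>(2 * s - 1) - 0\<bar> < d3"
            using s 2 by auto
        from d2(2)[OF this(1,2)] d3(2)[OF this(1,3)]
        have "\<forall>\<^sub>F z in nhds (\<gamma>2 (2 * s - 1)). G (2 * s - 1) z = F 1 z" by eventually_elim simp
        thus ?thesis using False by (simp add: joinpaths_def 2)
      qed
    qed (use d1(1) d2(1) d3(1) in auto)
  qed
qed

lemma joined_trans:
  assumes "joined S a x b y" "joined S b y c z"
  shows "joined S a x c z"
proof -
  obtain \<gamma>1 F where 1: "path \<gamma>1" "path_image \<gamma>1 \<subseteq> - S" "pathstart \<gamma>1 = a" "pathfinish \<gamma>1 = b"
    "\<And>i. analytic_continuation_along \<gamma>1 (F i)"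
    "\<And>i. \<forall>\<^sub>F w in nhds a. F i 0 w = x i w" "\<And>i. \<forall>\<^sub>F w in nhds b. F i 1 w = y i w"
    using assms(1) unfolding joined_def by blast
  obtain \<gamma>2 G where 2: "path \<gamma>2" "path_image \<gamma>2 \<subseteq> - S" "pathstart \<gamma>2 = b" "pathfinish \<gamma>2 = c"
    "\<And>i. analytic_continuation_along \<gamma>2 (G i)"
    "\<And>i. \<forall>\<^sub>F w in nhds b. G i 0 w = y i w" "\<And>i. \<forall>\<^sub>F w in nhds c. G i 1 w = z i w"
    using assms(2) unfolding joined_def by blast
  have "\<forall>\<^sub>F w in nhds (pathfinish \<gamma>1). F i 1 w = G i 0 w" for i
    unfolding 1(4) using 1(7)[of i] 2(6)[of i] by eventually_elim simp
  hence "analytic_continuation_along (\<gamma>1 +++ \<gamma>2)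
      (\<lambda>t. if t \<le> 1/2 then F i (2 * t) else G i (2 * t - 1))" for i
    using 1 2 by (intro analytic_continuation_along_join) auto
  thus ?thesis unfolding joined_def using 1 2
    by (intro exI[of _ "\<gamma>1 +++ \<gamma>2"] exI[of _ "\<lambda>i t. if t \<le> 1/2 then F i (2 * t) else G i (2 * t - 1)"])
       (auto simp: path_image_join)
qed

lemma eventually_nhds_not_countable:
  fixes w :: complex
  assumes "eventually P (nhds w)" "countable S"
  obtains c where "c \<notin> S" "P c"
proof -
  obtain U where U: "open U" "w \<in> U" "\<And>x. x \<in> U \<Longrightarrow> P x"
    using assms(1) by (auto simp: eventually_nhds)
  obtain r where r: "r > 0" "ball w r \<subseteq> U" using U open_contains_ball by blast
  hence "\<not> ball w r \<subseteq> S" using assms(2) countable_subset uncountable_ball by blast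
  hence "\<not> U \<subseteq> S" using r by blast
  thus ?thesis using U that by blast
qed

text \<open>
  The property carried along the path is that the continuation reaches every point near
  \<open>\<gamma> t\<close> outside of \<open>S'\<close> along a path which avoids \<open>S'\<close>.
\<close>

lemma joined_avoiding:
  fixes y x :: "'i :: finite \<Rightarrow> complex \<Rightarrow> complex"
  assumes "joined S a y b x" and S': "countable S'" "a \<notin> S'" "b \<notin> S'"
  shows "joined S' a y b x"
proof -
  obtain \<gamma> F where *: "path \<gamma>" "pathstart \<gamma> = a" "pathfinish \<gamma> = b"
    "\<And>i. analytic_continuation_along \<gamma> (F i)"
    "\<And>i. \<forall>\<^sub>F z in nhds a. F i 0 z = y i z" "\<And>i. \<forall>\<^sub>F z in nhds b. F i 1 z = x i z"
    using assms(1) unfolding joined_def by blast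
  \<comment> \<open>The index type is finite, so one disc around the point serves all members of the
    family.\<close>
  have ball: "\<exists>r>0. \<forall>i. F i t analytic_on ball (\<gamma> t) r" if t: "t \<in> {0..1}" for t
  proof -
    have "\<forall>\<^sub>F c in nhds (\<gamma> t). F i t analytic_on {c}" for i
    proof -
      have "F i t analytic_on {\<gamma> t}" using *(4)[of i] t by (simp add:
          analytic_continuation_along_def)
      then obtain U where "open U" "\<gamma> t \<in> U" "F i t holomorphic_on U" using analytic_at by blast
      thus ?thesis using analytic_at[of "F i t"] by (auto simp: eventually_nhds)
    qed
    hence "\<forall>\<^sub>F c in nhds (\<gamma> t). \<forall>i. F i t analytic_on {c}" by (simp add: eventually_all_finite)
    then obtain r where "r > 0" "\<And>c i. dist c (\<gamma> t) < r \<Longrightarrow> F i t analytic_on {c}"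
      unfolding eventually_nhds_metric by blast
    moreover from this have "F i t analytic_on ball (\<gamma> t) r" for i
      by (subst analytic_on_analytic_at) (auto simp: dist_commute)
    ultimately show ?thesis by blast
  qed
  define P where "P = (\<lambda>t. \<forall>\<^sub>F c in nhds (\<gamma> t). c \<notin> S' \<longrightarrow> joined S' a y c (\<lambda>i. F i t))"
  have "P 1"
  proof (rule connected_induction_simple[of "{0..1::real}" 0 1 P])
    obtain r where r: "r > 0" "\<And>i. F i 0 analytic_on ball (\<gamma> 0) r" using ball[of 0] by auto
    have a: "\<gamma> 0 = a" using *(2) by (simp add: pathstart_def)
    have "joined S' a y c (\<lambda>i. F i 0)" if "c \<in> ball a r" "c \<notin> S'" for c
      using joined_cong[OF joined_local[of "ball a r" S' a c "\<lambda>i. F i 0"] *(5), of "\<lambda>i. F i 0"]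
        r S' that a by simp
    thus "P 0" unfolding P_def a
      using eventually_nhds_in_open[of "ball a r" a] r by (auto elim!: eventually_mono)
  next
    fix t :: real assume t: "t \<in> {0..1}"
    obtain r where r: "r > 0" "\<And>i. F i t analytic_on ball (\<gamma> t) r" using ball[OF t] by blast
    have "\<forall>\<^sub>F c in nhds (\<gamma> t). c \<in> ball (\<gamma> t) r" using r by (intro eventually_nhds_in_open) auto
    then obtain d0 where d0: "d0 > 0" "\<And>s. s \<in> {0..1} \<Longrightarrow> \<bar>s - t\<bar> < d0 \<Longrightarrow> \<gamma> s \<in> ball (\<gamma> t) r"
      using path_eventually_nhds[OF *(1) t] by metis
    have "\<forall>\<^sub>F s in at t within {0..1}. \<forall>i. \<forall>\<^sub>F z in nhds (\<gamma> s). F i s z = F i t z"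
      using *(4) t by (simp add: eventually_all_finite analytic_continuation_along_def)
    then obtain d1 where d1: "d1 > 0"
      "\<And>s i. s \<in> {0..1} \<Longrightarrow> s \<noteq> t \<Longrightarrow> \<bar>s - t\<bar> < d1 \<Longrightarrow> \<forall>\<^sub>F z in nhds (\<gamma> s). F i s z = F i t z"
      unfolding eventually_at dist_real_def by blast
    define d where "d = min d0 d1"
    have d: "d > 0" using d0 d1 by (simp add: d_def)
    \<comment> \<open>This condition does not mention s. \<open>PQ\<close> and \<open>QP\<close>
      show that P s is equivalent to it for all s close to t, so P is locally constant on the
      interval; connectedness then carries it from 0 to 1.\<close>
    let ?Q = "\<exists>c\<in>ball (\<gamma> t) r - S'. joined S' a y c (\<lambda>i. F i t)"
    have near: "\<forall>\<^sub>F c in nhds (\<gamma> s). c \<in> ball (\<gamma> t) r \<and> (\<forall>i. \<forall>\<^sub>F z in nhds c. F i s z = F i t z)"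
      if "s \<in> {0..1}" "\<bar>s - t\<bar> < d" for s
    proof -
      have "\<forall>\<^sub>F c in nhds (\<gamma> s). c \<in> ball (\<gamma> t) r"
        using d0(2)[of s] that by (intro eventually_nhds_in_open) (auto simp: d_def)
      moreover have "\<forall>\<^sub>F c in nhds (\<gamma> s). \<forall>i. \<forall>\<^sub>F z in nhds c. F i s z = F i t z"
        using d1(2)[of s] that
        by (cases "s = t") (auto simp: eventually_all_finite eventually_eventually d_def)
      ultimately show ?thesis by eventually_elim simp
    qed
    have PQ: ?Q if "s \<in> {0..1}" "\<bar>s - t\<bar> < d" "P s" for s
    proof -
      from near[OF that(1,2)] that(3)[unfolded P_def]
      have ev: "\<forall>\<^sub>F c in nhds (\<gamma> s). c \<in> ball (\<gamma> t) r \<and> (\<forall>i. \<forall>\<^sub>F z in nhds c. F i s z = F i t z) \<and>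
        (c \<notin> S' \<longrightarrow> joined S' a y c (\<lambda>i. F i s))" by eventually_elim simp
      obtain c where "c \<notin> S'" "c \<in> ball (\<gamma> t) r \<and> (\<forall>i. \<forall>\<^sub>F z in nhds c. F i s z = F i t z) \<and>
        (c \<notin> S' \<longrightarrow> joined S' a y c (\<lambda>i. F i s))"
        by (rule eventually_nhds_not_countable[OF ev S'(1)])
      hence c: "c \<notin> S'" "c \<in> ball (\<gamma> t) r" "\<And>i. \<forall>\<^sub>F z in nhds c. F i s z = F i t z"
        "joined S' a y c (\<lambda>i. F i s)" by blast+
      have "joined S' a y c (\<lambda>i. F i t)" by (rule joined_cong[OF c(4) _ c(3)]) simp
      thus ?thesis using c by blast
    qed
    have QP: "P s" if s: "s \<in> {0..1}" "\<bar>s - t\<bar> < d" and ?Q for s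
    proof -
      obtain c0 where c0: "c0 \<in> ball (\<gamma> t) r - S'" "joined S' a y c0 (\<lambda>i. F i t)"
          using \<open>?Q\<close> by blast
      show ?thesis unfolding P_def using near[OF s]
      proof eventually_elim
        case (elim c)
        show ?case
        proof
          assume "c \<notin> S'"
          hence "joined S' c0 (\<lambda>i. F i t) c (\<lambda>i. F i t)"
            using c0 r elim S' by (intro joined_local[of "ball (\<gamma> t) r"]) auto
          from joined_trans[OF c0(2) this] show "joined S' a y c (\<lambda>i. F i s)"
            by (rule joined_cong) (use elim in \<open>simp_all add: eq_commute[of "F _ t _"]\<close>)
        qed
      qed
    qed
    show "\<exists>T. openin (top_of_set {0..1}) T \<and> t \<in> T \<and> (\<forall>x\<in>T. \<forall>y\<in>T. P x \<longrightarrow> P y)"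
    proof (intro exI[of _ "{0..1} \<inter> ball t d"] conjI ballI impI)
      show "openin (top_of_set {0..1}) ({0..1} \<inter> ball t d)" by (simp add: openin_open_Int)
      show "t \<in> {0..1} \<inter> ball t d" using t d by simp
      fix u v assume "u \<in> {0..1} \<inter> ball t d" "v \<in> {0..1} \<inter> ball t d" "P u"
      thus "P v" using PQ[of u] QP[of v] by (auto simp: dist_real_def abs_minus_commute)
    qed
  qed auto
  moreover have b: "\<gamma> 1 = b" using *(3) by (simp add: pathfinish_def)
  ultimately have "joined S' a y b (\<lambda>i. F i 1)"
    unfolding P_def b using eventually_nhds_x_imp_x S' by blast
  thus ?thesis by (rule joined_cong) (use *(6) in auto)
qed

section \<open>Square roots along paths\<close>

definition sqrt_germ :: "(complex \<Rightarrow> complex) \<Rightarrow> complex \<Rightarrow> complex \<Rightarrow> complex" where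
  "sqrt_germ g a z = exp ((Ln (g a) + Ln (g z / g a)) / 2)"

text \<open>Division by \<open>g a\<close> moves the value at a to 1, away from the branch cut.
  \<open>Ln (g z)\<close> itself could jump near a.\<close>

lemma analytic_Ln_quotient:
  assumes "g analytic_on {a}" "g a \<noteq> 0"
  shows "(\<lambda>z. Ln (g z / g a)) analytic_on {a}"
proof -
  have "(\<lambda>z. g z / g a) analytic_on {a}" using assms by (intro analytic_intros) auto
  moreover have "Ln analytic_on {1}" 
    using holomorphic_on_Ln[of "- \<real>\<^sub>\<le>\<^sub>0"] open_Compl[OF closed_nonpos_Reals_complex]
    by (auto simp: analytic_at)
  ultimately show ?thesis
    using analytic_on_compose_gen[of "\<lambda>z. g z / g a" "{a}" Ln "{1}"] assms by (simp add: o_def)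
qed

lemma sqrt_germ_analytic:
  assumes "g analytic_on {a}" "g a \<noteq> 0"
  shows "sqrt_germ g a analytic_on {a}"
  unfolding sqrt_germ_def[abs_def] by (intro analytic_intros analytic_Ln_quotient assms) auto

lemma exp_half_power2: "(exp (x / 2))\<^sup>2 = exp (x :: complex)"
  by (simp flip: exp_double)

lemma sqrt_germ_power2:
  assumes "g a \<noteq> 0" "g z \<noteq> 0"
  shows "(sqrt_germ g a z)\<^sup>2 = g z"
proof -
  have "(sqrt_germ g a z)\<^sup>2 = exp (Ln (g a) + Ln (g z / g a))"
    unfolding sqrt_germ_def by (rule exp_half_power2)
  thus ?thesis using assms by (simp add: exp_add)
qed

text \<open>A continuous logarithm K of g along the path replaces \<open>Ln (g a)\<close> in the
  definition of \<open>sqrt_germ\<close>. At the end K may differ from the principal logarithm by a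
  multiple of 2 pi i, and half of this difference exponentiates to the sign c.\<close>

lemma sqrt_continuation:
  assumes \<gamma>: "path \<gamma>" and g: "\<And>t. t \<in> {0..1} \<Longrightarrow> g analytic_on {\<gamma> t}" "\<And>t. t \<in> {0..1} \<Longrightarrow> g (\<gamma> t) \<noteq> 0"
  obtains R c where "analytic_continuation_along \<gamma> R" "R 0 = sqrt_germ g (\<gamma> 0)"
    "R 1 = (\<lambda>z. c * sqrt_germ g (\<gamma> 1) z)" "c\<^sup>2 = 1"
proof -
  have "continuous_on {0..1} (g \<circ> \<gamma>)"
  proof (rule continuous_on_compose)
    show "continuous_on (\<gamma> ` {0..1}) g"
      using g(1) analytic_at_imp_isCont continuous_at_imp_continuous_on by blast
  qed (use \<gamma> in \<open>simp add: path_def\<close>)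
  moreover have "contractible {0..1::real}" by (intro convex_imp_contractible) auto
  ultimately obtain L where L: "continuous_on {0..1} L" "\<And>t. t \<in> {0..1} \<Longrightarrow> g (\<gamma> t) = exp (L t)"
    using continuous_logarithm_on_contractible[of "{0..1}" "g \<circ> \<gamma>"] g(2) by (metis comp_apply)
  \<comment> \<open>The lift L is fixed only up to a multiple of 2 pi i; it is shifted so that K 0
    is the principal value and the continuation starts at \<open>sqrt_germ\<close> exactly.\<close>
  define K where "K = (\<lambda>t. L t - L 0 + Ln (g (\<gamma> 0)))"
  have K: "exp (K t) = g (\<gamma> t)" if "t \<in> {0..1}" for t
    using L(2)[of 0] L(2)[OF that] g(2)[of 0] by (simp add: K_def exp_add exp_diff)
  have Kc: "continuous_on {0..1} K" unfolding K_def by (intro continuous_intros L)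
  define R where "R = (\<lambda>t z. exp ((K t + Ln (g z / g (\<gamma> t))) / 2))"
  have pos: "\<forall>\<^sub>F z in nhds (\<gamma> t). Re (g z / g (\<gamma> t)) > 0" if t: "t \<in> {0..1}" for t
  proof -
    have "(\<lambda>z. Re (g z / g (\<gamma> t))) \<midarrow>\<gamma> t\<rightarrow> Re (g (\<gamma> t) / g (\<gamma> t))"
      using analytic_at_imp_isCont[OF g(1)[OF t]] g(2)[OF t]
      by (intro tendsto_intros) (auto simp: isCont_def)
    hence "\<forall>\<^sub>F z in at (\<gamma> t). Re (g z / g (\<gamma> t)) > 0"
      using g(2)[OF t] by (intro order_tendstoD(1)) auto
    thus ?thesis using g(2)[OF t] by (simp add: eventually_nhds_conv_at)
  qed
  have "analytic_continuation_along \<gamma> R"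
    unfolding analytic_continuation_along_iff
  proof (intro ballI conjI)
    fix t :: real assume t: "t \<in> {0..1}"
    show "R t analytic_on {\<gamma> t}" unfolding R_def
      by (intro analytic_intros analytic_Ln_quotient g t) auto
    have "\<forall>\<^sub>F c in nhds (\<gamma> t). \<forall>\<^sub>F z in nhds c. Re (g z / g (\<gamma> t)) > 0"
      using pos[OF t] by (simp add: eventually_eventually)
    then obtain d1 where d1: "d1 > 0"
      "\<And>s. s \<in> {0..1} \<Longrightarrow> \<bar>s - t\<bar> < d1 \<Longrightarrow> \<forall>\<^sub>F z in nhds (\<gamma> s). Re (g z / g (\<gamma> t)) > 0"
      by (rule path_eventually_nhds[OF \<gamma> t]) (rule that)
    \<comment> \<open>The bound pi keeps K s - K t in the strip on which \<open>Ln\<close> inverts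
      \<open>exp\<close>, so the increment of K is the principal logarithm of the quotient of the
      values of g.\<close>
    obtain d2 where d2: "d2 > 0" "\<And>s. s \<in> {0..1} \<Longrightarrow> dist s t < d2 \<Longrightarrow> dist (K s) (K t) < pi"
      using Kc t pi_gt_zero unfolding continuous_on_iff by blast
    show "\<exists>d>0. \<forall>s\<in>{0..1}. \<bar>s - t\<bar> < d \<longrightarrow> (\<forall>\<^sub>F z in nhds (\<gamma> s). R s z = R t z)"
    proof (intro exI[of _ "min d1 d2"] conjI ballI impI)
      fix s :: real assume s: "s \<in> {0..1}" "\<bar>s - t\<bar> < min d1 d2"
      have "\<bar>Im (K s - K t)\<bar> < pi"
        using d2(2)[of s] s abs_Im_le_cmod[of "K s - K t"] by (simp add: dist_norm)
      hence "Ln (exp (K s - K t)) = K s - K t" by (intro Ln_exp) auto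
      hence Ls: "Ln (g (\<gamma> s) / g (\<gamma> t)) = K s - K t" using K[OF s(1)] K[OF t]
          by (simp add: exp_diff)
      have ev: "\<forall>\<^sub>F z in nhds (\<gamma> s). Re (g z / g (\<gamma> t)) > 0" using d1(2)[of s] s by simp
      have "Re (g (\<gamma> s) / g (\<gamma> t)) > 0" using eventually_nhds_x_imp_x[OF ev] .
      \<comment> \<open>Two logarithms with imaginary parts below pi/2 in modulus have their sum in
        the principal strip, which makes \<open>Ln\<close> additive on the product below.\<close>
      hence 1: "\<bar>Im (Ln (g (\<gamma> s) / g (\<gamma> t)))\<bar> < pi / 2"
        using Re_Ln_pos_lt[of "g (\<gamma> s) / g (\<gamma> t)"] g(2) s(1) t by simp
      show "\<forall>\<^sub>F z in nhds (\<gamma> s). R s z = R t z" using pos[OF s(1)]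
      proof eventually_elim
        case (elim z)
        hence gz: "g z \<noteq> 0" by auto
        hence "\<bar>Im (Ln (g z / g (\<gamma> s)))\<bar> < pi / 2"
          using Re_Ln_pos_lt[of "g z / g (\<gamma> s)"] g(2)[OF s(1)] elim by simp
        hence "Ln (g (\<gamma> s) / g (\<gamma> t) * (g z / g (\<gamma> s))) = Ln (g (\<gamma> s) / g (\<gamma> t)) +
            Ln (g z / g (\<gamma> s))"
          using 1 gz g(2)[OF s(1)] g(2)[OF t] by (intro Ln_times_simple) (auto simp: abs_less_iff)
        moreover have "g (\<gamma> s) / g (\<gamma> t) * (g z / g (\<gamma> s)) = g z / g (\<gamma> t)"
          using g(2)[OF s(1)] by simp
        ultimately have "Ln (g z / g (\<gamma> t)) = K s - K t + Ln (g z / g (\<gamma> s))" using Ls by simp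
        thus ?case by (simp add: R_def)
      qed
    qed (use d1 d2 in auto)
  qed
  moreover have "R 0 = sqrt_germ g (\<gamma> 0)" by (simp add: R_def K_def sqrt_germ_def[abs_def])
  moreover have "R 1 = (\<lambda>z. exp ((K 1 - Ln (g (\<gamma> 1))) / 2) * sqrt_germ g (\<gamma> 1) z)"
  proof
    fix z
    have "(K 1 + Ln (g z / g (\<gamma> 1))) / 2 = (K 1 - Ln (g (\<gamma> 1))) / 2 + (Ln (g (\<gamma> 1)) +
        Ln (g z / g (\<gamma> 1))) / 2"
      by (simp add: field_simps)
    thus "R 1 z = exp ((K 1 - Ln (g (\<gamma> 1))) / 2) * sqrt_germ g (\<gamma> 1) z"
      unfolding R_def sqrt_germ_def by (simp only: exp_add)
  qed
  moreover have "(exp ((K 1 - Ln (g (\<gamma> 1))) / 2))\<^sup>2 = 1"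
    unfolding exp_half_power2 using K[of 1] g(2)[of 1] by (simp add: exp_diff)
  ultimately show ?thesis using that by blast
qed

section \<open>Continuation and translation of gauge transforms\<close>

lemma analytic_continuation_along_const:
  "(\<And>t. t \<in> {0..1} \<Longrightarrow> h analytic_on {\<gamma> t}) \<Longrightarrow> analytic_continuation_along \<gamma> (\<lambda>_. h)"
  by (simp add: analytic_continuation_along_def)

lemma analytic_continuation_along_add:
  assumes "analytic_continuation_along \<gamma> F" "analytic_continuation_along \<gamma> G"
  shows "analytic_continuation_along \<gamma> (\<lambda>t z. F t z + G t z)"
  unfolding analytic_continuation_along_def
proof (intro ballI conjI)
  fix t :: real assume t: "t \<in> {0..1}"
  show "(\<lambda>z. F t z + G t z) analytic_on {\<gamma> t}"
    using assms t by (auto simp: analytic_continuation_along_def intro!: analytic_intros)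
  have "\<forall>\<^sub>F s in at t within {0..1}. \<forall>\<^sub>F z in nhds (\<gamma> s). F s z = F t z"
    "\<forall>\<^sub>F s in at t within {0..1}. \<forall>\<^sub>F z in nhds (\<gamma> s). G s z = G t z"
    using assms t by (auto simp: analytic_continuation_along_def)
  thus "\<forall>\<^sub>F s in at t within {0..1}. \<forall>\<^sub>F z in nhds (\<gamma> s). F s z + G s z = F t z + G t z"
    by eventually_elim (auto elim: eventually_elim2)
qed

lemma analytic_continuation_along_mult:
  assumes "analytic_continuation_along \<gamma> F" "analytic_continuation_along \<gamma> G"
  shows "analytic_continuation_along \<gamma> (\<lambda>t z. F t z * G t z)"
  unfolding analytic_continuation_along_def
proof (intro ballI conjI)
  fix t :: real assume t: "t \<in> {0..1}"
  show "(\<lambda>z. F t z * G t z) analytic_on {\<gamma> t}"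
    using assms t by (auto simp: analytic_continuation_along_def intro!: analytic_intros)
  have "\<forall>\<^sub>F s in at t within {0..1}. \<forall>\<^sub>F z in nhds (\<gamma> s). F s z = F t z"
    "\<forall>\<^sub>F s in at t within {0..1}. \<forall>\<^sub>F z in nhds (\<gamma> s). G s z = G t z"
    using assms t by (auto simp: analytic_continuation_along_def)
  thus "\<forall>\<^sub>F s in at t within {0..1}. \<forall>\<^sub>F z in nhds (\<gamma> s). F s z * G s z = F t z * G t z"
    by eventually_elim (auto elim: eventually_elim2)
qed

lemma eventually_deriv_cong:
  fixes f g :: "complex \<Rightarrow> complex"
  assumes "\<forall>\<^sub>F z in nhds a. f z = g z"
  shows "\<forall>\<^sub>F z in nhds a. deriv f z = deriv g z"
proof -
  have "\<forall>\<^sub>F z in nhds a. \<forall>\<^sub>F x in nhds z. f x = g x" using assms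
      by (simp add: eventually_eventually)
  thus ?thesis by eventually_elim (auto intro: deriv_cong_ev)
qed

lemma analytic_continuation_along_deriv:
  assumes "analytic_continuation_along \<gamma> F"
  shows "analytic_continuation_along \<gamma> (\<lambda>t. deriv (F t))"
  unfolding analytic_continuation_along_def
proof (intro ballI conjI)
  fix t :: real assume t: "t \<in> {0..1}"
  show "deriv (F t) analytic_on {\<gamma> t}"
    using assms t by (auto simp: analytic_continuation_along_def intro!: analytic_deriv)
  have "\<forall>\<^sub>F s in at t within {0..1}. \<forall>\<^sub>F z in nhds (\<gamma> s). F s z = F t z"
    using assms t by (auto simp: analytic_continuation_along_def)
  thus "\<forall>\<^sub>F s in at t within {0..1}. \<forall>\<^sub>F z in nhds (\<gamma> s). deriv (F s) z = deriv (F t) z"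
    by eventually_elim (rule eventually_deriv_cong)
qed

text \<open>One operator for both directions: A = 1/g and B = sqrt g lead from the generalized
  equation to the Lame equation, while A = sqrt g / g, B = 1 and -T in place of T lead back.
  Continuation and translation can thus be treated once for both.\<close>

definition gauge ::
    "(complex \<Rightarrow> complex) \<Rightarrow> (complex \<Rightarrow> complex) \<Rightarrow> complex \<Rightarrow> (complex \<Rightarrow> complex) \<Rightarrow> complex \<Rightarrow> complex"
where
  "gauge A B T y z = A z * (deriv (\<lambda>x. B x * y x) z + T * (B z * y z))"

lemma eventually_gauge_cong:
  assumes "\<forall>\<^sub>F z in nhds a. A z = A' z" "\<forall>\<^sub>F z in nhds a. B z = B' z" "\<forall>\<^sub>F z in nhds a. y z = y' z"
  shows "\<forall>\<^sub>F z in nhds a. gauge A B T y z = gauge A' B' T y' z"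
proof -
  have "\<forall>\<^sub>F z in nhds a. B z * y z = B' z * y' z" using assms(2,3) by eventually_elim simp
  from eventually_deriv_cong[OF this] assms show ?thesis
    by eventually_elim (simp add: gauge_def)
qed

lemma analytic_continuation_along_gauge:
  assumes "analytic_continuation_along \<gamma> A" "analytic_continuation_along \<gamma> B" "analytic_continuation_along \<gamma> F"
  shows "analytic_continuation_along \<gamma> (\<lambda>t. gauge (A t) (B t) T (F t))"
  unfolding gauge_def
  by (intro analytic_continuation_along_mult analytic_continuation_along_add
      analytic_continuation_along_deriv analytic_continuation_along_const assms) auto

text \<open>All ingredients of the operator continue along the same path, and only the square root
  may return with a sign.\<close>

lemma joined_gauge:
  assumes "joined S a y b x" and g: "\<And>z. z \<notin> S \<Longrightarrow> g analytic_on {z}" "\<And>z. z \<notin> S \<Longrightarrow> g z \<noteq> 0"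
  obtains c where "c\<^sup>2 = 1"
    "joined S a (\<lambda>i. gauge (\<lambda>z. 1 / g z) (sqrt_germ g a) T (y i))
       b (\<lambda>i. gauge (\<lambda>z. 1 / g z) (\<lambda>z. c * sqrt_germ g b z) T (x i))"
    "joined S a (\<lambda>i. gauge (\<lambda>z. sqrt_germ g a z * (1 / g z)) (\<lambda>_. 1) T' (y i))
       b (\<lambda>i. gauge (\<lambda>z. c * sqrt_germ g b z * (1 / g z)) (\<lambda>_. 1) T' (x i))"
proof -
  obtain \<gamma> F where *: "path \<gamma>" "path_image \<gamma> \<subseteq> - S" "pathstart \<gamma> = a" "pathfinish \<gamma> = b"
    "\<And>i. analytic_continuation_along \<gamma> (F i)"
    "\<And>i. \<forall>\<^sub>F z in nhds a. F i 0 z = y i z" "\<And>i. \<forall>\<^sub>F z in nhds b. F i 1 z = x i z"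
    using assms(1) unfolding joined_def by blast
  have S: "\<gamma> t \<notin> S" if "t \<in> {0..1}" for t using *(2) that unfolding path_image_def by blast
  obtain R c where R: "analytic_continuation_along \<gamma> R" "R 0 = sqrt_germ g (\<gamma> 0)"
    "R 1 = (\<lambda>z. c * sqrt_germ g (\<gamma> 1) z)" and c: "c\<^sup>2 = 1"
    using sqrt_continuation[OF *(1), of g] g S by metis
  have ab: "\<gamma> 0 = a" "\<gamma> 1 = b" using *(3,4) by (simp_all add: pathstart_def pathfinish_def)
  have ig: "analytic_continuation_along \<gamma> (\<lambda>t z. 1 / g z)"
    using g S by (intro analytic_continuation_along_const analytic_intros) auto
  have 1: "analytic_continuation_along \<gamma> (\<lambda>t. gauge (\<lambda>z. 1 / g z) (R t) T (F i t))" for i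
    by (intro analytic_continuation_along_gauge ig R *)
  have 2: "analytic_continuation_along \<gamma> (\<lambda>t. gauge (\<lambda>z. R t z * (1 / g z))
      (\<lambda>_. 1) T' (F i t))" for i
    by (intro analytic_continuation_along_gauge analytic_continuation_along_mult ig R *
        analytic_continuation_along_const) auto
  show ?thesis
  proof (rule that[OF c])
    show "joined S a (\<lambda>i. gauge (\<lambda>z. 1 / g z) (sqrt_germ g a) T (y i))
       b (\<lambda>i. gauge (\<lambda>z. 1 / g z) (\<lambda>z. c * sqrt_germ g b z) T (x i))"
      unfolding joined_def
      using * 1 R ab
      by (intro exI[of _ \<gamma>] exI[of _ "\<lambda>i t. gauge (\<lambda>z. 1 / g z) (R t) T (F i t)"])
        (auto intro!: eventually_gauge_cong)
    show "joined S a (\<lambda>i. gauge (\<lambda>z. sqrt_germ g a z * (1 / g z)) (\<lambda>_. 1) T' (y i))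
       b (\<lambda>i. gauge (\<lambda>z. c * sqrt_germ g b z * (1 / g z)) (\<lambda>_. 1) T' (x i))"
      unfolding joined_def
      using * 2 R ab
      by (intro exI[of _ \<gamma>] exI[of _ "\<lambda>i t. gauge (\<lambda>z. R t z * (1 / g z)) (\<lambda>_. 1) T' (F i t)"])
        (auto intro!: eventually_gauge_cong)
  qed
qed

lemma deriv_shift:
  fixes f :: "complex \<Rightarrow> complex"
  shows "deriv f (z + c) = deriv (\<lambda>x. f (x + c)) z"
  unfolding deriv_def by (simp add: DERIV_shift)

text \<open>The operator is linear over constants, so it commutes with the matrix, and the factors
  picked up by A and B come out in front. The sign of the square root sits in B for one direction
  and in A for the other, which is why both c1 and c2 appear.\<close>

lemma gauge_translate:
  fixes M :: "'i :: finite \<Rightarrow> complex"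
  assumes A: "\<forall>\<^sub>F z in nhds a. A' (z + \<omega>) = c1 * A z" and B: "\<forall>\<^sub>F z in nhds a. B' (z + \<omega>) =
      c2 * B z"
    and an: "B analytic_on {a}" "\<And>j. y j analytic_on {a}"
  shows "\<forall>\<^sub>F z in nhds a. gauge A' B' T (\<lambda>z. \<Sum>j\<in>UNIV. M j * y j (z - \<omega>)) (z + \<omega>) =
     (\<Sum>j\<in>UNIV. c1 * c2 * M j * gauge A B T (y j) z)"
proof -
  have an': "(\<lambda>x. B x * y j x) analytic_on {a}" for j by (intro analytic_intros an)
  have diff: "\<forall>\<^sub>F z in nhds a. \<forall>j. (\<lambda>x. B x * y j x) field_differentiable at z"
  proof (rule eventually_all_finite)
    fix j
    obtain U where "open U" "a \<in> U" "(\<lambda>x. B x * y j x) holomorphic_on U" using an'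
        analytic_at by blast
    thus "\<forall>\<^sub>F z in nhds a. (\<lambda>x. B x * y j x) field_differentiable at z"
      using eventually_nhds_in_open[of U a] holomorphic_on_imp_differentiable_at
      by (auto elim!: eventually_mono)
  qed
  have "\<forall>\<^sub>F z in nhds a. \<forall>\<^sub>F x in nhds z. B' (x + \<omega>) = c2 * B x"
    using B by (simp add: eventually_eventually)
  with A B diff show ?thesis
  proof eventually_elim
    case (elim z)
    let ?x = "\<lambda>z. \<Sum>j\<in>UNIV. M j * y j (z - \<omega>)"
    have "deriv (\<lambda>x. B' x * ?x x) (z + \<omega>) = deriv (\<lambda>x. B' (x + \<omega>) * ?x (x + \<omega>)) z"
      by (rule deriv_shift)
    also have "\<dots> = deriv (\<lambda>x. \<Sum>j\<in>UNIV. c2 * M j * (B x * y j x)) z"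
      using elim(4) by (intro deriv_cong_ev)
          (auto elim!: eventually_mono simp: sum_distrib_left mult_ac)
    also have "\<dots> = (\<Sum>j\<in>UNIV. c2 * M j * deriv (\<lambda>x. B x * y j x) z)"
      using elim(3) by (intro DERIV_imp_deriv DERIV_sum DERIV_cmult)
          (auto simp: DERIV_deriv_iff_field_differentiable)
    finally show ?case unfolding gauge_def elim(1,2)
      by (simp add: sum_distrib_left distrib_left sum.distrib mult_ac)
  qed
qed

text \<open>The path that gives M for the germs y gives c M for their transforms, where c is the
  sign of the square root along that path. The sign varies with the path, hence a disjunction for
  each M and not a statement on the groups as a whole.\<close>

lemma monodromy_group_gauge:
  fixes y :: "2 \<Rightarrow> complex \<Rightarrow> complex"
  assumes M: "M \<in> monodromy_group \<tau> S a y"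
    and g: "\<And>z. z \<notin> S \<Longrightarrow> g analytic_on {z}" "\<And>z. z \<notin> S \<Longrightarrow> g z \<noteq> 0"
    and per: "\<And>z \<omega>. z \<notin> S \<Longrightarrow> \<omega> \<in> period_lattice \<tau> \<Longrightarrow> g (z + \<omega>) = g z"
    and S: "open (- S)" "a \<notin> S" and y: "\<And>j. y j analytic_on {a}"
  shows "M \<in> monodromy_group \<tau> S a (\<lambda>i. gauge (\<lambda>z. 1 / g z) (sqrt_germ g a) T (y i)) \<or>
         - M \<in> monodromy_group \<tau> S a (\<lambda>i. gauge
             (\<lambda>z. 1 / g z) (sqrt_germ g a) T (y i))" (is ?thesis1)
    and "M \<in> monodromy_group \<tau> S a (\<lambda>i. gauge (\<lambda>z. sqrt_germ g a z * (1 / g z)) (\<lambda>_. 1) T (y i)) \<or>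
         - M \<in> monodromy_group \<tau> S a (\<lambda>i. gauge (\<lambda>z. sqrt_germ g a z * (1 / g z))
             (\<lambda>_. 1) T (y i))" (is ?thesis2)
proof -
  obtain \<omega> where \<omega>: "\<omega> \<in> period_lattice \<tau>"
    and j: "joined S a y (a + \<omega>) (\<lambda>i z. \<Sum>j\<in>UNIV. M $ i $ j * y j (z - \<omega>))"
    using M by (auto simp: monodromy_group_iff)
  obtain c where c: "c\<^sup>2 = 1"
    and j1: "joined S a (\<lambda>i. gauge (\<lambda>z. 1 / g z) (sqrt_germ g a) T (y i))
       (a + \<omega>) (\<lambda>i. gauge (\<lambda>z. 1 / g z) (\<lambda>z. c * sqrt_germ g (a + \<omega>) z) T
           (\<lambda>z. \<Sum>j\<in>UNIV. M $ i $ j * y j (z - \<omega>)))"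
    and j2: "joined S a (\<lambda>i. gauge (\<lambda>z. sqrt_germ g a z * (1 / g z)) (\<lambda>_. 1) T (y i))
       (a + \<omega>) (\<lambda>i. gauge (\<lambda>z. c * sqrt_germ g (a + \<omega>) z * (1 / g z)) (\<lambda>_. 1) T
           (\<lambda>z. \<Sum>j\<in>UNIV. M $ i $ j * y j (z - \<omega>)))"
    by (rule joined_gauge[OF j g]) 
  have evS: "\<forall>\<^sub>F z in nhds a. z \<notin> S" using eventually_nhds_in_open[OF S(1), of a] S(2) by simp
  have gt: "\<forall>\<^sub>F z in nhds a. g (z + \<omega>) = g z" using evS by eventually_elim (rule per[OF _ \<omega>])
  \<comment> \<open>\<open>sqrt_germ g a\<close> is built from values of \<open>g\<close> alone, so
    for periodic \<open>g\<close> the germ at the end point is the exact translate of that at a. The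
    sign c therefore comes from the continuation only.\<close>
  hence rt: "\<forall>\<^sub>F z in nhds a. sqrt_germ g (a + \<omega>) (z + \<omega>) = sqrt_germ g a z"
    using per[OF S(2) \<omega>] by (auto elim!: eventually_mono simp: sqrt_germ_def)
  have ran: "sqrt_germ g a analytic_on {a}" by (intro sqrt_germ_analytic g S)
  have "\<forall>\<^sub>F z in nhds a. gauge (\<lambda>z. 1 / g z) (\<lambda>z. c * sqrt_germ g (a + \<omega>) z) T
      (\<lambda>z. \<Sum>j\<in>UNIV. M $ i $ j * y j (z - \<omega>)) (z + \<omega>) =
     (\<Sum>j\<in>UNIV. 1 * c * M $ i $ j * gauge (\<lambda>z. 1 / g z) (sqrt_germ g a) T (y j) z)" for i
    using gt rt by (intro gauge_translate ran y) (auto elim!: eventually_mono)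
  hence 1: "\<forall>\<^sub>F z in nhds (a + \<omega>). gauge (\<lambda>z. 1 / g z) (\<lambda>z. c * sqrt_germ g (a + \<omega>) z) T
      (\<lambda>z. \<Sum>j\<in>UNIV. M $ i $ j * y j (z - \<omega>)) z =
     (\<Sum>j\<in>UNIV. c * M $ i $ j * gauge (\<lambda>z. 1 / g z) (sqrt_germ g a) T (y j) (z - \<omega>))" for i
    by (simp add: eventually_nhds_shift)
  have "\<forall>\<^sub>F z in nhds a. gauge (\<lambda>z. c * sqrt_germ g (a + \<omega>) z * (1 / g z)) (\<lambda>_. 1) T
      (\<lambda>z. \<Sum>j\<in>UNIV. M $ i $ j * y j (z - \<omega>)) (z + \<omega>) =
     (\<Sum>j\<in>UNIV. c * 1 * M $ i $ j * gauge (\<lambda>z. sqrt_germ g a z * (1 / g z)) (\<lambda>_. 1) T (y j) z)" for i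
    using eventually_conj[OF gt rt] by (intro gauge_translate y analytic_on_const)
        (auto elim!: eventually_mono)
  hence 2: "\<forall>\<^sub>F z in nhds (a + \<omega>). gauge (\<lambda>z. c * sqrt_germ g (a + \<omega>) z * (1 / g z)) (\<lambda>_. 1) T
      (\<lambda>z. \<Sum>j\<in>UNIV. M $ i $ j * y j (z - \<omega>)) z =
     (\<Sum>j\<in>UNIV. c * M $ i $ j * gauge (\<lambda>z. sqrt_germ g a z * (1 / g z))
         (\<lambda>_. 1) T (y j) (z - \<omega>))" for i
    by (simp add: eventually_nhds_shift)
  from c have "c = 1 \<or> c = -1" by (simp add: power2_eq_1_iff)
  moreover have "joined S a (\<lambda>i. gauge (\<lambda>z. 1 / g z) (sqrt_germ g a) T (y i)) (a + \<omega>)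
    (\<lambda>i z. \<Sum>j\<in>UNIV. c * M $ i $ j * gauge (\<lambda>z. 1 / g z) (sqrt_germ g a) T (y j) (z - \<omega>))"
    by (rule joined_cong[OF j1 _ 1]) simp
  ultimately show ?thesis1 using \<omega> by (auto simp: monodromy_group_iff)
  from c have "c = 1 \<or> c = -1" by (simp add: power2_eq_1_iff)
  moreover have "joined S a (\<lambda>i. gauge (\<lambda>z. sqrt_germ g a z * (1 / g z)) (\<lambda>_. 1) T (y i)) (a + \<omega>)
    (\<lambda>i z. \<Sum>j\<in>UNIV. c * M $ i $ j * gauge (\<lambda>z. sqrt_germ g a z * (1 / g z))
        (\<lambda>_. 1) T (y j) (z - \<omega>))"
    by (rule joined_cong[OF j2 _ 2]) simp
  ultimately show ?thesis2 using \<omega> by (auto simp: monodromy_group_iff)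
qed

section \<open>The gauge transformation\<close>

text \<open>The local algebra of the transformation, on an open set that carries a branch R of the
  square root. It is independent of elliptic functions: g1 and g2 stand for the first two
  derivatives of g.\<close>

locale gauge_data =
  fixes U :: "complex set" and g g1 g2 R :: "complex \<Rightarrow> complex" and T :: complex
  assumes U: "open U"
    and g: "\<And>z. z \<in> U \<Longrightarrow> (g has_field_derivative g1 z) (at z)"
    and g1: "\<And>z. z \<in> U \<Longrightarrow> (g1 has_field_derivative g2 z) (at z)"
    and nz: "\<And>z. z \<in> U \<Longrightarrow> g z \<noteq> 0"
    and R: "R holomorphic_on U" "\<And>z. z \<in> U \<Longrightarrow> (R z)\<^sup>2 = g z"
begin

lemma R_nz: "z \<in> U \<Longrightarrow> R z \<noteq> 0"
  using R(2) nz by force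

lemma R_deriv:
  assumes z: "z \<in> U"
  shows "(R has_field_derivative g1 z / (2 * g z) * R z) (at z)"
proof -
  obtain D where D: "(R has_field_derivative D) (at z)"
    using R(1) U z holomorphic_on_imp_differentiable_at field_differentiable_def by blast
  have "((\<lambda>z. (R z)\<^sup>2) has_field_derivative 2 * R z * D) (at z)"
    using D by (auto intro!: derivative_eq_intros)
  moreover have "\<forall>\<^sub>F x in nhds z. (R x)\<^sup>2 = g x"
    using eventually_nhds_in_open[OF U z] by eventually_elim (rule R(2))
  ultimately have "(g has_field_derivative 2 * R z * D) (at z)"
    using DERIV_cong_ev[OF refl, of "\<lambda>z. (R z)\<^sup>2" g z] by blast
  hence "g1 z = 2 * R z * D" using g[OF z] DERIV_unique by blast
  hence "g1 z / (2 * g z) * R z = D"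
    using R_nz[OF z] by (simp add: R(2)[OF z, symmetric] power2_eq_square)
  thus ?thesis using D by simp
qed

text \<open>This is 1/R, written with g so as to match the coefficient A of the operator; likewise
  \<open>kap\<close> is the logarithmic derivative R'/R.\<close>

definition rho :: "complex \<Rightarrow> complex" where "rho z = R z / g z"

definition kap :: "complex \<Rightarrow> complex" where "kap z = g1 z / (2 * g z)"

text \<open>The potential that results for y when w is eliminated from w' = T w + R y and y' = R w -
  (T + kap) y. The elimination gives g - kap' + (T + kap)^2, and kap' = g''/(2g) - 2 kap^2 turns
  kap^2 into 3 kap^2.\<close>

definition Q :: "complex \<Rightarrow> complex" where
  "Q z = T\<^sup>2 + g z + T * (g1 z / g z) + 3 / 4 * (g1 z / g z)\<^sup>2 - g2 z / (2 * g z)"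

lemma R_eq: "z \<in> U \<Longrightarrow> R z = g z * rho z"
  using nz by (simp add: rho_def)

lemma Q_eq: "Q z = T\<^sup>2 + g z + 2 * T * kap z + 3 * (kap z)\<^sup>2 - g2 z / (2 * g z)"
  by (simp add: Q_def kap_def power_divide power_mult_distrib)

lemma R_deriv': "z \<in> U \<Longrightarrow> (R has_field_derivative kap z * R z) (at z)"
  using R_deriv by (simp add: kap_def)

lemma rho_deriv:
  assumes z: "z \<in> U"
  shows "(rho has_field_derivative - kap z * rho z) (at z)"
proof -
  have "((\<lambda>z. R z / g z) has_field_derivative (kap z * R z * g z - R z * g1 z) / (g z * g z)) (at z)"
    using R_deriv'[OF z] g[OF z] nz[OF z] by (intro DERIV_divide)
  also have "(kap z * R z * g z - R z * g1 z) / (g z * g z) = - kap z * rho z"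
    using nz[OF z] by (simp add: rho_def kap_def field_simps)
  finally show ?thesis unfolding rho_def[abs_def] .
qed

lemma kap_deriv:
  assumes z: "z \<in> U"
  shows "(kap has_field_derivative g2 z / (2 * g z) - 2 * (kap z)\<^sup>2) (at z)"
proof -
  have "((\<lambda>z. g1 z / (2 * g z)) has_field_derivative
      (g2 z * (2 * g z) - g1 z * (2 * g1 z)) / (2 * g z * (2 * g z))) (at z)"
    using g[OF z] g1[OF z] nz[OF z] by (intro DERIV_divide DERIV_cmult) auto
  also have "(g2 z * (2 * g z) - g1 z * (2 * g1 z)) / (2 * g z * (2 * g z)) =
      g2 z / (2 * g z) - 2 * (kap z)\<^sup>2"
    using nz[OF z] by (simp add: kap_def diff_divide_distrib power2_eq_square)
  finally show ?thesis unfolding kap_def[abs_def] .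
qed

lemma has_derivs:
  assumes "y holomorphic_on U" "z \<in> U"
  shows "(y has_field_derivative deriv y z) (at z)"
    "(deriv y has_field_derivative deriv (deriv y) z) (at z)"
  using assms U holomorphic_derivI holomorphic_deriv by blast+

lemma eventually_U: "z \<in> U \<Longrightarrow> \<forall>\<^sub>F x in nhds z. x \<in> U"
  by (rule eventually_nhds_in_open[OF U])

lemma deriv_transfer:
  assumes "\<And>x. x \<in> U \<Longrightarrow> f x = h x" "(h has_field_derivative D) (at z)" "z \<in> U"
  shows "(f has_field_derivative D) (at z)"
proof -
  have "\<forall>\<^sub>F x in nhds z. f x = h x"
    using eventually_U[OF assms(3)] by eventually_elim (rule assms(1))
  from DERIV_cong_ev[OF refl this refl, of D] assms(2) show ?thesis by blast
qed

text \<open>Here w is defined by solving the second equation of the system for w. The equation y'' =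
  Q y then yields the first equation, and differentiating that one gives the Lame equation for
  w.\<close>

lemma gauge_R:
  fixes y :: "complex \<Rightarrow> complex"
  assumes y: "y holomorphic_on U" and ode: "\<And>z. z \<in> U \<Longrightarrow> deriv (deriv y) z = Q z * y z"
  defines "w \<equiv> gauge (\<lambda>z. 1 / g z) R T y"
  shows gauge_R_holomorphic: "w holomorphic_on U"
    and gauge_R_deriv: "\<And>z. z \<in> U \<Longrightarrow> deriv w z = T * w z + R z * y z"
    and gauge_R_deriv2: "\<And>z. z \<in> U \<Longrightarrow> deriv (deriv w) z = (g z + T\<^sup>2) * w z"
proof -
  have w_eq: "w z = rho z * (deriv y z + (T + kap z) * y z)" if z: "z \<in> U" for z
  proof -
    have "((\<lambda>x. R x * y x) has_field_derivative kap z * R z * y z + R z * deriv y z) (at z)"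
      using R_deriv'[OF z] has_derivs[OF y z] by (auto intro!: derivative_eq_intros)
    hence "deriv (\<lambda>x. R x * y x) z = kap z * R z * y z + R z * deriv y z"
      by (rule DERIV_imp_deriv)
    thus ?thesis by (simp add: w_def gauge_def rho_def algebra_simps add_divide_distrib)
  qed
  have w1: "(w has_field_derivative T * w z + R z * y z) (at z)" if z: "z \<in> U" for z
  proof (rule deriv_transfer[OF w_eq _ z])
    show "((\<lambda>z. rho z * (deriv y z + (T + kap z) * y z)) has_field_derivative
      T * w z + R z * y z) (at z)"
      using rho_deriv[OF z] kap_deriv[OF z] has_derivs[OF y z]
      by (auto intro!: derivative_eq_intros)
         (simp add: w_eq[OF z] R_eq[OF z] ode[OF z] Q_eq algebra_simps power2_eq_square)
  qed
  thus "w holomorphic_on U" using U by (auto simp: holomorphic_on_open)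
  show w1': "deriv w z = T * w z + R z * y z" if "z \<in> U" for z
    by (rule DERIV_imp_deriv[OF w1[OF that]])
  show "deriv (deriv w) z = (g z + T\<^sup>2) * w z" if z: "z \<in> U" for z
  proof (rule DERIV_imp_deriv[OF deriv_transfer[OF w1' _ z]])
    show "((\<lambda>z. T * w z + R z * y z) has_field_derivative (g z + T\<^sup>2) * w z) (at z)"
      using w1[OF z] R_deriv'[OF z] has_derivs[OF y z]
      by (auto intro!: derivative_eq_intros)
         (simp add: w_eq[OF z] R_eq[OF z] algebra_simps power2_eq_square)
  qed
qed

text \<open>The other elimination: y is defined by solving w' = T w + R y for y, the equation of w
  gives the equation for y', and one more derivative gives the potential Q.\<close>

lemma gauge_rho:
  fixes w :: "complex \<Rightarrow> complex"
  assumes w: "w holomorphic_on U" and ode: "\<And>z. z \<in> U \<Longrightarrow> deriv (deriv w) z = (g z + T\<^sup>2) * w z"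
  defines "y \<equiv> gauge (\<lambda>z. R z * (1 / g z)) (\<lambda>_. 1) (- T) w"
  shows gauge_rho_holomorphic: "y holomorphic_on U"
    and gauge_rho_deriv: "\<And>z. z \<in> U \<Longrightarrow> deriv y z = R z * w z - (T + kap z) * y z"
    and gauge_rho_deriv2: "\<And>z. z \<in> U \<Longrightarrow> deriv (deriv y) z = Q z * y z"
proof -
  have y_eq: "y z = rho z * (deriv w z - T * w z)" for z
    by (simp add: y_def gauge_def rho_def)
  have y1: "(y has_field_derivative R z * w z - (T + kap z) * y z) (at z)" if z: "z \<in> U" for z
  proof -
    have "((\<lambda>z. rho z * (deriv w z - T * w z)) has_field_derivative
        R z * w z - (T + kap z) * (rho z * (deriv w z - T * w z))) (at z)"
      using rho_deriv[OF z] has_derivs[OF w z]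
      by (auto intro!: derivative_eq_intros)
         (simp add: R_eq[OF z] ode[OF z] algebra_simps power2_eq_square)
    thus ?thesis by (simp add: y_eq[abs_def])
  qed
  thus "y holomorphic_on U" using U by (auto simp: holomorphic_on_open)
  show y1': "deriv y z = R z * w z - (T + kap z) * y z" if "z \<in> U" for z
    by (rule DERIV_imp_deriv[OF y1[OF that]])
  show "deriv (deriv y) z = Q z * y z" if z: "z \<in> U" for z
  proof (rule DERIV_imp_deriv[OF deriv_transfer[OF y1' _ z]])
    have "R z * deriv w z = g z * y z + T * (R z * w z)"
      by (simp add: y_eq R_eq[OF z] algebra_simps)
    thus "((\<lambda>z. R z * w z - (T + kap z) * y z) has_field_derivative Q z * y z) (at z)"
      using y1[OF z] R_deriv'[OF z] has_derivs[OF w z] kap_deriv[OF z]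
      by (auto intro!: derivative_eq_intros)
         (simp add: Q_eq algebra_simps power2_eq_square)
  qed
qed

end

text \<open>Since y can be recovered from w and its derivative, a linear relation among the w i,
  together with its derivative, becomes the same relation among the y i after division by \<beta>.
  Independence is thus inherited without Wronskians.\<close>

lemma is_fundamental_system_transfer:
  assumes y: "is_fundamental_system q a y" and w: "\<And>i. is_solution_at q' a (w i)"
    and rel: "\<And>i. \<forall>\<^sub>F z in nhds a. deriv (w i) z + \<alpha> z * w i z = \<beta> z * y i z"
    and nz: "\<forall>\<^sub>F z in nhds a. \<beta> z \<noteq> 0"
  shows "is_fundamental_system q' a w"
  unfolding is_fundamental_system_def
proof (intro conjI allI impI w)
  fix c :: "complex ^ 2"
  assume 0: "\<forall>\<^sub>F z in nhds a. (\<Sum>i\<in>UNIV. c $ i * w i z) = 0"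
  have "\<forall>\<^sub>F z in nhds a. \<forall>i. (w i) field_differentiable at z"
  proof (rule eventually_all_finite)
    fix i
    have "w i analytic_on {a}" using w by (simp add: is_solution_at_def)
    then obtain U where "open U" "a \<in> U" "w i holomorphic_on U" using analytic_at by blast
    thus "\<forall>\<^sub>F z in nhds a. (w i) field_differentiable at z"
      using eventually_nhds_in_open[of U a] holomorphic_on_imp_differentiable_at
      by (auto elim!: eventually_mono)
  qed
  moreover have "\<forall>\<^sub>F z in nhds a. \<forall>i. deriv (w i) z + \<alpha> z * w i z = \<beta> z * y i z"
    by (rule eventually_all_finite) (rule rel)
  ultimately have "\<forall>\<^sub>F z in nhds a. (\<Sum>i\<in>UNIV. c $ i * y i z) = 0"
    using eventually_deriv_cong[OF 0] 0 nz
  proof eventually_elim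
    case (elim z)
    have "deriv (\<lambda>z. \<Sum>i\<in>UNIV. c $ i * w i z) z = (\<Sum>i\<in>UNIV. c $ i * deriv (w i) z)"
      using elim(1) by (intro DERIV_imp_deriv DERIV_sum DERIV_cmult)
        (auto simp: DERIV_deriv_iff_field_differentiable)
    hence "(\<Sum>i\<in>UNIV. c $ i * deriv (w i) z) = 0" using elim(3) by simp
    hence "(\<Sum>i\<in>UNIV. c $ i * (deriv (w i) z + \<alpha> z * w i z)) = 0"
      using elim(4) by (simp add: distrib_left sum.distrib mult.left_commute[of _ "\<alpha> z"] flip: sum_distrib_left)
    hence "\<beta> z * (\<Sum>i\<in>UNIV. c $ i * y i z) = 0"
      using elim(2) by (simp add: sum_distrib_left mult.left_commute)
    thus ?case using elim(5) by simp
  qed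
  thus "c = 0" using y by (simp add: is_fundamental_system_def)
qed

section \<open>Solutions on discs and change of base point\<close>

lemma is_solution_atI:
  assumes "open U" "a \<in> U" "y holomorphic_on U" "\<And>z. z \<in> U \<Longrightarrow> deriv (deriv y) z = q z * y z"
  shows "is_solution_at q a y"
  unfolding is_solution_at_def using assms eventually_nhds_in_open[OF assms(1,2)]
  by (auto simp: analytic_at elim!: eventually_mono)

lemma is_solutions_atE:
  fixes y :: "'i :: finite \<Rightarrow> complex \<Rightarrow> complex"
  assumes "\<And>i. is_solution_at q a (y i)" "open V" "a \<in> V"
  obtains r where "r > 0" "ball a r \<subseteq> V" "\<And>i. y i holomorphic_on ball a r"
    "\<And>i z. z \<in> ball a r \<Longrightarrow> deriv (deriv (y i)) z = q z * y i z"
proof -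
  have "\<forall>\<^sub>F z in nhds a. \<forall>i. y i analytic_on {z} \<and> deriv (deriv (y i)) z = q z * y i z"
  proof (rule eventually_all_finite)
    fix i
    obtain U where "open U" "a \<in> U" "y i holomorphic_on U"
      using assms(1)[of i] analytic_at unfolding is_solution_at_def by blast
    hence "\<forall>\<^sub>F z in nhds a. y i analytic_on {z}" using analytic_at[of "y i"] by
        (auto simp: eventually_nhds)
    moreover have "\<forall>\<^sub>F z in nhds a. deriv (deriv (y i)) z = q z * y i z"
      using assms(1)[of i] by (simp add: is_solution_at_def)
    ultimately show "\<forall>\<^sub>F z in nhds a. y i analytic_on {z} \<and> deriv (deriv (y i)) z = q z * y i z"
      by eventually_elim simp
  qed
  moreover have "\<forall>\<^sub>F z in nhds a. z \<in> V" using assms(2,3) by (rule eventually_nhds_in_open)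
  ultimately have "\<forall>\<^sub>F z in nhds a. z \<in> V \<and> (\<forall>i. y i analytic_on {z} \<and> deriv (deriv (y i)) z =
      q z * y i z)"
    by eventually_elim simp
  then obtain r where r: "r > 0"
    "\<And>z. z \<in> ball a r \<Longrightarrow> z \<in> V \<and> (\<forall>i. y i analytic_on {z} \<and> deriv (deriv (y i)) z = q z * y i z)"
    unfolding eventually_nhds_metric by (auto simp: dist_commute)
  have "y i holomorphic_on ball a r" for i
    using r(2) analytic_on_analytic_at analytic_imp_holomorphic by blast
  thus ?thesis using that[of r] r by blast
qed

text \<open>A loop at b is prolonged by a short path in the disc and its translate. The functions y
  are the same at both base points, so the matrix is unchanged and not merely conjugated.\<close>

lemma monodromy_group_base_point:
  fixes y :: "2 \<Rightarrow> complex \<Rightarrow> complex"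
  assumes S: "countable S" "a \<notin> S" "b \<notin> S" "\<And>z \<omega>. z \<notin> S \<Longrightarrow> \<omega> \<in> period_lattice \<tau> \<Longrightarrow> z + \<omega> \<notin> S"
    and r: "b \<in> ball a r" "\<And>i. y i holomorphic_on ball a r"
  shows "monodromy_group \<tau> S b y \<subseteq> monodromy_group \<tau> S a y"
proof
  fix M assume "M \<in> monodromy_group \<tau> S b y"
  then obtain \<omega> where \<omega>: "\<omega> \<in> period_lattice \<tau>"
    and j: "joined S b y (b + \<omega>) (\<lambda>i z. \<Sum>j\<in>UNIV. M $ i $ j * y j (z - \<omega>))"
    by (auto simp: monodromy_group_iff)
  have r0: "r > 0" using r(1)
      by (metis dist_not_less_zero mem_ball not_less_iff_gr_or_eq order_less_trans)
  have "joined S a y b y"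
    using S r r0 by (intro joined_local[of "ball a r"]) (auto simp: analytic_on_open)
  moreover have "joined S (b + \<omega>) (\<lambda>i z. \<Sum>j\<in>UNIV. M $ i $ j * y j (z - \<omega>))
     (a + \<omega>) (\<lambda>i z. \<Sum>j\<in>UNIV. M $ i $ j * y j (z - \<omega>))"
  proof (rule joined_local[of "ball (a + \<omega>) r"])
    have "(\<lambda>z. y j (z - \<omega>)) holomorphic_on ball (a + \<omega>) r" for j
      by (rule holomorphic_on_compose_gen[of "\<lambda>z. z - \<omega>" _ "y j" "ball a r", unfolded o_def])
         (use r in \<open>auto intro!: holomorphic_intros simp: dist_norm algebra_simps\<close>)
    thus "(\<lambda>z. \<Sum>j\<in>UNIV. M $ i $ j * y j (z - \<omega>)) analytic_on ball (a + \<omega>) r" for i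
      by (auto simp: analytic_on_open intro!: holomorphic_intros)
  qed (use S \<omega> r r0 in auto)
  ultimately have "joined S a y (a + \<omega>) (\<lambda>i z. \<Sum>j\<in>UNIV. M $ i $ j * y j (z - \<omega>))"
    using j joined_trans by blast
  thus "M \<in> monodromy_group \<tau> S a y" using \<omega> by (auto simp: monodromy_group_iff)
qed

section \<open>The main result\<close>

context upper_half_plane
begin

lemma gle1_singular_points_add:
  "z \<notin> gle1_singular_points \<tau> p \<Longrightarrow> \<omega> \<in> \<Lambda> \<Longrightarrow> z + \<omega> \<notin> gle1_singular_points \<tau> p"
  using period_lattice_add_iff[of \<omega> \<tau> z] period_lattice_add_iff[of \<omega> \<tau> "z - p"]
    period_lattice_add_iff[of \<omega> \<tau> "z + p"]
  by (simp add: gle1_singular_points_def algebra_simps)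

lemma monodromy_group_mono_singular:
  fixes y :: "2 \<Rightarrow> complex \<Rightarrow> complex"
  assumes "S' \<subseteq> S"
  shows "monodromy_group \<tau> S a y \<subseteq> monodromy_group \<tau> S' a y"
  unfolding subset_iff monodromy_group_iff using joined_mono[OF _ assms] by blast

text \<open>Enlarging the singular set by countably many points loses no monodromy matrices, as
  \<open>joined_avoiding\<close> reroutes every path; all translates of the base point have to be
  regular because any of them may be the end of a path.\<close>

lemma monodromy_group_avoiding:
  fixes y :: "2 \<Rightarrow> complex \<Rightarrow> complex"
  assumes "countable S" "a \<notin> S" "\<And>\<omega>. \<omega> \<in> \<Lambda> \<Longrightarrow> a + \<omega> \<notin> S"
  shows "monodromy_group \<tau> S' a y \<subseteq> monodromy_group \<tau> S a y"
  using joined_avoiding[OF _ assms(1,2) assms(3)] by (fastforce simp: monodromy_group_iff)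

lemma monodromy_group_cong:
  fixes y y' :: "2 \<Rightarrow> complex \<Rightarrow> complex"
  assumes "\<And>i. \<forall>\<^sub>F z in nhds a. y i z = y' i z"
  shows "monodromy_group \<tau> S a y \<subseteq> monodromy_group \<tau> S a y'"
proof
  fix M assume "M \<in> monodromy_group \<tau> S a y"
  then obtain \<omega> where \<omega>: "\<omega> \<in> \<Lambda>"
    and j: "joined S a y (a + \<omega>) (\<lambda>i z. \<Sum>j\<in>UNIV. M $ i $ j * y j (z - \<omega>))"
    by (auto simp: monodromy_group_iff)
  have "\<forall>\<^sub>F z in nhds a. \<forall>j. y j z = y' j z" by (rule eventually_all_finite) (rule assms)
  hence "\<forall>\<^sub>F z in nhds (a + \<omega>). \<forall>j. y j (z - \<omega>) = y' j (z - \<omega>)" by (simp add: eventually_nhds_shift)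
  hence "\<forall>\<^sub>F z in nhds (a + \<omega>). (\<Sum>j\<in>UNIV. M $ i $ j * y j (z - \<omega>)) =
      (\<Sum>j\<in>UNIV. M $ i $ j * y' j (z - \<omega>))" for i
    by eventually_elim simp
  hence "joined S a y' (a + \<omega>) (\<lambda>i z. \<Sum>j\<in>UNIV. M $ i $ j * y' j (z - \<omega>))"
    by (rule joined_cong[OF j assms])
  thus "M \<in> monodromy_group \<tau> S a y'" using \<omega> by (auto simp: monodromy_group_iff)
qed

text \<open>In either direction only one inclusion is shown: every matrix of the transformed system
  is, up to sign, a matrix of the given system with finite group. To this end the transformed system
  is sent back by the inverse transformation.\<close>

lemma gle1_finite_monodromy_iff:
  assumes n: "n > 0" and fam: "(p, T) \<in> gle1_family n \<tau> B"
  shows "gle1_finite_monodromy n \<tau> p T \<longleftrightarrow> lame_finite_monodromy n \<tau> B"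
proof -
  have p: "2 * p \<notin> \<Lambda>" and T: "T\<^sup>2 = of_nat (n * (n + 1)) * wp \<tau> p + B"
    using fam by (auto simp: gle1_family_def)
  have p': "p \<notin> \<Lambda>" using p by (metis mult_2 period_lattice_add)
  define N :: complex where "N = of_nat (n * (n + 1))"
  have N: "N \<noteq> 0" unfolding N_def of_nat_eq_0_iff using n by simp
  define S where "S = gle1_singular_points \<tau> p"
  define g where "g = (\<lambda>z. N * (wp \<tau> z - wp \<tau> p))"
  define g1 where "g1 = (\<lambda>z. N * deriv (wp \<tau>) z)"
  define g2 where "g2 = (\<lambda>z. N * deriv (deriv (wp \<tau>)) z)"
  have S\<Lambda>: "\<Lambda> \<subseteq> S" by (auto simp: S_def gle1_singular_points_def)
  have Sopen: "open (- S)" unfolding S_def by (rule open_minus_gle1_singular_points)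
  have Scount: "countable S" unfolding S_def by (rule countable_gle1_singular_points)
  have Sper: "z + \<omega> \<notin> S" if "z \<notin> S" "\<omega> \<in> \<Lambda>" for z \<omega>
    using gle1_singular_points_add that by (simp add: S_def)
  have gan: "g analytic_on {z}" if "z \<notin> S" for z
    unfolding g_def using that S\<Lambda> by (intro analytic_intros wp_analytic) auto
  have gnz: "g z \<noteq> 0" if "z \<notin> S" for z
    using wp_neq_wp[OF p'] N that by (simp add: g_def S_def)
  have gper: "g (z + \<omega>) = g z" if "z \<notin> S" "\<omega> \<in> \<Lambda>" for z \<omega>
    using wp_periodic[of \<omega> z] that S\<Lambda> by (auto simp: g_def)
  have nbhd: "\<exists>V. open V \<and> a \<in> V \<and> V \<subseteq> - S \<and> sqrt_germ g a holomorphic_on V" if a: "a \<notin> S" for a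
  proof -
    obtain W where "open W" "a \<in> W" "sqrt_germ g a holomorphic_on W"
      using sqrt_germ_analytic[OF gan gnz] a analytic_at by blast
    thus ?thesis using Sopen a by (intro exI[of _ "W \<inter> - S"]) (auto elim: holomorphic_on_subset)
  qed
  have gd: "gauge_data U g g1 g2 (sqrt_germ g a)"
    if a: "a \<notin> S" and U: "open U" "U \<subseteq> - S" "sqrt_germ g a holomorphic_on U" for U a
  proof
    fix z assume "z \<in> U"
    hence z: "z \<notin> S" "z \<notin> \<Lambda>" using U(2) S\<Lambda> by auto
    show "(g has_field_derivative g1 z) (at z)" unfolding g_def g1_def
      using DERIV_wp[OF z(2)] by (auto intro!: derivative_eq_intros)
    show "(g1 has_field_derivative g2 z) (at z)" unfolding g1_def g2_def
      by (intro DERIV_cmult DERIV_wp' z)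
    show "g z \<noteq> 0" by (rule gnz[OF z(1)])
    show "(sqrt_germ g a z)\<^sup>2 = g z" using gnz z a by (intro sqrt_germ_power2) auto
  qed (use U in auto)
  have pot: "gle1_potential n \<tau> p T z =
      T\<^sup>2 + g z + T * (g1 z / g z) + 3 / 4 * (g1 z / g z)\<^sup>2 - g2 z / (2 * g z)" if "z \<notin> S" for z
    unfolding g_def g1_def g2_def N_def by (rule gle1_potential_eq[OF p T n that[unfolded S_def]])
  \<comment> \<open>Membership in the family enters here: T^2 compensates the constant -n(n+1) wp(p)
    in g and leaves B.\<close>
  have lame: "g z + T\<^sup>2 = lame_potential n \<tau> B z" for z
    unfolding T by (simp add: g_def N_def lame_potential_def algebra_simps)
  show ?thesis
  proof
    assume "gle1_finite_monodromy n \<tau> p T"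
    then obtain a y where a: "a \<notin> S"
      and y: "is_fundamental_system (gle1_potential n \<tau> p T) a y"
      and fin: "finite (monodromy_group \<tau> S a y)"
      by (auto simp: gle1_finite_monodromy_def finite_monodromy_def S_def)
    obtain V where V: "open V" "a \<in> V" "V \<subseteq> - S" "sqrt_germ g a holomorphic_on V"
      using nbhd[OF a] by blast
    have ysol: "is_solution_at (gle1_potential n \<tau> p T) a (y i)" for i
      using y by (simp add: is_fundamental_system_def)
    obtain r where r: "r > 0" "ball a r \<subseteq> V" "\<And>i. y i holomorphic_on ball a r"
      "\<And>i z. z \<in> ball a r \<Longrightarrow> deriv (deriv (y i)) z = gle1_potential n \<tau> p T z * y i z"
      using is_solutions_atE[of "gle1_potential n \<tau> p T" a y V] ysol V(1,2) by metis
    have rS: "ball a r \<subseteq> - S" using r V by blast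
    interpret gauge_data "ball a r" g g1 g2 "sqrt_germ g a" T
      using a rS holomorphic_on_subset[OF V(4) r(2)] by (intro gd) auto
    have ode: "deriv (deriv (y i)) z = Q z * y i z" if "z \<in> ball a r" for i z
      using r(4)[OF that] pot[of z] that rS by (auto simp: Q_def)
    define w where "w = (\<lambda>i. gauge (\<lambda>z. 1 / g z) (sqrt_germ g a) T (y i))"
    have w: "is_solution_at (lame_potential n \<tau> B) a (w i)" for i
      using gauge_R_holomorphic[OF r(3) ode] gauge_R_deriv2[OF r(3) ode] r(1)
      by (intro is_solution_atI[of "ball a r"]) (auto simp: w_def lame)
    have "is_fundamental_system (lame_potential n \<tau> B) a w"
    proof (rule is_fundamental_system_transfer[OF y w])
      show "\<forall>\<^sub>F z in nhds a. deriv (w i) z + - T * w i z = sqrt_germ g a z * y i z" for i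
        using eventually_U[of a] r(1) gauge_R_deriv[OF r(3) ode]
        by (auto simp: w_def elim!: eventually_mono)
      show "\<forall>\<^sub>F z in nhds a. sqrt_germ g a z \<noteq> 0"
        by (simp add: sqrt_germ_def)
    qed
    moreover have "finite (monodromy_group \<tau> \<Lambda> a w)"
    proof (rule finite_subset)
      \<comment> \<open>The round trip: by w' = T w + R y the inverse transformation of w is R (R y)
        / g, which is y again.\<close>
      define y' where "y' = (\<lambda>i. gauge (\<lambda>z. sqrt_germ g a z * (1 / g z)) (\<lambda>_. 1) (- T) (w i))"
      have yy: "\<forall>\<^sub>F z in nhds a. y' i z = y i z" for i
        using eventually_U[of a, simplified, OF r(1)]
      proof eventually_elim
        case (elim z)
        have "(sqrt_germ g a z)\<^sup>2 = g z" "g z \<noteq> 0" using R(2) nz elim by simp_all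
        moreover have "deriv (w i) z = T * w i z + sqrt_germ g a z * y i z"
          unfolding w_def by (rule gauge_R_deriv[OF r(3) ode]) (use elim in simp_all)
        moreover from calculation have "sqrt_germ g a z * (sqrt_germ g a z * y i z) / g z = y i z"
          by (simp add: power2_eq_square flip: mult.assoc)
        ultimately show ?case by (simp add: y'_def gauge_def[of _ _ "- T"])
      qed
      have wan: "w i analytic_on {a}" for i using w by (simp add: is_solution_at_def)
      show "monodromy_group \<tau> \<Lambda> a w \<subseteq> uminus ` monodromy_group \<tau> S a y \<union> monodromy_group \<tau> S a y"
      proof
        fix M assume "M \<in> monodromy_group \<tau> \<Lambda> a w"
        hence "M \<in> monodromy_group \<tau> S a w"
          using monodromy_group_avoiding[OF Scount a Sper[OF a]] by blast
        from monodromy_group_gauge(2)[OF this gan gnz gper Sopen a wan, of "- T"]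
        have "M \<in> monodromy_group \<tau> S a y' \<or> - M \<in> monodromy_group \<tau> S a y'"
          by (simp add: y'_def)
        hence "M \<in> monodromy_group \<tau> S a y \<or> - M \<in> monodromy_group \<tau> S a y"
          using monodromy_group_cong[where y = y' and y' = y and S = S, OF yy] by blast
        thus "M \<in> uminus ` monodromy_group \<tau> S a y \<union> monodromy_group \<tau> S a y"
          by (metis UnI1 UnI2 image_eqI minus_minus)
      qed
    qed (use fin in auto)
    ultimately show "lame_finite_monodromy n \<tau> B"
      using a S\<Lambda> unfolding lame_finite_monodromy_def finite_monodromy_def by blast
  next
    assume "lame_finite_monodromy n \<tau> B"
    then obtain a0 w where a0: "a0 \<notin> \<Lambda>"
      and w0: "is_fundamental_system (lame_potential n \<tau> B) a0 w"
      and fin0: "finite (monodromy_group \<tau> \<Lambda> a0 w)"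
      by (auto simp: lame_finite_monodromy_def finite_monodromy_def)
    have w0sol: "is_solution_at (lame_potential n \<tau> B) a0 (w i)" for i
      using w0 by (simp add: is_fundamental_system_def)
    obtain r0 where r0: "r0 > 0" "ball a0 r0 \<subseteq> - \<Lambda>" "\<And>i. w i holomorphic_on ball a0 r0"
      "\<And>i z. z \<in> ball a0 r0 \<Longrightarrow> deriv (deriv (w i)) z = lame_potential n \<tau> B z * w i z"
      using is_solutions_atE[of "lame_potential n \<tau> B" a0 w "- \<Lambda>"] w0sol open_minus_lattice a0 
      by (metis ComplI)
    have "\<forall>\<^sub>F z in nhds a0. z \<in> ball a0 r0" using r0(1) by (intro eventually_nhds_in_open) auto
    \<comment> \<open>The given base point may be congruent to p or -p. A nearby point outside the
      countable set S is regular for both equations.\<close>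
    then obtain a where a: "a \<notin> S" "a \<in> ball a0 r0"
      by (rule eventually_nhds_not_countable[OF _ Scount])
    have "monodromy_group \<tau> \<Lambda> a w \<subseteq> monodromy_group \<tau> \<Lambda> a0 w"
      using a a0 r0(3) S\<Lambda> countable_period_lattice
      by (intro monodromy_group_base_point[of _ _ _ _ r0]) auto
    hence fin: "finite (monodromy_group \<tau> \<Lambda> a w)" using fin0 finite_subset by blast
    have wsol: "is_solution_at (lame_potential n \<tau> B) a (w i)" for i
      using a(2) r0 by (intro is_solution_atI[of "ball a0 r0"]) auto
    \<comment> \<open>A linear relation between the germs at a extends over the disc around a0 by
      the identity theorem, so it is also a relation between the germs at a0.\<close>
    have w: "is_fundamental_system (lame_potential n \<tau> B) a w"
      unfolding is_fundamental_system_def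
    proof (intro conjI allI impI wsol)
      fix c :: "complex ^ 2"
      assume "\<forall>\<^sub>F z in nhds a. (\<Sum>i\<in>UNIV. c $ i * w i z) = 0"
      moreover have "\<forall>\<^sub>F z in nhds a. z \<in> ball a0 r0" using a(2)
          by (intro eventually_nhds_in_open) auto
      ultimately have "\<forall>\<^sub>F z in nhds a. (\<Sum>i\<in>UNIV. c $ i * w i z) = 0 \<and> z \<in> ball a0 r0"
        by eventually_elim simp
      then obtain W where "open W" "a \<in> W"
        "\<forall>z\<in>W. (\<Sum>i\<in>UNIV. c $ i * w i z) = 0 \<and> z \<in> ball a0 r0"
        unfolding eventually_nhds by blast
      hence W: "open W" "a \<in> W" "\<And>z. z \<in> W \<Longrightarrow> (\<Sum>i\<in>UNIV. c $ i * w i z) = 0"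
        "W \<subseteq> ball a0 r0" by blast+
      have "(\<Sum>i\<in>UNIV. c $ i * w i z) = 0" if "z \<in> ball a0 r0" for z
        using W that r0(3)
        by (intro analytic_continuation_open[of W "ball a0 r0" "\<lambda>z. \<Sum>i\<in>UNIV. c $ i * w i z" "\<lambda>_. 0" z])
           (auto intro!: holomorphic_intros)
      hence "\<forall>\<^sub>F z in nhds a0. (\<Sum>i\<in>UNIV. c $ i * w i z) = 0"
        using eventually_nhds_in_open[of "ball a0 r0" a0] r0(1) by (auto elim!: eventually_mono)
      thus "c = 0" using w0 by (simp add: is_fundamental_system_def)
    qed
    obtain V where V: "open V" "a \<in> V" "V \<subseteq> - S" "sqrt_germ g a holomorphic_on V"
      using nbhd[OF a(1)] by blast
    obtain r where r: "r > 0" "ball a r \<subseteq> V" "\<And>i. w i holomorphic_on ball a r"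
      "\<And>i z. z \<in> ball a r \<Longrightarrow> deriv (deriv (w i)) z = lame_potential n \<tau> B z * w i z"
      using is_solutions_atE[of "lame_potential n \<tau> B" a w V] wsol V(1,2) by metis
    have rS: "ball a r \<subseteq> - S" using r V by blast
    interpret gauge_data "ball a r" g g1 g2 "sqrt_germ g a" T
      using a rS holomorphic_on_subset[OF V(4) r(2)] by (intro gd) auto
    have ode: "deriv (deriv (w i)) z = (g z + T\<^sup>2) * w i z" if "z \<in> ball a r" for i z
      using r(4)[OF that] by (simp add: lame)
    define y where "y = (\<lambda>i. gauge (\<lambda>z. sqrt_germ g a z * (1 / g z)) (\<lambda>_. 1) (- T) (w i))"
    have y: "is_solution_at (gle1_potential n \<tau> p T) a (y i)" for i
      using gauge_rho_holomorphic[OF r(3) ode] gauge_rho_deriv2[OF r(3) ode] r(1) pot rS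
      by (intro is_solution_atI[of "ball a r"]) (auto simp: y_def Q_def subset_iff)
    have "is_fundamental_system (gle1_potential n \<tau> p T) a y"
    proof (rule is_fundamental_system_transfer[OF w y])
      show "\<forall>\<^sub>F z in nhds a. deriv (y i) z + (T + kap z) * y i z = sqrt_germ g a z * w i z" for i
        using eventually_U[of a] r(1) gauge_rho_deriv[OF r(3) ode]
        by (auto simp: y_def elim!: eventually_mono)
      show "\<forall>\<^sub>F z in nhds a. sqrt_germ g a z \<noteq> 0"
        by (simp add: sqrt_germ_def)
    qed
    moreover have "finite (monodromy_group \<tau> S a y)"
    proof (rule finite_subset)
      \<comment> \<open>The round trip in this direction: R y = w' - T w in terms of the derivative
        of w, so the derivative of R y plus T R y is w'' - T^2 w = g w, and division by g returns
        w.\<close>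
      define w' where "w' = (\<lambda>i. gauge (\<lambda>z. 1 / g z) (sqrt_germ g a) T (y i))"
      have ww: "\<forall>\<^sub>F z in nhds a. w' i z = w i z" for i
        using eventually_U[of a, simplified, OF r(1)]
      proof eventually_elim
        case (elim z)
        have Ry: "sqrt_germ g a x * y i x = deriv (w i) x - T * w i x" if "x \<in> ball a r" for x
        proof -
          have "(sqrt_germ g a x)\<^sup>2 = g x" "g x \<noteq> 0" using R(2) nz that by simp_all
          hence "sqrt_germ g a x * (sqrt_germ g a x * v) / g x = v" for v
            by (simp add: power2_eq_square flip: mult.assoc)
          thus ?thesis by (simp add: y_def gauge_def)
        qed
        have "((\<lambda>x. deriv (w i) x - T * w i x) has_field_derivative
            deriv (deriv (w i)) z - T * deriv (w i) z) (at z)"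
          using has_derivs[OF r(3) , of z i] elim by (auto intro!: derivative_eq_intros)
        from deriv_transfer[OF Ry this] elim
        have "deriv (\<lambda>x. sqrt_germ g a x * y i x) z = deriv (deriv (w i)) z - T * deriv (w i) z"
          by (intro DERIV_imp_deriv) auto
        hence "deriv (\<lambda>x. sqrt_germ g a x * y i x) z + T * (sqrt_germ g a z * y i z) =
            deriv (deriv (w i)) z - T * deriv (w i) z + T * (deriv (w i) z - T * w i z)"
          using Ry[of z] elim by simp
        also have "\<dots> = g z * w i z"
          using ode[of z i] elim by (simp add: algebra_simps power2_eq_square)
        finally show ?case using nz[of z] elim by (simp add: w'_def gauge_def[of _ _ T])
      qed
      have yan: "y i analytic_on {a}" for i using y by (simp add: is_solution_at_def)
      show "monodromy_group \<tau> S a y \<subseteq> uminus ` monodromy_group \<tau> \<Lambda> a w \<union> monodromy_group \<tau> \<Lambda> a w"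
      proof
        fix M assume M: "M \<in> monodromy_group \<tau> S a y"
        from monodromy_group_gauge(1)[OF this gan gnz gper Sopen a(1) yan, of T]
        have "M \<in> monodromy_group \<tau> S a w' \<or> - M \<in> monodromy_group \<tau> S a w'"
          by (simp add: w'_def)
        hence "M \<in> monodromy_group \<tau> \<Lambda> a w \<or> - M \<in> monodromy_group \<tau> \<Lambda> a w"
          using monodromy_group_cong[where y = w' and y' = w and S =
              S, OF ww] monodromy_group_mono_singular[OF S\<Lambda>] by blast
        thus "M \<in> uminus ` monodromy_group \<tau> \<Lambda> a w \<union> monodromy_group \<tau> \<Lambda> a w"
          by (metis UnI1 UnI2 image_eqI minus_minus)
      qed
    qed (use fin in auto)
    ultimately show "gle1_finite_monodromy n \<tau> p T"
      using a(1) unfolding gle1_finite_monodromy_def finite_monodromy_def S_def by blast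
  qed
qed

end

text \<open>Finite monodromy of the family is stated both for all members and for some member. As
  every single member is equivalent to the Lame equation, the two readings agree once the family has
  a member.\<close>

theorem corollary1p11:
  fixes n :: nat and \<tau> B :: complex
  assumes "n > 0" and "Im \<tau> > 0"
  shows "((\<forall>(p, T)\<in>gle1_family n \<tau> B. gle1_finite_monodromy n \<tau> p T)
            \<longleftrightarrow> lame_finite_monodromy n \<tau> B) \<and>
         ((\<exists>(p, T)\<in>gle1_family n \<tau> B. gle1_finite_monodromy n \<tau> p T)
            \<longleftrightarrow> lame_finite_monodromy n \<tau> B)"
proof -
  interpret upper_half_plane \<tau> by unfold_locales fact
  \<comment> \<open>The point p = 1/4 has order four on the torus, hence is not a 2-torsion point,
    and a complex square root provides T; so the family is nonempty.\<close>
  have "2 * (1 / 4) \<notin> period_lattice \<tau>" using half_period_not_in_lattice(1) by simp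
  hence "(1 / 4, csqrt (of_nat (n * (n + 1)) * wp \<tau> (1 / 4) + B)) \<in> gle1_family n \<tau> B"
    unfolding gle1_family_def by simp
  thus ?thesis using gle1_finite_monodromy_iff[OF assms(1)] by blast
qed

end
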